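(* Let $F$ be a cyclic cubic field with conductor $m=9p_1p_2\cdots p_r$, where $r\ge 2$ and $p_1,\dots,p_r$ are distinct primes congruent to $1$ modulo $3$. Let $q,q'$ be two coprime (positive) divisors of $p_1p_2\cdots p_r$. Then the unique ideal of $\mathcal{O}_F$ of norm $3q^2q'$ is well-rounded if and only if $\frac{m}{36}\le q\,q'^2\le\frac{4m}{9}$.
   Context: A cyclic cubic field is a Galois extension $F/\mathbb{Q}$ of degree $3$; its conductor $m$ is the least positive integer with $F\subseteq\mathbb{Q}(\zeta_m)$. All ideals are nonzero integral ideals of the ring of integers $\mathcal{O}_F$. An ideal is identified with the lattice in $\mathbb{R}^3$ that is its image under $x\mapsto (x,\sigma(x),\sigma^2(x))$, where $\sigma$ generates $\mathrm{Gal}(F/\mathbb{Q})$; thus $\|x\|^2=x^2+\sigma(x)^2+\sigma^2(x)^2$. A full rank lattice $L\subset\mathbb{R}^n$ is well-rounded (WR) if its set of nonzero vectors of minimal Euclidean norm contains $n$ linearly independent vectors. (Uniqueness of the ideal holds because $3,p_1,\dots,p_r$ are totally ramified in $F$.) *)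

theory Defs
  imports
    "HOL-Analysis.Analysis"
    "HOL-Algebra.Algebra"
    "HOL-Algebra.Algebraic_Closure_Type"
    "HOL-Number_Theory.Cong"
begin

text \<open>
  Number fields are subfields of the complex numbers, so that the inclusion of a field in a
  cyclotomic field is literal set inclusion.
\<close>

abbreviation CC :: "complex ring" where
  "CC \<equiv> ring_of_type_algebra"

definition gal_group :: "complex set \<Rightarrow> (complex \<Rightarrow> complex) monoid" where
  "gal_group F = (BijGroup F)
     \<lparr>carrier := {\<sigma> \<in> Bij F. \<sigma> \<in> ring_hom (CC\<lparr>carrier := F\<rparr>) (CC\<lparr>carrier := F\<rparr>) \<and> (\<forall>x\<in>\<rat>. \<sigma> x = x)}\<rparr>"

definition cyclic_cubic_field :: "complex set \<Rightarrow> bool" where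
  "cyclic_cubic_field F \<longleftrightarrow>
     subfield F CC \<and>
     ring.dimension CC 3 \<rat> F \<and>
     {x \<in> F. \<forall>\<sigma> \<in> carrier (gal_group F). \<sigma> x = x} = \<rat>"

definition cyclotomic_field :: "nat \<Rightarrow> complex set" where
  "cyclotomic_field m = generate_field CC (\<rat> \<union> {cis (2 * pi / real m)})"

text \<open>
  A relation rather than a function defined by \<open>LEAST\<close>: the latter would be an arbitrary
  number if \<open>F\<close> were contained in no cyclotomic field.
\<close>

definition is_conductor :: "complex set \<Rightarrow> nat \<Rightarrow> bool" where
  "is_conductor F m \<longleftrightarrow>
     m > 0 \<and> F \<subseteq> cyclotomic_field m \<and> (\<forall>k>0. F \<subseteq> cyclotomic_field k \<longrightarrow> m \<le> k)"

definition ring_of_integers :: "complex set \<Rightarrow> complex ring" where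
  "ring_of_integers F = CC\<lparr>carrier := {x \<in> F. algebraic_int x}\<rparr>"

definition nonzero_ideal :: "complex set \<Rightarrow> complex set \<Rightarrow> bool" where
  "nonzero_ideal F I \<longleftrightarrow> ideal I (ring_of_integers F) \<and> I \<noteq> {0}"

definition ideal_norm :: "complex set \<Rightarrow> complex set \<Rightarrow> nat" where
  "ideal_norm F I = order (ring_of_integers F Quot I)"

text \<open>
  A cyclic cubic field lies in \<open>\<real>\<close> (it is Galois of odd degree), so on such a field \<open>Re\<close>
  only changes the type.
\<close>

definition canonical_embedding :: "(complex \<Rightarrow> complex) \<Rightarrow> complex \<Rightarrow> real ^ 3" where
  "canonical_embedding \<sigma> x = vector [Re x, Re (\<sigma> x), Re (\<sigma> (\<sigma> x))]"

definition full_rank_lattice :: "'a::euclidean_space set \<Rightarrow> bool" where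
  "full_rank_lattice L \<longleftrightarrow>
     (\<exists>B. independent B \<and> card B = DIM('a) \<and>
          L = {\<Sum>b\<in>B. real_of_int (c b) *\<^sub>R b | c. True})"

definition minimal_vectors :: "'a::euclidean_space set \<Rightarrow> 'a set" where
  "minimal_vectors L = {v \<in> L. v \<noteq> 0 \<and> (\<forall>w\<in>L. w \<noteq> 0 \<longrightarrow> norm v \<le> norm w)}"

definition well_rounded :: "'a::euclidean_space set \<Rightarrow> bool" where
  "well_rounded L \<longleftrightarrow>
     full_rank_lattice L \<and>
     (\<exists>S \<subseteq> minimal_vectors L. independent S \<and> card S = DIM('a))"

end

theory Submission
  imports Defs "Jordan_Normal_Form.Char_Poly" "HOL-Number_Theory.Residues" "HOL-Algebra.Sylow"
begin

text \<open>
  The idea is to make the field, its integers and the ideal in question completely explicit, so that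
  the lattice becomes a concrete lattice with one free parameter.

  Put \<open>n = p\<^sub>1 \<dots> p\<^sub>r\<close>, so that \<open>m = 9 n\<close>, and let \<open>\<omega>\<close> be a primitive cube root of unity. Since \<open>F\<close> lies in
  the \<open>m\<close>-th cyclotomic field, the substitutions \<open>\<zeta> \<mapsto> \<zeta>\<^sup>a\<close> act on \<open>F\<close> through the powers of \<open>\<sigma>\<close>, which gives
  a cubic character modulo \<open>m\<close>; it is primitive because no smaller cyclotomic field contains \<open>F\<close>.
  Its Gauss sum \<open>\<tau>\<close> has \<open>\<tau> cnj \<tau> = m\<close> and \<open>\<tau>\<^sup>3 = 27 n \<pi>\<close> with \<open>\<pi> = a + b \<omega>\<close> of norm \<open>n\<close> and \<open>b\<close> prime to \<open>3\<close>
  (\<open>gauss_sum_cube\<close>), and the Lagrange resolvents of elements of \<open>F\<close> are multiples of \<open>\<tau>\<close>. So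
  \<open>\<theta> = \<tau> / 3\<close> satisfies \<open>\<theta> cnj \<theta> = n\<close> and \<open>\<theta>\<^sup>3 = n \<pi>\<close>, and \<open>\<theta> + cnj \<theta>\<close> generates \<open>F\<close> (\<open>gauss_generator\<close>).

  The ring of integers consists of the numbers \<open>E k u = k + u \<theta> + cnj (u \<theta>)\<close> with \<open>k\<close> an integer and \<open>u\<close> an
  Eisenstein integer (\<open>integers_E\<close>). The automorphism multiplies \<open>u\<close> by \<open>\<omega>\<^sup>2\<close>, and the squared length of
  \<open>E k u\<close> is \<open>3 k\<^sup>2 + 6 n N(u)\<close>: geometrically the integers are an orthogonal sum of a line and a
  hexagonal plane.

  Write \<open>M = q q'\<close>. Looking at norms of elements modulo the primes that divide \<open>3 q\<^sup>2 q'\<close> forces every ideal of this norm into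
  the set of \<open>E k u\<close> with \<open>M\<close> dividing \<open>k\<close>, \<open>q\<close> dividing \<open>u \<pi>\<close>, and \<open>k \<equiv> s u\<close> modulo the prime above \<open>3\<close>,
  where \<open>s = \<plusminus>1\<close>; this set is itself an ideal of norm \<open>3 q\<^sup>2 q'\<close>, whence uniqueness. The condition on
  \<open>u\<close> means \<open>u = \<kappa> z\<close> for a fixed \<open>\<kappa>\<close> of norm \<open>q\<close>. Hence the lattice consists of the pairs \<open>(j, z)\<close> with
  \<open>j \<equiv> z\<close> modulo the prime above \<open>3\<close>, with squared length \<open>A j\<^sup>2 + B N(z)\<close> for \<open>A = 3 M\<^sup>2\<close> and \<open>B = 6 n q\<close>. Its
  shortest vectors are found among those of squared length \<open>A + B\<close> (three independent ones), those on
  the axis, of squared length \<open>9 A\<close>, and those in the plane, of squared length \<open>3 B\<close>. It is therefore well-rounded if and only if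
  \<open>A + B \<le> 9 A\<close> and \<open>A + B \<le> 3 B\<close>, which are the two inequalities of the theorem
  (\<open>well_rounded_iff\<close>).
\<close>

hide_const (open) up_ring.coeff up_ring.monom Module.smult Divisibility.prime Polynomials.lead_coeff Polynomials.degree

section \<open>Algebraic integers form a ring\<close>

text \<open>
  Finitely generated subgroups of the complex numbers; an element that multiplies such a group
  into itself is integral.
\<close>

definition int_span :: "complex set \<Rightarrow> complex set" where
  "int_span V = {\<Sum>v\<in>V. of_int (c v) * v | c. True}"

lemma int_span_base: "finite V \<Longrightarrow> v \<in> V \<Longrightarrow> v \<in> int_span V"
  unfolding int_span_def
  by (auto intro!: exI[of _ "\<lambda>u. if u = v then 1 else 0"] simp: if_distrib[of of_int] if_distrib[of "\<lambda>x. x * _"] sum.delta cong: if_cong)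

lemma int_span_add: "x \<in> int_span V \<Longrightarrow> y \<in> int_span V \<Longrightarrow> x + y \<in> int_span V"
  unfolding int_span_def
proof clarify
  fix c d
  show "\<exists>e. (\<Sum>v\<in>V. of_int (c v) * v) + (\<Sum>v\<in>V. of_int (d v) * v) = (\<Sum>v\<in>V. of_int (e v) * v) \<and> True"
    by (intro exI[of _ "\<lambda>v. c v + d v"]) (simp add: sum.distrib algebra_simps)
qed

lemma int_span_scale: "x \<in> int_span V \<Longrightarrow> of_int k * x \<in> int_span V"
  unfolding int_span_def
proof clarify
  fix c
  show "\<exists>e. of_int k * (\<Sum>v\<in>V. of_int (c v) * v) = (\<Sum>v\<in>V. of_int (e v) * v) \<and> True"
    by (intro exI[of _ "\<lambda>v. k * c v"]) (simp add: sum_distrib_left algebra_simps)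
qed

lemma int_span_sum:
  "(\<And>i. i \<in> A \<Longrightarrow> f i \<in> int_span V) \<Longrightarrow> (\<Sum>i\<in>A. f i) \<in> int_span V"
proof (induction A rule: infinite_finite_induct)
  case empty
  show ?case unfolding int_span_def by (auto intro!: exI[of _ "\<lambda>_. 0"])
next
  case (infinite A)
  then show ?case unfolding int_span_def by (auto intro!: exI[of _ "\<lambda>_. 0"])
qed (simp add: int_span_add)

text \<open>
  Cayley-Hamilton in the form needed here: multiplication by \<open>x\<close> is given on the
  generators by an integer matrix, so \<open>x\<close> is an eigenvalue of it and a root of its
  monic integer characteristic polynomial.
\<close>

lemma algebraic_int_if_stable:
  assumes fin: "finite V" and v0: "v0 \<in> V" "v0 \<noteq> 0" and st: "\<And>v. v \<in> V \<Longrightarrow> x * v \<in> int_span V"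
  shows "algebraic_int x"
proof -
  obtain vs where vs: "set vs = V" "distinct vs" using finite_distinct_list[OF fin] by blast
  define n where "n = length vs"
  have bij: "bij_betw ((!) vs) {..<n} V" using bij_betw_nth[OF vs(2) _ vs(1)[symmetric]] by (auto simp: n_def)
  have "\<forall>v\<in>V. \<exists>c. x * v = (\<Sum>u\<in>V. of_int (c u) * u)" using st unfolding int_span_def by auto
  then obtain c where c: "\<And>v. v \<in> V \<Longrightarrow> x * v = (\<Sum>u\<in>V. of_int (c v u) * u)" by metis
  define A :: "int mat" where "A = mat n n (\<lambda>(i,j). c (vs ! i) (vs ! j))"
  define B :: "complex mat" where "B = map_mat of_int A"
  define w where "w = vec n (\<lambda>i. vs ! i)"
  have A: "A \<in> carrier_mat n n" and B: "B \<in> carrier_mat n n" by (auto simp: A_def B_def)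
  have "B *\<^sub>v w = x \<cdot>\<^sub>v w"
  proof (rule eq_vecI)
    show "dim_vec (B *\<^sub>v w) = dim_vec (x \<cdot>\<^sub>v w)" using B by (auto simp: w_def)
    fix i assume "i < dim_vec (x \<cdot>\<^sub>v w)"
    then have i: "i < n" by (simp add: w_def)
    then have "vs ! i \<in> V" using vs by (auto simp: n_def)
    from c[OF this] have "x * vs ! i = (\<Sum>j<n. of_int (c (vs ! i) (vs ! j)) * vs ! j)"
      by (simp add: sum.reindex_bij_betw[OF bij, symmetric])
    then show "(B *\<^sub>v w) $ i = (x \<cdot>\<^sub>v w) $ i" using i
      by (auto simp: B_def A_def w_def scalar_prod_def lessThan_atLeast0)
  qed
  moreover have "w \<noteq> 0\<^sub>v n"
  proof
    assume "w = 0\<^sub>v n"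
    moreover from v0 vs obtain i where "i < n" "vs ! i = v0" by (metis in_set_conv_nth n_def)
    ultimately show False using v0 by (metis index_vec index_zero_vec(1) w_def)
  qed
  ultimately have "eigenvalue B x" unfolding eigenvalue_def eigenvector_def using B by (auto simp: w_def intro!: exI[of _ w])
  then have r: "poly (char_poly B) x = 0" using eigenvalue_root_char_poly[OF B] by simp
  have cB: "char_poly B = map_poly of_int (char_poly A)" unfolding B_def
    by (simp add: of_int_hom.char_poly_hom[OF A])
  show ?thesis unfolding algebraic_int_altdef_ipoly
    using r degree_monic_char_poly[OF A] by (intro exI[of _ "char_poly A"]) (simp add: cB)
qed

text \<open>
  The powers of \<open>x\<close> up to the degree of an integral equation span a group that is
  stable under multiplication by \<open>x\<close>; the products of two such systems of
  generators give closure under sum and product.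
\<close>

lemma algebraic_int_stable_module:
  assumes "algebraic_int x"
  obtains V where "finite V" "1 \<in> V" "\<And>v. v \<in> V \<Longrightarrow> x * v \<in> int_span V"
proof -
  obtain p where p: "poly (map_poly of_int p) x = 0" "lead_coeff p = 1"
    using assms unfolding algebraic_int_altdef_ipoly by blast
  define d where "d = degree p"
  define V where "V = (\<lambda>i. x ^ i) ` {..<Suc d}"
  have fin: "finite V" by (simp add: V_def)
  have s: "x ^ i \<in> int_span V" if "i < Suc d" for i
    using that by (intro int_span_base) (auto simp: V_def)
  have "d \<noteq> 0"
  proof
    assume "d = 0"
    then have "p = 1" using p(2) unfolding d_def by (metis degree_eq_zeroE degree_0 coeff_pCons_0 one_pCons)
    with p(1) show False by simp
  qed
  have "0 = (\<Sum>i\<le>d. of_int (coeff p i) * x ^ i)"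
    using p(1) by (simp add: poly_altdef coeff_map_poly degree_map_poly d_def)
  also have "\<dots> = (\<Sum>i<d. of_int (coeff p i) * x ^ i) + x ^ d"
    using p(2) by (simp add: d_def flip: lessThan_Suc_atMost)
  finally have xd: "x ^ d = (\<Sum>i<d. of_int (- coeff p i) * x ^ i)"
    by (simp add: sum_negf add_eq_0_iff2)
  have st: "x * v \<in> int_span V" if v: "v \<in> V" for v
  proof -
    from v obtain i where i: "i < Suc d" "v = x ^ i" by (auto simp: V_def)
    show ?thesis
    proof (cases "i = d")
      case False
      with i have "Suc i < Suc d" by simp
      from s[OF this] show ?thesis using i by simp
    next
      case True
      have "x * v = x * (\<Sum>i<d. of_int (- coeff p i) * x ^ i)" using i True xd by simp
      also have "\<dots> = (\<Sum>i<d. of_int (- coeff p i) * x ^ Suc i)" by (simp add: sum_distrib_left algebra_simps)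
      also have "\<dots> \<in> int_span V" by (intro int_span_sum int_span_scale s) auto
      finally show ?thesis .
    qed
  qed
  show ?thesis by (rule that[of V]) (use fin st in \<open>auto simp: V_def image_iff intro: bexI[of _ 0]\<close>)
qed

lemma
  assumes "algebraic_int x" "algebraic_int (y :: complex)"
  shows algebraic_int_add: "algebraic_int (x + y)" and algebraic_int_mult: "algebraic_int (x * y)"
proof -
  obtain V where V: "finite V" "1 \<in> V" "\<And>v. v \<in> V \<Longrightarrow> x * v \<in> int_span V" using algebraic_int_stable_module[OF assms(1)] by blast
  obtain W where W: "finite W" "1 \<in> W" "\<And>v. v \<in> W \<Longrightarrow> y * v \<in> int_span W" using algebraic_int_stable_module[OF assms(2)] by blast
  define U where "U = (\<lambda>(v,w). v * w) ` (V \<times> W)"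
  have U: "finite U" "1 \<in> U" using V W by (auto simp: U_def image_iff intro!: bexI[of _ 1])
  have VW: "a * b \<in> int_span U" if a: "a \<in> int_span V" and b: "b \<in> int_span W" for a b
  proof -
    obtain c d where "a = (\<Sum>v\<in>V. of_int (c v) * v)" "b = (\<Sum>w\<in>W. of_int (d w) * w)"
      using a b unfolding int_span_def by auto
    then have "a * b = (\<Sum>v\<in>V. \<Sum>w\<in>W. of_int (c v * d w) * (v * w))"
      by (simp add: sum_product algebra_simps)
    also have "\<dots> \<in> int_span U"
      by (intro int_span_sum int_span_scale int_span_base U(1)) (auto simp: U_def)
    finally show ?thesis .
  qed
  have x: "x * u \<in> int_span U" if "u \<in> U" for u
  proof -
    from that obtain v w where "v \<in> V" "w \<in> W" "u = v * w" by (auto simp: U_def)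
    with VW[OF V(3)[of v] int_span_base[OF W(1), of w]] show ?thesis by (simp add: mult_ac)
  qed
  have y: "y * u \<in> int_span U" if "u \<in> U" for u
  proof -
    from that obtain v w where "v \<in> V" "w \<in> W" "u = v * w" by (auto simp: U_def)
    with VW[OF int_span_base[OF V(1), of v] W(3)[of w]] show ?thesis by (simp add: mult_ac)
  qed
  have xs: "x * u \<in> int_span U" if u: "u \<in> int_span U" for u
  proof -
    obtain c where "u = (\<Sum>v\<in>U. of_int (c v) * v)" using u unfolding int_span_def by auto
    then have "x * u = (\<Sum>v\<in>U. of_int (c v) * (x * v))" by (simp add: sum_distrib_left algebra_simps)
    also have "\<dots> \<in> int_span U" by (intro int_span_sum int_span_scale x)
    finally show ?thesis .
  qed
  show "algebraic_int (x + y)"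
    by (rule algebraic_int_if_stable[OF U]) (auto simp: distrib_right intro: int_span_add x y)
  show "algebraic_int (x * y)"
    by (rule algebraic_int_if_stable[OF U]) (auto simp: mult.assoc intro: xs y)
qed

lemma algebraic_int_diff: "algebraic_int x \<Longrightarrow> algebraic_int y \<Longrightarrow> algebraic_int (x - y :: complex)"
  using algebraic_int_add[of x "- y"] by auto

lemma algebraic_int_sum: "(\<And>i. i \<in> A \<Longrightarrow> algebraic_int (f i :: complex)) \<Longrightarrow> algebraic_int (sum f A)"
  by (induction A rule: infinite_finite_induct) (auto intro: algebraic_int_add)

lemma algebraic_int_power: "algebraic_int x \<Longrightarrow> algebraic_int (x ^ k :: complex)"
  by (induction k) (auto intro: algebraic_int_mult)

lemma algebraic_int_poly:
  assumes "\<And>i. algebraic_int (coeff f i)" "algebraic_int (x :: complex)"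
  shows "algebraic_int (poly f x)"
  unfolding poly_altdef by (intro algebraic_int_sum algebraic_int_mult algebraic_int_power assms)

section \<open>Galois conjugates of roots of unity\<close>

abbreviation rpoly :: "rat poly \<Rightarrow> complex poly" where
  "rpoly \<equiv> map_poly of_rat"

interpretation rpoly_hom: map_poly_inj_idom_hom "of_rat :: rat \<Rightarrow> complex" ..

lemma rpoly_ring:
  "rpoly (f + g) = rpoly f + rpoly g" "rpoly (f - g) = rpoly f - rpoly g" "rpoly (f * g) = rpoly f * rpoly g"
  "rpoly (pcompose f g) = pcompose (rpoly f) (rpoly g)" "rpoly (pderiv f) = pderiv (rpoly f)"
  "rpoly (Polynomial.smult c f) = Polynomial.smult (of_rat c) (rpoly f)" "rpoly 1 = 1" "rpoly 0 = 0" "rpoly (monom c k) = monom (of_rat c) k"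
  by (simp_all add: hom_distribs of_rat_hom.map_poly_pcompose of_rat_hom.map_poly_pderiv map_poly_monom)

text \<open>
  By Vieta the coefficients are sums of products of roots. This makes rational factors of
  \<open>x\<^sup>m - 1\<close> integral.
\<close>

lemma coeffs_algebraic_int_if_roots:
  fixes f :: "complex poly"
  assumes "Polynomial.lead_coeff f = 1" "\<And>x. poly f x = 0 \<Longrightarrow> algebraic_int x"
  shows "algebraic_int (Polynomial.coeff f i)"
proof -
  obtain as where as: "f = (\<Prod> a \<leftarrow> as. [:- a, 1:])"
    using fundamental_theorem_algebra_factorized[of f] assms(1) by auto
  have "\<forall>a\<in>set as. algebraic_int a" using assms(2) unfolding as by (auto simp: poly_prod_list prod_list_zero_iff)
  then have "algebraic_int (Polynomial.coeff (\<Prod> a \<leftarrow> as. [:- a, 1:]) i)"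
  proof (induction as arbitrary: i)
    case (Cons a as)
    let ?g = "\<Prod> a \<leftarrow> as. [:- a, 1:]"
    have "(\<Prod> a \<leftarrow> a # as. [:- a, 1:]) = smult (- a) ?g + pCons 0 ?g" by simp
    then show ?case using Cons
      by (cases i) (auto simp: coeff_pCons intro!: algebraic_int_add algebraic_int_mult algebraic_int_diff)
  qed (auto simp: coeff_pCons split: nat.splits)
  with as show ?thesis by simp
qed

text \<open>
  Frobenius for polynomial congruences: the inner binomial coefficients are divisible by the
  prime.
\<close>

lemma freshman_dream:
  fixes x y :: complex
  assumes p: "Factorial_Ring.prime (p :: nat)" and "algebraic_int x" "algebraic_int y"
  shows "\<exists>c. algebraic_int c \<and> (x + y) ^ p = x ^ p + y ^ p + of_nat p * c"
proof -
  have p0: "p > 0" using p by (simp add: prime_gt_0_nat)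
  define c where "c = (\<Sum>k=1..<p. of_nat ((p choose k) div p) * x ^ k * y ^ (p - k))"
  have "(x + y) ^ p = (\<Sum>k\<le>p. of_nat (p choose k) * x ^ k * y ^ (p - k))" by (simp add: binomial_ring)
  also have "{..p} = insert 0 (insert p {1..<p})" using p0 by auto
  also have "(\<Sum>k\<in>\<dots>. of_nat (p choose k) * x ^ k * y ^ (p - k)) = y ^ p + (x ^ p + (\<Sum>k=1..<p. of_nat (p choose k) * x ^ k * y ^ (p - k)))"
    using p0 by (subst sum.insert) auto
  also have "(\<Sum>k=1..<p. of_nat (p choose k) * x ^ k * y ^ (p - k)) = of_nat p * c"
    unfolding c_def sum_distrib_left
  proof (rule sum.cong)
    fix k assume "k \<in> {1..<p}"
    then have "p dvd (p choose k)" using p by (intro dvd_choose_prime) auto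
    then have "of_nat (p choose k) = (of_nat p * of_nat ((p choose k) div p) :: complex)"
      by (metis dvd_mult_div_cancel of_nat_mult)
    then show "of_nat (p choose k) * x ^ k * y ^ (p - k) = of_nat p * (of_nat ((p choose k) div p) * x ^ k * y ^ (p - k))" by simp
  qed simp
  finally have "(x + y) ^ p = x ^ p + y ^ p + of_nat p * c" by simp
  moreover have "algebraic_int c" unfolding c_def
    by (intro algebraic_int_sum algebraic_int_mult algebraic_int_power assms) auto
  ultimately show ?thesis by blast
qed

lemma int_fermat: 
  assumes "Factorial_Ring.prime (p :: nat)"
  shows "int p dvd a ^ p - a"
proof -
  define k where "k = nat (a mod int p)"
  have p0: "p > 0" using assms by (simp add: prime_gt_0_nat)
  have k: "int k = a mod int p" using p0 by (simp add: k_def)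
  have "[k ^ p = k] (mod p)"
  proof (cases "p dvd k")
    case True
    then show ?thesis using p0 by (simp add: cong_def dvd_power dvd_trans)
  next
    case False
    from fermat_theorem[OF assms this] have "[k ^ (p - 1) * k = 1 * k] (mod p)" by (intro cong_mult cong_refl)
    then show ?thesis using p0 by (simp flip: power_Suc2)
  qed
  then have "[int k ^ p = int k] (mod int p)" by (metis cong_int_iff of_nat_power)
  moreover have "[a = int k] (mod int p)" by (simp add: k cong_def)
  ultimately have "[a ^ p = a] (mod int p)" by (meson cong_pow cong_sym cong_trans)
  then show ?thesis by (simp add: cong_iff_dvd_diff)
qed

lemma poly_power_prime:
  assumes p: "Factorial_Ring.prime (p :: nat)" and x: "algebraic_int (x :: complex)"
    and "\<And>i. Polynomial.coeff f i \<in> \<int>"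
  shows "\<exists>c. algebraic_int c \<and> poly f (x ^ p) = poly f x ^ p + of_nat p * c"
  using assms(3)
proof (induction f)
  case 0
  have "p > 0" using p by (simp add: prime_gt_0_nat)
  then show ?case by (intro exI[of _ 0]) auto
next
  case (pCons a f)
  have "Polynomial.coeff f i \<in> \<int>" for i using pCons.prems[of "Suc i"] by simp
  with pCons.IH obtain c where c: "algebraic_int c" "poly f (x ^ p) = poly f x ^ p + of_nat p * c" by blast
  obtain k where k: "a = of_int k" using pCons.prems[of 0] by (auto simp: Ints_def)
  obtain l where l: "k ^ p - k = int p * l" using int_fermat[OF p, of k] by (auto simp: dvd_def)
  then have "(of_int (k ^ p - k) :: complex) = of_int (int p * l)" by simp
  then have l': "a = a ^ p - of_nat p * of_int l" by (simp add: k algebra_simps)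
  have cf: "algebraic_int (Polynomial.coeff f i)" for i
    using pCons.prems[of "Suc i"] by (auto intro: int_imp_algebraic_int)
  obtain d where d: "algebraic_int d" "(a + x * poly f x) ^ p = a ^ p + (x * poly f x) ^ p + of_nat p * d"
    using freshman_dream[OF p, of a "x * poly f x"] x k cf by (auto intro!: algebraic_int_mult algebraic_int_poly)
  have "poly (pCons a f) (x ^ p) = poly (pCons a f) x ^ p + of_nat p * (x ^ p * c - d - of_int l)"
    using l' by (simp add: c(2) d(2) algebra_simps power_mult_distrib)
  moreover have "algebraic_int (x ^ p * c - d - of_int l)"
    by (intro algebraic_int_diff algebraic_int_mult algebraic_int_power x c d) auto
  ultimately show ?case by blast
qed

lemma minimal_polynomial:
  fixes z :: complex
  assumes "f0 \<noteq> 0" "poly (rpoly f0) z = 0"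
  obtains g where "Polynomial.lead_coeff g = 1" "poly (rpoly g) z = 0" "\<And>f. poly (rpoly f) z = 0 \<Longrightarrow> g dvd f"
proof -
  define P where "P f \<longleftrightarrow> f \<noteq> 0 \<and> poly (rpoly f) z = 0" for f
  obtain g0 where g0: "P g0" "\<And>f. P f \<Longrightarrow> degree g0 \<le> degree f"
    using ex_has_least_nat[of P f0 degree] assms unfolding P_def by blast
  define g where "g = Polynomial.smult (1 / Polynomial.lead_coeff g0) g0"
  have g: "Polynomial.lead_coeff g = 1" "poly (rpoly g) z = 0" "degree g = degree g0" "g \<noteq> 0"
    using g0(1) by (auto simp: g_def P_def rpoly_ring)
  have "g dvd f" if f: "poly (rpoly f) z = 0" for f
  proof (rule ccontr)
    assume "\<not> g dvd f"
    then have "f mod g \<noteq> 0" by auto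
    moreover have "f = f div g * g + f mod g" by simp
    then have "rpoly f = rpoly (f div g) * rpoly g + rpoly (f mod g)" by (metis rpoly_ring(1,3))
    with f g have "poly (rpoly (f mod g)) z = 0" by simp
    ultimately have "degree g0 \<le> degree (f mod g)" by (intro g0) (simp add: P_def)
    with \<open>f mod g \<noteq> 0\<close> g show False by (metis degree_mod_less leD)
  qed
  with g that show ?thesis by blast
qed

text \<open>
  Dedekind's argument: if \<open>z\<^sup>p\<close> were not a root of the minimal polynomial of
  \<open>z\<close>, then reduction modulo \<open>p\<close> would make \<open>p\<close> divide a
  power of \<open>m\<close> in the algebraic integers.
\<close>

lemma root_of_unity_prime_power_conjugate:
  fixes z :: complex
  assumes m: "m > 0" "z ^ m = 1" and p: "Factorial_Ring.prime (p :: nat)" "\<not> p dvd m"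
    and f: "poly (rpoly f) z = 0"
  shows "poly (rpoly f) (z ^ p) = 0"
proof -
  define U :: "rat poly" where "U = monom 1 m - 1"
  have rU: "poly (rpoly U) w = w ^ m - 1" for w by (simp add: U_def rpoly_ring poly_monom)
  have dU: "poly (pderiv (rpoly U)) w = of_nat m * w ^ (m - 1)" for w
    by (simp add: U_def rpoly_ring pderiv_diff pderiv_monom poly_monom)
  have lU: "Polynomial.lead_coeff U = 1" "U \<noteq> 0"
  proof -
    have d: "degree U = m" unfolding U_def using m degree_add_eq_left[of "- 1" "monom 1 m :: rat poly"] by (simp add: degree_monom_eq)
    then show "Polynomial.lead_coeff U = 1" using m by (simp add: U_def)
    then show "U \<noteq> 0" by auto
  qed
  have zU: "poly (rpoly U) z = 0" using m rU by simp
  obtain g where g: "Polynomial.lead_coeff g = 1" "poly (rpoly g) z = 0" "\<And>f. poly (rpoly f) z = 0 \<Longrightarrow> g dvd f"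
    using minimal_polynomial[OF lU(2) zU] by blast
  obtain h where h: "U = g * h" using g(3)[OF zU] by (auto simp: dvd_def)
  have lh: "Polynomial.lead_coeff h = 1" using lU g(1) h by (simp add: lead_coeff_mult)
  have alg: "algebraic_int w" if "w ^ m = 1" for w :: complex
    by (rule algebraic_int_root[of 1 "monom 1 m"]) (use that m in \<open>auto simp: poly_monom degree_monom_eq\<close>)
  have lc: "Polynomial.lead_coeff (rpoly k) = 1" if "Polynomial.lead_coeff k = 1" for k
    using that by (simp add: of_rat_hom.degree_map_poly_hom)
  have rts: "w ^ m = 1" if "poly (rpoly g) w = 0 \<or> poly (rpoly h) w = 0" for w
    using rU[of w] that by (auto simp: h rpoly_ring)
  have gZ: "Polynomial.coeff (rpoly g) i \<in> \<int>" for i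
    by (intro rational_algebraic_int_is_int coeffs_algebraic_int_if_roots lc g(1)) (auto intro: alg rts simp: Rats_def)
  have hA: "algebraic_int (Polynomial.coeff (rpoly h) i)" for i
    by (intro coeffs_algebraic_int_if_roots lc lh) (auto intro: alg rts)
  then have hA': "algebraic_int (of_rat (Polynomial.coeff h i) :: complex)" for i by simp
  define w where "w = z ^ p"
  have wm: "w ^ m = 1" using m by (simp add: w_def power_mult[symmetric] mult.commute[of p] power_mult)
  have "poly (rpoly g) w = 0"
  proof (rule ccontr)
    assume ng: "poly (rpoly g) w \<noteq> 0"
    have hw: "poly (rpoly h) w = 0" using rU[of w] wm ng by (simp add: h rpoly_ring)
    obtain c where c: "algebraic_int c" "poly (rpoly g) w = of_nat p * c"
      using poly_power_prime[OF p(1) alg[OF m(2)] gZ] g(2) p(1) unfolding w_def by (auto simp: prime_gt_0_nat power_0_left)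
    define d where "d = poly (pderiv (rpoly h)) w"
    have d: "algebraic_int d" unfolding d_def
      by (intro algebraic_int_poly alg[OF wm]) (auto simp: coeff_pderiv simp flip: of_nat_Suc intro!: algebraic_int_mult hA')
    have "of_nat m * w ^ (m - 1) = of_nat p * c * d"
      unfolding dU[symmetric] by (simp add: h rpoly_ring pderiv_mult hw c(2) d_def)
    then have "of_nat m * (w * w ^ (m - 1)) = of_nat p * c * d * w" by simp
    also have "w * w ^ (m - 1) = 1" using m wm by (simp flip: power_Suc)
    finally have "of_nat m / of_nat p = c * d * w" using p(1) by (simp add: field_simps)
    then have "algebraic_int (of_nat m / of_nat p :: complex)" by (simp add: algebraic_int_mult c d alg wm)
    then have "(of_nat m / of_nat p :: complex) \<in> \<int>"
      by (rule rational_algebraic_int_is_int) (intro Rats_divide Rats_of_nat)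
    then obtain k where "(of_nat m / of_nat p :: complex) = of_int k" by (auto simp: Ints_def)
    then have "(of_int (int m) :: complex) = of_int (int p * k)" using p(1) by (simp add: field_simps)
    then have "int m = int p * k" unfolding of_int_eq_iff .
    then have "p dvd m" by (metis dvd_triv_left int_dvd_int_iff)
    with p(2) show False by simp
  qed
  moreover have "g dvd f" by (rule g(3)[OF f])
  ultimately show ?thesis unfolding w_def[symmetric] by (auto simp: dvd_def rpoly_ring)
qed

text \<open>
  This is irreducibility of the cyclotomic polynomial in the form in which it is used: \<open>z
  \<mapsto> z\<^sup>a\<close> preserves rational relations. It follows from the prime case by
  factoring the exponent.
\<close>

lemma root_of_unity_conjugate:
  fixes z :: complex
  assumes m: "m > 0" "z ^ m = 1" and "coprime a m" and f: "poly (rpoly f) z = 0"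
  shows "poly (rpoly f) (z ^ a) = 0"
proof (cases "a = 0")
  case True
  with assms have "m = 1" by simp
  with m f True show ?thesis by simp
next
  case False
  then show ?thesis using assms
  proof (induction a arbitrary: z rule: prime_divisors_induct)
    case (factor p x)
    have "poly (rpoly f) (z ^ p) = 0"
      by (rule root_of_unity_prime_power_conjugate[OF factor.prems(2,3) _ _ factor.prems(5)])
         (use factor in \<open>auto simp: coprime_mult_left_iff not_prime_unit dest: coprime_common_divisor\<close>)
    moreover have "(z ^ p) ^ m = 1" using factor.prems by (simp add: power_mult[symmetric] mult.commute[of p] power_mult)
    ultimately have "poly (rpoly f) ((z ^ p) ^ x) = 0"
      using factor.prems by (intro factor.IH) auto
    then show ?case by (simp add: power_mult)
  qed auto
qed

section \<open>Cyclic cubic fields\<close>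

lemma CC_simps [simp]:
  "carrier CC = UNIV" "x \<otimes>\<^bsub>CC\<^esub> y = x * y" "x \<oplus>\<^bsub>CC\<^esub> y = x + y" "\<one>\<^bsub>CC\<^esub> = 1" "\<zero>\<^bsub>CC\<^esub> = 0"
  by (auto simp: ring_of_type_algebra_def)

lemma CC_field: "field CC" by (rule field_from_type_algebra)

lemma CC_uminus [simp]: "\<ominus>\<^bsub>CC\<^esub> x = - x"
proof -
  interpret field CC by (rule CC_field)
  show ?thesis by (rule minus_equality) auto
qed

lemma CC_inv [simp]: "x \<noteq> 0 \<Longrightarrow> inv\<^bsub>CC\<^esub> x = inverse x"
proof -
  interpret field CC by (rule CC_field)
  show "x \<noteq> 0 \<Longrightarrow> ?thesis" by (intro comm_inv_char) auto
qed

lemma Rats_subfield: "subfield \<rat> CC"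
proof -
  interpret field CC by (rule CC_field)
  show ?thesis
    by (rule subfieldI'[OF subringI]) (auto simp: Rats_inverse)
qed

lemma Span_CC:
  "ring.Span CC \<rat> [] = {0}"
  "ring.Span CC \<rat> (u # us) = {k * u + v | k v. k \<in> \<rat> \<and> v \<in> ring.Span CC \<rat> us}"
proof -
  interpret field CC by (rule CC_field)
  show "Span \<rat> [] = {0}" by simp
  show "Span \<rat> (u # us) = {k * u + v | k v. k \<in> \<rat> \<and> v \<in> Span \<rat> us}"
    using line_extension_mem_iff[of _ \<rat> u "Span \<rat> us"] by auto
qed

lemma line_extension_CC: "ring.line_extension CC \<rat> u E = {k * u + v | k v. k \<in> \<rat> \<and> v \<in> E}"
proof -
  interpret field CC by (rule CC_field)
  show ?thesis using line_extension_mem_iff[of _ \<rat> u E] by auto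
qed

text \<open>
  The generator enters only through its action on elements, so the locale records an injective
  endomorphism whose fixed field is \<open>\<rat>\<close>. That it has order three is derived
  from the dimension.
\<close>

locale cyclic_cubic =
  fixes F :: "complex set" and \<sigma> :: "complex \<Rightarrow> complex"
  assumes field: "subfield F CC" and dim: "ring.dimension CC 3 \<rat> F"
    and \<sigma>_closed: "x \<in> F \<Longrightarrow> \<sigma> x \<in> F"
    and \<sigma>_add: "x \<in> F \<Longrightarrow> y \<in> F \<Longrightarrow> \<sigma> (x + y) = \<sigma> x + \<sigma> y"
    and \<sigma>_mult: "x \<in> F \<Longrightarrow> y \<in> F \<Longrightarrow> \<sigma> (x * y) = \<sigma> x * \<sigma> y"
    and \<sigma>_inj: "inj_on \<sigma> F"
    and \<sigma>_rat: "x \<in> \<rat> \<Longrightarrow> \<sigma> x = x"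
    and \<sigma>_fixed: "x \<in> F \<Longrightarrow> \<sigma> x = x \<Longrightarrow> x \<in> \<rat>"
begin

sublocale C: field CC by (rule CC_field)

lemma F_add: "x \<in> F \<Longrightarrow> y \<in> F \<Longrightarrow> x + y \<in> F"
  and F_mult: "x \<in> F \<Longrightarrow> y \<in> F \<Longrightarrow> x * y \<in> F"
  and F_uminus: "x \<in> F \<Longrightarrow> - x \<in> F"
  and F_1: "1 \<in> F" and F_0: "0 \<in> F"
  using subringE[OF subfieldE(1)[OF field]] by auto

lemma F_inverse: "x \<in> F \<Longrightarrow> inverse x \<in> F"
  using C.subfield_m_inv(1)[OF field, of x] by (cases "x = 0") auto

lemma F_diff: "x \<in> F \<Longrightarrow> y \<in> F \<Longrightarrow> x - y \<in> F"
  using F_add[of x "- y"] F_uminus by auto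

lemma F_power: "x \<in> F \<Longrightarrow> x ^ k \<in> F"
  by (induction k) (auto intro: F_1 F_mult)

lemma Rats_F: "x \<in> \<rat> \<Longrightarrow> x \<in> F"
proof -
  have n: "of_nat n \<in> F" for n by (induction n) (auto intro: F_0 F_1 F_add)
  have i: "of_int i \<in> F" for i by (cases i rule: int_cases2) (auto intro: F_uminus n)
  show "x \<in> \<rat> \<Longrightarrow> x \<in> F" by (elim Rats_cases') (auto simp: divide_inverse intro!: F_mult F_inverse i)
qed

lemmas F_closed = F_add F_mult F_uminus F_1 F_0 F_inverse F_diff F_power \<sigma>_closed

lemma \<sigma>_simps: 
  "x \<in> F \<Longrightarrow> \<sigma> (- x) = - \<sigma> x" "x \<in> F \<Longrightarrow> y \<in> F \<Longrightarrow> \<sigma> (x - y) = \<sigma> x - \<sigma> y" "\<sigma> 0 = 0" "\<sigma> 1 = 1"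
proof -
  show 0: "\<sigma> 0 = 0" "\<sigma> 1 = 1" by (auto intro: \<sigma>_rat)
  show 1: "\<sigma> (- x) = - \<sigma> x" if "x \<in> F" for x
    using \<sigma>_add[of x "- x"] that 0 by (auto simp: F_uminus minus_unique)
  show "x \<in> F \<Longrightarrow> y \<in> F \<Longrightarrow> \<sigma> (x - y) = \<sigma> x - \<sigma> y"
    using \<sigma>_add[of x "- y"] 1 F_uminus by auto
qed

lemma \<sigma>_poly:
  assumes "\<And>i. Polynomial.coeff f i \<in> \<rat>" "x \<in> F"
  shows "poly f x \<in> F" "\<sigma> (poly f x) = poly f (\<sigma> x)"
proof -
  have "poly f x \<in> F \<and> \<sigma> (poly f x) = poly f (\<sigma> x)" using assms(1)
  proof (induction f)
    case (pCons a f)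
    have "a \<in> \<rat>" "\<And>i. Polynomial.coeff f i \<in> \<rat>" using pCons.prems[of 0] pCons.prems[of "Suc _"] by auto
    then show ?case using pCons.IH assms(2) by (auto simp: \<sigma>_add \<sigma>_mult \<sigma>_rat F_closed Rats_F)
  qed (auto simp: \<sigma>_simps F_0)
  then show "poly f x \<in> F" "\<sigma> (poly f x) = poly f (\<sigma> x)" by auto
qed

lemma spanning:
  assumes "a \<in> F" "b \<in> F" "c \<in> F" "a \<noteq> 0" "\<And>r. r \<in> \<rat> \<Longrightarrow> b \<noteq> r * a"
    and "\<And>r s. r \<in> \<rat> \<Longrightarrow> s \<in> \<rat> \<Longrightarrow> c \<noteq> r * b + s * a" and "x \<in> F"
  obtains r s t where "r \<in> \<rat>" "s \<in> \<rat>" "t \<in> \<rat>" "x = r * a + s * b + t * c"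
proof -
  have "C.independent \<rat> [c, b, a]"
    using assms by (intro C.li_Cons C.li_Nil) (auto simp: line_extension_CC)
  then have "C.Span \<rat> [c, b, a] = F"
    using C.independent_length_eq_dimension[OF Rats_subfield dim, of "[c, b, a]"] assms by simp
  then have "x \<in> C.Span \<rat> [c, b, a]" using assms by simp
  then obtain t s r where *: "t \<in> \<rat>" "s \<in> \<rat>" "r \<in> \<rat>" "x = t * c + (s * b + (r * a + 0))"
    unfolding Span_CC by blast
  then show ?thesis by (intro that[of r s t]) (simp_all only: add_0_left add_0_right ac_simps)
qed

text \<open>
  A space over \<open>\<rat>\<close> with at most two generators is too small to contain
  \<open>F\<close>.
\<close>

lemma not_small:
  shows "\<exists>x\<in>F. x \<notin> \<rat>" and "b \<in> F \<Longrightarrow> b \<notin> \<rat> \<Longrightarrow> \<exists>x\<in>F. \<forall>r\<in>\<rat>. \<forall>s\<in>\<rat>. x \<noteq> r * b + s"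
proof -
  show "\<exists>x\<in>F. x \<notin> \<rat>"
  proof (rule ccontr)
    assume "\<not> ?thesis"
    then have "F = \<rat>" using Rats_F by auto
    then show False using dim C.dimension_one[OF Rats_subfield] C.dimension_is_inj[OF Rats_subfield] by fastforce
  qed
  assume b: "b \<in> F" "b \<notin> \<rat>"
  show "\<exists>x\<in>F. \<forall>r\<in>\<rat>. \<forall>s\<in>\<rat>. x \<noteq> r * b + s"
  proof (rule ccontr)
    assume c: "\<not> ?thesis"
    have ind: "C.independent \<rat> [b, 1]"
      using b by (intro C.li_Cons C.li_Nil) (auto simp: line_extension_CC)
    have sp: "C.Span \<rat> [b, 1] = {r * b + s | r s. r \<in> \<rat> \<and> s \<in> \<rat>}"
      by (auto simp: line_extension_CC)
    have "F \<subseteq> C.Span \<rat> [b, 1]" using c unfolding sp by blast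
    moreover have "C.Span \<rat> [b, 1] \<subseteq> F" using F_add[OF F_mult[OF Rats_F b(1)] Rats_F] unfolding sp by blast
    ultimately have "C.Span \<rat> [b, 1] = F" by auto
    then have "C.dimension (length [b, 1]) \<rat> F" using C.dimension_independent[OF ind] by metis
    then show False using C.dimension_is_inj[OF Rats_subfield dim] by fastforce
  qed
qed

text \<open>
  Otherwise \<open>1, b, c\<close> is a basis for some \<open>c\<close>. Expanding \<open>b
  c\<close> in it expresses \<open>c\<close> rationally, hence linearly, through
  \<open>b\<close>, since \<open>\<rat>(b)\<close> would be spanned by \<open>1\<close> and
  \<open>b\<close>.
\<close>

lemma no_quadratic:
  assumes b: "b \<in> F" "b \<notin> \<rat>" and rs: "r \<in> \<rat>" "s \<in> \<rat>"
  shows "b\<^sup>2 \<noteq> r * b + s"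
proof
  assume eq: "b\<^sup>2 = r * b + s"
  obtain c where c: "c \<in> F" "\<And>r s. r \<in> \<rat> \<Longrightarrow> s \<in> \<rat> \<Longrightarrow> c \<noteq> r * b + s" using not_small(2)[OF b] by blast
  have b1: "b \<noteq> r * 1" if "r \<in> \<rat>" for r using b that by auto
  have c1: "c \<noteq> r * b + s * 1" if "r \<in> \<rat>" "s \<in> \<rat>" for r s using c(2)[OF that] by simp
  obtain u v w where uvw: "u \<in> \<rat>" "v \<in> \<rat>" "w \<in> \<rat>" "b * c = u * 1 + v * b + w * c"
    using spanning[OF F_1 b(1) c(1) _ b1 c1 F_mult[OF b(1) c(1)]] by auto
  \<comment> \<open>(b - w) c = u + v b, and 1 / (b - w) is again a linear polynomial in b\<close>
  have bw: "b - w \<noteq> 0" using b uvw by auto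
  define N where "N = r * w + s - w\<^sup>2"
  have n1: "(b - w) * (b - (r - w)) = N" using eq by (simp add: N_def algebra_simps power2_eq_square)
  have "b - (r - w) \<noteq> 0" using b uvw rs by auto
  with n1 bw have N0: "N \<noteq> 0" by auto
  have "N * c = (u + v * b) * (b - (r - w))"
  proof -
    have "(b - w) * c = u + v * b" using uvw(4) by (simp add: algebra_simps)
    then show ?thesis using n1 by (metis mult.commute mult.left_commute)
  qed
  also have "\<dots> = v * b\<^sup>2 + (u - v * (r - w)) * b - u * (r - w)" by (simp add: algebra_simps power2_eq_square)
  also have "\<dots> = (u + v * w) * b + (v * s - u * (r - w))" unfolding eq by (simp add: algebra_simps)
  finally have "c = ((u + v * w) / N) * b + (v * s - u * (r - w)) / N" using N0 by (simp add: field_simps)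
  moreover have "(u + v * w) / N \<in> \<rat>" "(v * s - u * (r - w)) / N \<in> \<rat>" using uvw rs by (auto simp: N_def)
  ultimately show False using c(2) by blast
qed

lemma cubic_relation:
  assumes b: "b \<in> F" "b \<notin> \<rat>"  and x: "x \<in> F"
  obtains r s t where "r \<in> \<rat>" "s \<in> \<rat>" "t \<in> \<rat>" "x = r + s * b + t * b\<^sup>2"
proof -
  have b1: "b \<noteq> r * 1" if "r \<in> \<rat>" for r using b that by auto
  have c1: "b\<^sup>2 \<noteq> r * b + s * 1" if "r \<in> \<rat>" "s \<in> \<rat>" for r s using no_quadratic[OF b that] by simp
  show ?thesis using spanning[OF F_1 b(1) F_power[OF b(1)] _ b1 c1 x] that by auto
qed

text \<open>
  An irrational element satisfies a rational cubic equation; its images under the powers of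
  \<open>\<sigma>\<close> are roots of the same equation, so they must repeat.
\<close>

lemma \<sigma>_cube: 
  assumes "b \<in> F"
  shows "\<sigma> (\<sigma> (\<sigma> b)) = b"
proof (cases "b \<in> \<rat>")
  case True
  then show ?thesis by (simp add: \<sigma>_rat)
next
  case False
  obtain r s t where rst: "r \<in> \<rat>" "s \<in> \<rat>" "t \<in> \<rat>" "b ^ 3 = r + s * b + t * b\<^sup>2"
    by (rule cubic_relation[OF assms False F_power[OF assms]])
  define f where "f = [:- r, - s, - t, 1:]"
  have f0: "poly f x = x ^ 3 - (r + s * x + t * x\<^sup>2)" for x by (simp add: f_def algebra_simps power2_eq_square power3_eq_cube)
  have fQ: "Polynomial.coeff f i \<in> \<rat>" for i using rst by (auto simp: f_def coeff_pCons split: nat.splits)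
  have root: "poly f (\<sigma> x) = 0" if "x \<in> F" "poly f x = 0" for x
    using \<sigma>_poly(2)[OF fQ that(1)] that(2) by (simp add: \<sigma>_simps)
  let ?b1 = "\<sigma> b" and ?b2 = "\<sigma> (\<sigma> b)" and ?b3 = "\<sigma> (\<sigma> (\<sigma> b))"
  have inF: "?b1 \<in> F" "?b2 \<in> F" "?b3 \<in> F" using assms by (auto intro: \<sigma>_closed)
  have r: "poly f b = 0" "poly f ?b1 = 0" "poly f ?b2 = 0" "poly f ?b3 = 0"
    using rst(4) by (auto simp: f0[of b] intro!: root inF assms)
  have n1: "?b1 \<noteq> b" using False assms \<sigma>_fixed by auto
  have n2: "?b2 \<noteq> b"
  proof
    assume e: "?b2 = b"
    have "b + ?b1 \<in> \<rat>" "b * ?b1 \<in> \<rat>" using assms inF e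
      by (auto intro!: \<sigma>_fixed simp: F_closed \<sigma>_add \<sigma>_mult)
    moreover have "b\<^sup>2 = (b + ?b1) * b + - (b * ?b1)" by (simp add: algebra_simps power2_eq_square)
    ultimately show False using no_quadratic[OF assms False] by (metis Rats_minus_iff)
  qed
  have n3: "?b2 \<noteq> ?b1" using n1 \<sigma>_inj assms inF unfolding inj_on_def by blast
  have n4: "?b3 \<noteq> ?b1" using n2 \<sigma>_inj assms inF unfolding inj_on_def by blast
  have n5: "?b3 \<noteq> ?b2" using n3 \<sigma>_inj assms inF unfolding inj_on_def by blast
  show ?thesis
  proof (rule ccontr)
    assume n6: "?b3 \<noteq> b"
    have "card {b, ?b1, ?b2, ?b3} \<le> card {x. poly f x = 0}"
      using r by (intro card_mono poly_roots_finite) (auto simp: f_def)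
    also have "\<dots> \<le> degree f" by (intro card_poly_roots_bound) (auto simp: f_def)
    finally show False using n1 n2 n3 n4 n5 n6 by (auto simp: f_def)
  qed
qed

lemma symmetric_rational:
  assumes "x \<in> F"
  shows "x + \<sigma> x + \<sigma> (\<sigma> x) \<in> \<rat>" "x * \<sigma> x + \<sigma> x * \<sigma> (\<sigma> x) + \<sigma> (\<sigma> x) * x \<in> \<rat>" "x * \<sigma> x * \<sigma> (\<sigma> x) \<in> \<rat>"
  using assms by (auto intro!: \<sigma>_fixed simp: F_closed \<sigma>_add \<sigma>_mult \<sigma>_cube)

lemma Rats_real: "x \<in> \<rat> \<Longrightarrow> (x :: complex) \<in> \<real>"
  by (elim Rats_cases') (auto simp: Reals_cnj_iff)

text \<open>
  Complex conjugation permutes the three conjugates of an irrational element, so it fixes one of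
  them, and that one generates \<open>F\<close>.
\<close>

lemma F_real: assumes "x \<in> F" shows "x \<in> \<real>"
proof -
  obtain b0 where b0: "b0 \<in> F" "b0 \<notin> \<rat>" using not_small(1) by auto
  let ?b1 = "\<sigma> b0" and ?b2 = "\<sigma> (\<sigma> b0)"
  have inF: "?b1 \<in> F" "?b2 \<in> F" using b0 by (auto intro: \<sigma>_closed)
  have nQ: "?b1 \<notin> \<rat>" "?b2 \<notin> \<rat>"
    using \<sigma>_rat[of ?b1] \<sigma>_rat[of ?b2] \<sigma>_cube[OF b0(1)] b0(2) by metis+
  have e: "cnj (b0 + ?b1 + ?b2) = b0 + ?b1 + ?b2" 
      "cnj (b0 * ?b1 + ?b1 * ?b2 + ?b2 * b0) = b0 * ?b1 + ?b1 * ?b2 + ?b2 * b0"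
      "cnj (b0 * ?b1 * ?b2) = b0 * ?b1 * ?b2"
    using symmetric_rational[OF b0(1), THEN Rats_real] unfolding Reals_cnj_iff .
  define g where "g x = (x - b0) * (x - ?b1) * (x - ?b2)" for x
  have g: "g x = x ^ 3 - (b0 + ?b1 + ?b2) * x\<^sup>2 + (b0 * ?b1 + ?b1 * ?b2 + ?b2 * b0) * x - b0 * ?b1 * ?b2" for x
    by (simp add: g_def algebra_simps power2_eq_square power3_eq_cube)
  have gc: "cnj (g x) = g (cnj x)" for x
  proof -
    have "cnj (x ^ 3 - u * x\<^sup>2 + v * x - w) = cnj x ^ 3 - u * (cnj x)\<^sup>2 + v * cnj x - w"
      if "cnj u = u" "cnj v = v" "cnj w = w" for u v w using that by simp
    from this[OF e] show ?thesis unfolding g .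
  qed
  have g0: "g x = 0 \<longleftrightarrow> x = b0 \<or> x = ?b1 \<or> x = ?b2" for x
    unfolding g_def mult_eq_0_iff by (simp add: disj_assoc)
  have c: "cnj x = b0 \<or> cnj x = ?b1 \<or> cnj x = ?b2" if "x = b0 \<or> x = ?b1 \<or> x = ?b2" for x
    using that gc[of x] unfolding g0[symmetric] by (metis complex_cnj_zero)
  \<comment> \<open>an involution of a three element set has a fixed point\<close>
  have "cnj b0 = b0 \<or> cnj ?b1 = ?b1 \<or> cnj ?b2 = ?b2"
  proof -
    have i: "cnj x = y \<longrightarrow> cnj y = x" for x y by auto
    have "?b1 \<noteq> b0" "?b2 \<noteq> ?b1" "?b2 \<noteq> b0"
      using b0 inF nQ \<sigma>_fixed[of b0] \<sigma>_fixed[of ?b1] \<sigma>_fixed[of ?b2] \<sigma>_cube[OF b0(1)] by metis+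
    moreover have "cnj b0 = b0 \<or> cnj b0 = ?b1 \<or> cnj b0 = ?b2" "cnj ?b1 = b0 \<or> cnj ?b1 = ?b1 \<or> cnj ?b1 = ?b2" 
        "cnj ?b2 = b0 \<or> cnj ?b2 = ?b1 \<or> cnj ?b2 = ?b2"
      by (intro c; simp)+
    ultimately show ?thesis using i by metis
  qed
  then obtain b where b: "b \<in> F" "b \<notin> \<rat>" "b \<in> \<real>" using b0 inF nQ unfolding Reals_cnj_iff by blast
  obtain r s t where rst: "r \<in> \<rat>" "s \<in> \<rat>" "t \<in> \<rat>" "x = r + s * b + t * b\<^sup>2"
    by (rule cubic_relation[OF b(1,2) assms])
  show ?thesis unfolding rst(4) by (intro Reals_add Reals_mult Reals_power Rats_real rst b)
qed

text \<open>
  An element of trace zero and its image under \<open>\<sigma>\<close> are independent together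
  with \<open>1\<close>, so by dimension they form a basis.
\<close>

lemma trace_zero_basis:
  assumes a: "a \<in> F" "a \<noteq> 0" "a + \<sigma> a + \<sigma> (\<sigma> a) = 0" and x: "x \<in> F"
  obtains r s t where "r \<in> \<rat>" "s \<in> \<rat>" "t \<in> \<rat>" "x = r + s * a + t * \<sigma> a"
proof -
  have aQ: "a \<notin> \<rat>"
  proof
    assume "a \<in> \<rat>"
    then have "a + a + a = 0" using a(3) \<sigma>_rat by metis
    with a(2) show False by simp
  qed
  have b1: "a \<noteq> r * 1" if "r \<in> \<rat>" for r using aQ that by (metis mult_1_right)
  have c1: "\<sigma> a \<noteq> r * a + s * 1" if rs: "r \<in> \<rat>" "s \<in> \<rat>" for r s
  proof
    assume e: "\<sigma> a = r * a + s * 1"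
    have lin: "\<sigma> (r * x + s * 1) = r * \<sigma> x + s" if "x \<in> F" for x
      using rs that by (simp add: \<sigma>_add \<sigma>_mult \<sigma>_rat F_mult Rats_F)
    have e2: "\<sigma> (\<sigma> a) = r * \<sigma> a + s" using lin[OF a(1)] unfolding e[symmetric] .
    have e3: "a = r * \<sigma> (\<sigma> a) + s"
      using lin[OF \<sigma>_closed[OF a(1)]] unfolding mult_1_right e2[symmetric] \<sigma>_cube[OF a(1)] .
    have "a + \<sigma> a + \<sigma> (\<sigma> a) = (r * \<sigma> (\<sigma> a) + s) + (r * a + s * 1) + (r * \<sigma> a + s)"
      by (rule arg_cong2[OF arg_cong2[OF e3 e, of "(+)"] e2, of "(+)"])
    also have "\<dots> = r * (a + \<sigma> a + \<sigma> (\<sigma> a)) + 3 * s" by (simp add: algebra_simps)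
    finally have "a + \<sigma> a + \<sigma> (\<sigma> a) = r * (a + \<sigma> a + \<sigma> (\<sigma> a)) + 3 * s" .
    then have "0 = r * 0 + 3 * s" unfolding a(3) .
    then have s0: "s = 0" by simp
    have sa: "\<sigma> a = r * a" "\<sigma> (\<sigma> a) = r * \<sigma> a" using e e2 unfolding s0 by (simp_all only: mult_zero_left add_0_right)
    have "a = r * \<sigma> (\<sigma> a)" using e3 unfolding s0 by (simp only: add_0_right)
    also have "\<dots> = r * (r * \<sigma> a)" by (rule arg_cong[OF sa(2)])
    also have "\<dots> = r * (r * (r * a))" by (simp only: sa(1))
    finally have "a = r ^ 3 * a" by (simp only: power3_eq_cube mult.assoc)
    then have "1 * a = r ^ 3 * a" by (simp only: mult_1)
    then have r3: "r ^ 3 = 1" unfolding mult_right_cancel[OF a(2)] by (rule sym)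
    have im: "Im r = 0" using Rats_real[OF rs(1)] complex_is_Real_iff by blast
    have "r\<^sup>2 + r + 1 \<noteq> 0"
    proof
      assume "r\<^sup>2 + r + 1 = 0"
      then have "Re (r\<^sup>2 + r + 1) = 0" by (simp only: zero_complex.sel)
      then have "(2 * Re r + 1)\<^sup>2 + 3 = 0" using im by (simp add: power2_eq_square algebra_simps)
      moreover have "(2 * Re r + 1)\<^sup>2 \<ge> 0" by (rule zero_le_power2)
      ultimately show False by linarith
    qed
    moreover have "(r - 1) * (r\<^sup>2 + r + 1) = r ^ 3 - 1" by (simp add: algebra_simps power2_eq_square power3_eq_cube)
    then have "(r - 1) * (r\<^sup>2 + r + 1) = 0" unfolding r3 diff_self .
    ultimately have "r - 1 = 0" unfolding mult_eq_0_iff by blast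
    then have "r = 1" by (rule right_minus_eq[THEN iffD1])
    then have "\<sigma> a = a" using sa(1) by (simp only: mult_1)
    then show False using \<sigma>_fixed[OF a(1)] aQ by blast
  qed
  obtain u v w where "u \<in> \<rat>" "v \<in> \<rat>" "w \<in> \<rat>" "x = u * 1 + v * a + w * \<sigma> a"
    by (rule spanning[OF F_1 a(1) \<sigma>_closed[OF a(1)] one_neq_zero b1 c1 x])
  then show ?thesis using that[of u v w] by (simp only: mult_1_right)
qed

end

section \<open>Gauss sums of cubic characters\<close>

definition \<omega> :: complex where "\<omega> = cis (2 * pi / 3)"

lemma \<omega>_eq: "\<omega> = Complex (- 1 / 2) (sqrt 3 / 2)"
  by (simp add: \<omega>_def cis.ctr cos_120 sin_120)

lemma \<omega>_square: "\<omega>\<^sup>2 = - 1 - \<omega>"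
  by (simp add: \<omega>_eq power2_eq_square complex_eq_iff)

lemma \<omega>_cube: "\<omega> ^ 3 = 1"
  by (simp add: \<omega>_eq power3_eq_cube complex_eq_iff field_simps)

lemma cnj_\<omega>: "cnj \<omega> = - 1 - \<omega>"
  by (simp add: \<omega>_eq complex_eq_iff)

lemma \<omega>_mult: "\<omega> * \<omega> = - 1 - \<omega>" "\<omega> * (\<omega> * x) = - x - \<omega> * x"
proof -
  show *: "\<omega> * \<omega> = - 1 - \<omega>" using \<omega>_square by (simp only: power2_eq_square)
  have "\<omega> * (\<omega> * x) = (\<omega> * \<omega>) * x" by (simp only: mult.assoc)
  then show "\<omega> * (\<omega> * x) = - x - \<omega> * x" unfolding * by (simp add: algebra_simps)
qed

lemma cube_root_unity: "(x :: complex) ^ 3 = 1 \<longleftrightarrow> x = 1 \<or> x = \<omega> \<or> x = \<omega>\<^sup>2"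
proof -
  have "x ^ 3 - 1 = (x - 1) * (x - \<omega>) * (x - \<omega>\<^sup>2)"
    unfolding \<omega>_square by (simp add: algebra_simps power3_eq_cube \<omega>_mult)
  then have "x ^ 3 - 1 = 0 \<longleftrightarrow> x - 1 = 0 \<or> x - \<omega> = 0 \<or> x - \<omega>\<^sup>2 = 0" by (simp only: mult_eq_0_iff disj_assoc)
  then show ?thesis by (simp only: right_minus_eq)
qed

lemma \<omega>_ne: "\<omega> \<noteq> 1" "\<omega> \<noteq> 0" "\<omega>\<^sup>2 \<noteq> 1" "\<omega>\<^sup>2 \<noteq> \<omega>"
  unfolding \<omega>_square by (auto simp: \<omega>_eq complex_eq_iff)

lemma \<omega>_combination_norm:
  fixes a b :: real
  shows "(of_real a + of_real b * \<omega>) * cnj (of_real a + of_real b * \<omega>) = of_real (a\<^sup>2 - a * b + b\<^sup>2)"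
  by (simp add: cnj_\<omega> algebra_simps \<omega>_mult power2_eq_square)

text \<open>
  A set with a fixed point free map of order three splits into orbits of size three.
\<close>

lemma card_dvd_3_if_free_order_3:
  assumes "finite S" and f: "\<And>x. x \<in> S \<Longrightarrow> f x \<in> S" "\<And>x. x \<in> S \<Longrightarrow> f (f (f x)) = x" "\<And>x. x \<in> S \<Longrightarrow> f x \<noteq> x"
  shows "3 dvd card S"
  using assms
proof (induction "card S" arbitrary: S rule: less_induct)
  case less
  show ?case
  proof (cases "S = {}")
    case False
    then obtain x where x: "x \<in> S" by auto
    let ?O = "{x, f x, f (f x)}"
    have d: "f x \<noteq> x" "f (f x) \<noteq> f x" "f (f x) \<noteq> x"
      using less.prems(2-4) x by metis+
    have O: "?O \<subseteq> S" using x less.prems(2) by auto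
    have cO: "card ?O = 3" using d by auto
    have "card (S - ?O) = card S - 3" using O cO less.prems(1) card_Diff_subset[of ?O S] by simp
    moreover have "card S \<ge> 3" using card_mono[OF less.prems(1) O] cO by simp
    moreover have "3 dvd card (S - ?O)"
    proof (rule less.hyps)
      show "card (S - ?O) < card S" using calculation by simp
      show "finite (S - ?O)" using less.prems(1) by simp
      fix y assume y: "y \<in> S - ?O"
      then show "f (f (f y)) = y" "f y \<noteq> y" using less.prems by auto
      have yS: "y \<in> S" and yO: "y \<noteq> x" "y \<noteq> f x" "y \<noteq> f (f x)" using y by auto
      have fff: "f (f (f y)) = y" "f (f (f x)) = x" using less.prems(3) yS x by auto
      have "f y \<noteq> x" "f y \<noteq> f x" "f y \<noteq> f (f x)" using fff yO by metis+
      then show "f y \<in> S - ?O" using less.prems(2)[OF yS] by auto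
    qed
    ultimately show ?thesis by presburger
  qed simp
qed

text \<open>
  A primitive cubic Dirichlet character. Primitivity is expressed through the maximal proper
  divisors \<open>m div p\<close> of the modulus.
\<close>

locale cubic_character =
  fixes n m :: nat and \<psi> :: "nat \<Rightarrow> complex"
  assumes m: "m = 9 * n" and n: "n mod 3 = 1"
    and \<psi>_mult: "\<psi> (a * b) = \<psi> a * \<psi> b"
    and \<psi>_cong: "[a = b] (mod m) \<Longrightarrow> \<psi> a = \<psi> b"
    and \<psi>_zero: "\<not> coprime a m \<Longrightarrow> \<psi> a = 0"
    and \<psi>_cube: "coprime a m \<Longrightarrow> \<psi> a ^ 3 = 1"
    and \<psi>_primitive: "Factorial_Ring.prime p \<Longrightarrow> p dvd m \<Longrightarrow> \<exists>b. coprime b m \<and> [b = 1] (mod (m div p)) \<and> \<psi> b \<noteq> 1"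
begin

lemma n_pos: "n > 0" and m_pos: "m > 0" and m_ge: "m \<ge> 9"
  using n m by (auto intro!: Nat.gr0I)

lemma \<psi>_1: "\<psi> 1 = 1"
proof -
  have "\<psi> 1 * \<psi> 1 = \<psi> 1" using \<psi>_mult[of 1 1] by simp
  moreover have "\<psi> 1 \<noteq> 0" using \<psi>_cube[of 1] by auto
  ultimately show ?thesis by simp
qed

lemma \<psi>_nonzero: "\<psi> a \<noteq> 0 \<longleftrightarrow> coprime a m"
  using \<psi>_zero[of a] \<psi>_cube[of a] by auto

lemma \<psi>_cnj: "coprime a m \<Longrightarrow> \<psi> a * cnj (\<psi> a) = 1" "cnj (\<psi> a) = \<psi> a * \<psi> a"
proof -
  have "x * cnj x = 1 \<and> cnj x = x * x" if h: "x ^ 3 = 1" for x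
  proof -
    consider "x = 1" | "x = \<omega>" | "x = - 1 - \<omega>" using h unfolding cube_root_unity \<omega>_square by blast
    then show ?thesis by cases (hypsubst, simp add: cnj_\<omega> \<omega>_mult algebra_simps)+
  qed
  with \<psi>_cube \<psi>_zero show "coprime a m \<Longrightarrow> \<psi> a * cnj (\<psi> a) = 1" "cnj (\<psi> a) = \<psi> a * \<psi> a"
    by (metis, metis complex_cnj_zero mult_zero_left)
qed

lemma \<psi>_minus_1: "\<psi> (m - 1) = 1"
proof -
  obtain k where "m = k + 2" using m_ge by (intro that[of "m - 2"]) simp
  then have e: "(m - 1) * (m - 1) = 1 + m * (m - 2)" by (simp add: algebra_simps)
  have "[(m - 1) * (m - 1) = 1] (mod m)" unfolding e by (simp only: cong_def mod_mult_self2)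
  from \<psi>_cong[OF this] have "\<psi> (m - 1) * \<psi> (m - 1) = 1" unfolding \<psi>_mult \<psi>_1 .
  moreover have "\<psi> (m - 1) ^ 3 = 1"
  proof (rule \<psi>_cube)
    show "coprime (m - 1) m" using m_ge coprime_diff_one_left_nat[of m] by simp
  qed
  ultimately show ?thesis by (simp add: power3_eq_cube)
qed

definition \<zeta> :: complex where "\<zeta> = cis (2 * pi / real m)"

lemma \<zeta>_power: "\<zeta> ^ k = cis (2 * pi * real k / real m)"
  unfolding \<zeta>_def Complex.DeMoivre by (rule arg_cong[of _ _ cis]) simp

lemma \<zeta>_m: "\<zeta> ^ m = 1"
  using m_pos by (simp add: \<zeta>_power)

lemma \<zeta>_cnj: "\<zeta> * cnj \<zeta> = 1"
  by (simp add: \<zeta>_def complex_eq_iff flip: power2_eq_square)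

lemma \<zeta>_mod: "\<zeta> ^ (k mod m) = \<zeta> ^ k"
proof -
  have "\<zeta> ^ k = \<zeta> ^ (k mod m + m * (k div m))" by simp
  also have "\<dots> = \<zeta> ^ (k mod m)" unfolding power_add power_mult \<zeta>_m by simp
  finally show ?thesis by simp
qed

lemma \<zeta>_eq: "\<zeta> ^ a = \<zeta> ^ b \<longleftrightarrow> [a = b] (mod m)"
proof -
  have *: "\<zeta> ^ a = \<zeta> ^ b \<longleftrightarrow> a = b" if "a < m" "b < m" for a b
    using inj_on_eq_iff[OF bij_betw_imp_inj_on[OF Complex.bij_betw_roots_unity[OF m_pos]], of a b] that
    by (simp add: \<zeta>_power)
  show ?thesis using *[of "a mod m" "b mod m"] m_pos by (simp add: \<zeta>_mod cong_def)
qed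

lemma unit_cancel: "y * z = 1 \<Longrightarrow> x * z = 1 \<longleftrightarrow> x = y" for x y z :: complex
  by (metis mult_right_cancel mult_zero_right zero_neq_one)

lemma reindex: assumes "coprime b m" shows "(\<Sum>a<m. g (a * b mod m)) = (\<Sum>a<m. g a)"
proof (rule sum.reindex_bij_betw[of "\<lambda>a. a * b mod m" "{..<m}" "{..<m}" g])
  have "inj_on (\<lambda>a. a * b mod m) {..<m}"
  proof (rule inj_onI)
    fix x y assume "x \<in> {..<m}" "y \<in> {..<m}" "x * b mod m = y * b mod m"
    then have "[x * b = y * b] (mod m)" by (simp add: cong_def)
    then have "[x = y] (mod m)" using cong_mult_rcancel_nat assms by blast
    then show "x = y" using \<open>x \<in> _\<close> \<open>y \<in> _\<close> by (simp add: cong_def)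
  qed
  moreover have "(\<lambda>a. a * b mod m) ` {..<m} \<subseteq> {..<m}" using m_pos by auto
  ultimately show "bij_betw (\<lambda>a. a * b mod m) {..<m} {..<m}"
    by (simp add: bij_betw_def endo_inj_surj)
qed

lemma \<psi>_mod: "\<psi> (a mod m) = \<psi> a"
  by (rule \<psi>_cong) (simp add: cong_def)

definition G :: "nat \<Rightarrow> complex" where "G i = (\<Sum>a<m. \<psi> a * \<zeta> ^ (a * i))"

text \<open>
  For \<open>i\<close> prime to \<open>m\<close> substitute \<open>a i\<close> for
  \<open>a\<close>; for the other \<open>i\<close> primitivity makes the sum vanish.
\<close>

lemma G_eq: "G i = cnj (\<psi> i) * G 1"
proof (cases "coprime i m")
  case True
  have "G 1 = (\<Sum>a<m. \<psi> (a * i mod m) * \<zeta> ^ (a * i mod m))"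
    unfolding G_def using reindex[OF True, of "\<lambda>a. \<psi> a * \<zeta> ^ (a * 1)"] by simp
  also have "\<dots> = (\<Sum>a<m. \<psi> i * (\<psi> a * \<zeta> ^ (a * i)))"
    by (simp add: \<psi>_mod \<zeta>_mod \<psi>_mult mult_ac)
  also have "\<dots> = \<psi> i * G i" by (simp add: G_def sum_distrib_left)
  finally have g: "G 1 = \<psi> i * G i" .
  have "cnj (\<psi> i) * G 1 = (\<psi> i * cnj (\<psi> i)) * G i" by (subst g) (simp only: mult_ac)
  then show ?thesis using \<psi>_cnj(1)[OF True] by simp
next
  case False
  then have "gcd i m \<noteq> 1" by (simp add: coprime_iff_gcd_eq_1)
  then obtain p where p0: "Factorial_Ring.prime p" "p dvd gcd i m" using prime_factor_nat by blast
  then have p: "Factorial_Ring.prime p" "p dvd i" "p dvd m" by simp_all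
  obtain b where b: "coprime b m" "[b = 1] (mod (m div p))" "\<psi> b \<noteq> 1" using p \<psi>_primitive by blast
  have "[b * i = 1 * i] (mod m)"
  proof -
    obtain j where j: "i = p * j" using p by auto
    have "[p * b = p * 1] (mod (p * (m div p)))" using b(2) by (rule cong_cmult_leftI)
    then have "[p * b = p * 1] (mod m)" using p(3) by (simp only: dvd_mult_div_cancel)
    then have "[p * b * j = p * 1 * j] (mod m)" by (rule cong_scalar_right)
    then show ?thesis unfolding j by (simp only: mult_ac)
  qed
  then have bi: "\<zeta> ^ (b * i * a) = \<zeta> ^ (i * a)" for a
    unfolding \<zeta>_eq by (intro cong_mult) auto
  have "G i = (\<Sum>a<m. \<psi> (a * b mod m) * \<zeta> ^ ((a * b mod m) * i))"
    unfolding G_def using reindex[OF b(1), of "\<lambda>a. \<psi> a * \<zeta> ^ (a * i)"] by simp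
  also have "\<dots> = (\<Sum>a<m. \<psi> b * (\<psi> a * \<zeta> ^ (a * i)))"
  proof (rule sum.cong)
    fix a
    have "\<zeta> ^ ((a * b mod m) * i) = \<zeta> ^ (b * i * a)" unfolding \<zeta>_eq cong_def mod_mult_left_eq by (simp only: mult_ac)
    then show "\<psi> (a * b mod m) * \<zeta> ^ ((a * b mod m) * i) = \<psi> b * (\<psi> a * \<zeta> ^ (a * i))"
      unfolding bi by (simp add: \<psi>_mod \<psi>_mult mult_ac)
  qed simp
  also have "\<dots> = \<psi> b * G i" by (simp add: G_def sum_distrib_left)
  finally have "G i = 0" using b(3) by simp
  with False \<psi>_zero show ?thesis by simp
qed

lemma geometric: assumes "x ^ m = 1" shows "(\<Sum>i<m. x ^ i) = (if x = 1 then of_nat m else (0 :: complex))"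
  using assms geometric_sum[of x m] by auto

text \<open>
  Summing \<open>\<bar>G i\<bar>\<^sup>2\<close> over all residues \<open>i\<close> in two ways:
  by orthogonality of the additive characters, and by the preceding formula.
\<close>

lemma G_norm: "G 1 * cnj (G 1) = of_nat m"
proof -
  define \<phi> where "\<phi> = card {a. a < m \<and> coprime a m}"
  have "1 \<in> {a. a < m \<and> coprime a m}" using m_ge by auto
  then have \<phi>: "\<phi> \<noteq> 0" unfolding \<phi>_def by auto
  have s: "(\<Sum>a<m. \<psi> a * cnj (\<psi> a)) = of_nat \<phi>"
  proof -
    have "(\<Sum>a<m. \<psi> a * cnj (\<psi> a)) = (\<Sum>a<m. if coprime a m then 1 else 0)"
      using \<psi>_cnj(1) \<psi>_zero by (intro sum.cong) auto
    also have "\<dots> = of_nat \<phi>" unfolding \<phi>_def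
      by (subst sum.inter_filter[symmetric]) (auto simp: lessThan_def)
    finally show ?thesis .
  qed
  have x: "(\<Sum>i<m. (\<zeta> ^ a * cnj \<zeta> ^ b) ^ i) = (if a = b then of_nat m else 0)" if "a < m" "b < m" for a b
  proof -
    have "(\<zeta> ^ a * cnj \<zeta> ^ b) ^ m = 1"
      by (simp add: power_mult_distrib power_mult[symmetric] mult.commute[of _ m] power_mult \<zeta>_m flip: complex_cnj_power)
    moreover have "\<zeta> ^ a * cnj \<zeta> ^ b = 1 \<longleftrightarrow> a = b"
    proof -
      have "\<zeta> ^ b * cnj \<zeta> ^ b = 1" using \<zeta>_cnj by (simp flip: power_mult_distrib)
      then have "\<zeta> ^ a * cnj \<zeta> ^ b = 1 \<longleftrightarrow> \<zeta> ^ a = \<zeta> ^ b" by (rule unit_cancel)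
      then show ?thesis using that by (simp add: \<zeta>_eq cong_def)
    qed
    ultimately show ?thesis by (simp add: geometric)
  qed
  have "of_nat \<phi> * (G 1 * cnj (G 1)) = (\<Sum>i<m. G i * cnj (G i))"
    unfolding s[symmetric] sum_distrib_right
  proof (intro sum.cong refl)
    fix i
    have "\<psi> i * cnj (\<psi> i) * (G 1 * cnj (G 1)) = (cnj (\<psi> i) * G 1) * cnj (cnj (\<psi> i) * G 1)"
      by (simp only: complex_cnj_mult complex_cnj_cnj mult_ac)
    then show "\<psi> i * cnj (\<psi> i) * (G 1 * cnj (G 1)) = G i * cnj (G i)" by (simp only: G_eq[symmetric])
  qed
  also have "\<dots> = (\<Sum>i<m. \<Sum>a<m. \<Sum>b<m. \<psi> a * cnj (\<psi> b) * (\<zeta> ^ a * cnj \<zeta> ^ b) ^ i)"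
  proof (intro sum.cong refl)
    fix i
    have "G i * cnj (G i) = (\<Sum>a<m. \<Sum>b<m. (\<psi> a * (\<zeta> ^ a) ^ i) * (cnj (\<psi> b) * (cnj \<zeta> ^ b) ^ i))"
      by (simp only: G_def power_mult cnj_sum complex_cnj_mult complex_cnj_power sum_product)
    also have "\<dots> = (\<Sum>a<m. \<Sum>b<m. \<psi> a * cnj (\<psi> b) * (\<zeta> ^ a * cnj \<zeta> ^ b) ^ i)"
      by (intro sum.cong refl) (simp only: power_mult_distrib mult_ac)
    finally show "G i * cnj (G i) = (\<Sum>a<m. \<Sum>b<m. \<psi> a * cnj (\<psi> b) * (\<zeta> ^ a * cnj \<zeta> ^ b) ^ i)" .
  qed
  also have "\<dots> = (\<Sum>a<m. \<Sum>b<m. \<psi> a * cnj (\<psi> b) * (\<Sum>i<m. (\<zeta> ^ a * cnj \<zeta> ^ b) ^ i))"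
    unfolding sum_distrib_left by (subst sum.swap) (intro sum.cong refl sum.swap)
  also have "\<dots> = (\<Sum>a<m. \<Sum>b<m. if b = a then \<psi> a * cnj (\<psi> a) * of_nat m else 0)"
    by (intro sum.cong refl) (auto simp: x)
  also have "\<dots> = of_nat \<phi> * of_nat m" by (simp add: s flip: sum_distrib_right)
  finally show ?thesis using \<phi> by simp
qed

text \<open>
  \<open>a (1 - a)\<close> modulo \<open>m\<close>, written without subtraction below zero; its
  character value is the summand of the Jacobi sum.
\<close>

definition u :: "nat \<Rightarrow> nat" where "u a = a * (m + 1 - a)"

definition J :: complex where "J = (\<Sum>a<m. \<psi> (u a))"

text \<open>
  Evaluate the sum of \<open>(G i)\<^sup>2 cnj \<zeta> ^ i\<close> over \<open>i\<close> in two
  ways: \<open>(G i)\<^sup>2 = \<psi> i (G 1)\<^sup>2\<close> turns it into \<open>(G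
  1)\<^sup>3\<close>, and orthogonality leaves the pairs of arguments that add up to one.
\<close>

lemma G_cube: "G 1 ^ 3 = of_nat m * J"
proof -
  have c: "cnj \<zeta> ^ i = \<zeta> ^ (i * (m - 1) mod m)" for i
  proof -
    have "\<zeta> ^ (i * (m - 1)) * \<zeta> ^ i = \<zeta> ^ (i * (m - 1) + i)" by (simp add: power_add)
    also have "i * (m - 1) + i = m * i" using m_pos by (cases m) auto
    also have "\<zeta> ^ (m * i) = 1" by (simp add: power_mult \<zeta>_m)
    finally have "\<zeta> ^ (i * (m - 1)) * \<zeta> ^ i = 1" .
    moreover have "cnj \<zeta> ^ i * \<zeta> ^ i = 1" using \<zeta>_cnj by (simp add: mult.commute flip: power_mult_distrib)
    ultimately show ?thesis unfolding \<zeta>_mod by (simp only: unit_cancel)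
  qed
  have "(\<Sum>i<m. \<psi> i * cnj \<zeta> ^ i) = (\<Sum>i<m. \<psi> (i * (m - 1) mod m) * \<zeta> ^ (i * (m - 1) mod m))"
    by (simp only: c \<psi>_mod \<psi>_mult \<psi>_minus_1 mult_1_right)
  also have "\<dots> = (\<Sum>i<m. \<psi> i * \<zeta> ^ i)"
    by (rule reindex) (use coprime_diff_one_left_nat[OF m_pos] in simp)
  also have "\<dots> = G 1" by (simp only: G_def mult_1_right)
  finally have g: "(\<Sum>i<m. \<psi> i * cnj \<zeta> ^ i) = G 1" .
  have x: "(\<Sum>i<m. (\<zeta> ^ a * \<zeta> ^ b * cnj \<zeta>) ^ i) = (if b = (m + 1 - a) mod m then of_nat m else 0)" if ab: "a < m" "b < m" for a b
  proof -
    have "(\<zeta> ^ a * \<zeta> ^ b * cnj \<zeta>) ^ m = 1"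
      by (simp add: power_mult_distrib power_mult[symmetric] mult.commute[of _ m] power_mult \<zeta>_m flip: complex_cnj_power)
    moreover have "\<zeta> ^ a * \<zeta> ^ b * cnj \<zeta> = 1 \<longleftrightarrow> b = (m + 1 - a) mod m"
    proof -
      have "\<zeta> ^ a * \<zeta> ^ b * cnj \<zeta> = 1 \<longleftrightarrow> \<zeta> ^ (a + b) = \<zeta> ^ 1"
        unfolding power_add power_one_right by (rule unit_cancel[OF \<zeta>_cnj])
      also have "\<dots> \<longleftrightarrow> [a + b = 1] (mod m)" by (rule \<zeta>_eq)
      also have "\<dots> \<longleftrightarrow> [a + b = a + (m + 1 - a)] (mod m)"
      proof -
        have "a + (m + 1 - a) = m + 1" using ab by simp
        then show ?thesis by (simp only: cong_def mod_add_self1)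
      qed
      also have "\<dots> \<longleftrightarrow> [b = m + 1 - a] (mod m)" by (rule cong_add_lcancel_nat)
      also have "\<dots> \<longleftrightarrow> b = (m + 1 - a) mod m" using ab by (simp add: cong_def)
      finally show ?thesis .
    qed
    ultimately show ?thesis by (simp add: geometric)
  qed
  have "G 1 ^ 3 = (G 1)\<^sup>2 * (\<Sum>i<m. \<psi> i * cnj \<zeta> ^ i)"
    unfolding g by (simp only: power3_eq_cube power2_eq_square)
  also have "\<dots> = (\<Sum>i<m. \<psi> i * (G 1)\<^sup>2 * cnj \<zeta> ^ i)"
    unfolding sum_distrib_left by (simp only: mult_ac)
  also have "\<dots> = (\<Sum>i<m. (G i)\<^sup>2 * cnj \<zeta> ^ i)"
  proof (intro sum.cong refl)
    fix i
    have "cnj (\<psi> i) * cnj (\<psi> i) = \<psi> i"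
      using arg_cong[OF \<psi>_cnj(2)[of i], of cnj] by (simp only: complex_cnj_cnj complex_cnj_mult)
    note c = this
    have "(G i)\<^sup>2 = (cnj (\<psi> i) * G 1)\<^sup>2" by (rule arg_cong[OF G_eq])
    also have "\<dots> = (cnj (\<psi> i) * cnj (\<psi> i)) * (G 1)\<^sup>2" by (simp only: power2_eq_square mult_ac)
    finally have "(G i)\<^sup>2 = \<psi> i * (G 1)\<^sup>2" unfolding c .
    then show "\<psi> i * (G 1)\<^sup>2 * cnj \<zeta> ^ i = (G i)\<^sup>2 * cnj \<zeta> ^ i" by simp
  qed
  also have "\<dots> = (\<Sum>i<m. \<Sum>a<m. \<Sum>b<m. \<psi> a * \<psi> b * (\<zeta> ^ a * \<zeta> ^ b * cnj \<zeta>) ^ i)"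
  proof (intro sum.cong refl)
    fix i
    have "G i * G i = (\<Sum>a<m. \<Sum>b<m. (\<psi> a * (\<zeta> ^ a) ^ i) * (\<psi> b * (\<zeta> ^ b) ^ i))"
      by (simp only: G_def power_mult sum_product)
    then have "(G i)\<^sup>2 * cnj \<zeta> ^ i = (\<Sum>a<m. \<Sum>b<m. (\<psi> a * (\<zeta> ^ a) ^ i) * (\<psi> b * (\<zeta> ^ b) ^ i) * cnj \<zeta> ^ i)"
      by (simp only: power2_eq_square sum_distrib_right)
    also have "\<dots> = (\<Sum>a<m. \<Sum>b<m. \<psi> a * \<psi> b * (\<zeta> ^ a * \<zeta> ^ b * cnj \<zeta>) ^ i)"
      by (intro sum.cong refl) (simp only: power_mult_distrib mult_ac)
    finally show "(G i)\<^sup>2 * cnj \<zeta> ^ i = (\<Sum>a<m. \<Sum>b<m. \<psi> a * \<psi> b * (\<zeta> ^ a * \<zeta> ^ b * cnj \<zeta>) ^ i)" .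
  qed
  also have "\<dots> = (\<Sum>a<m. \<Sum>b<m. \<psi> a * \<psi> b * (\<Sum>i<m. (\<zeta> ^ a * \<zeta> ^ b * cnj \<zeta>) ^ i))"
    unfolding sum_distrib_left by (subst sum.swap) (intro sum.cong refl sum.swap)
  also have "\<dots> = (\<Sum>a<m. \<Sum>b<m. if b = (m + 1 - a) mod m then \<psi> a * \<psi> b * of_nat m else 0)"
    by (intro sum.cong refl) (auto simp: x)
  also have "\<dots> = (\<Sum>a<m. \<psi> a * \<psi> ((m + 1 - a) mod m) * of_nat m)"
    using m_pos by (intro sum.cong refl) (simp add: sum.delta)
  also have "\<dots> = of_nat m * J" by (simp add: J_def u_def \<psi>_mod \<psi>_mult mult_ac sum_distrib_left)
  finally show ?thesis .
qed

definition \<psi>i :: "int \<Rightarrow> complex" where "\<psi>i x = \<psi> (nat (x mod int m))"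

lemma \<psi>i_cong: "[x = y] (mod int m) \<Longrightarrow> \<psi>i x = \<psi>i y"
  by (simp add: \<psi>i_def cong_def)

lemma \<psi>i_nat: "\<psi>i (int a) = \<psi> a"
  by (simp add: \<psi>i_def \<psi>_mod flip: zmod_int)

lemma \<psi>i_obtain: obtains a where "[x = int a] (mod int m)" "\<psi>i x = \<psi> a"
  using that[of "nat (x mod int m)"] m_pos by (simp add: \<psi>i_def cong_def)

lemma \<psi>i_mult: "\<psi>i (x * y) = \<psi>i x * \<psi>i y"
proof -
  obtain a where a: "[x = int a] (mod int m)" "\<psi>i x = \<psi> a" by (rule \<psi>i_obtain)
  obtain b where b: "[y = int b] (mod int m)" "\<psi>i y = \<psi> b" by (rule \<psi>i_obtain)
  have "\<psi>i (x * y) = \<psi>i (int (a * b))"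
    using cong_mult[OF a(1) b(1)] by (intro \<psi>i_cong) simp
  then show ?thesis using a b by (simp only: \<psi>i_nat \<psi>_mult)
qed

lemma \<psi>i_coprime: "\<psi>i x \<noteq> 0 \<longleftrightarrow> coprime x (int m)" "\<psi>i x \<noteq> 0 \<Longrightarrow> \<psi>i x ^ 3 = 1"
proof -
  obtain a where a: "[x = int a] (mod int m)" "\<psi>i x = \<psi> a" by (rule \<psi>i_obtain)
  have "coprime x (int m) \<longleftrightarrow> coprime a m" using cong_imp_coprime[OF a(1)] cong_imp_coprime[OF cong_sym[OF a(1)]] by auto
  then show "\<psi>i x \<noteq> 0 \<longleftrightarrow> coprime x (int m)" "\<psi>i x \<noteq> 0 \<Longrightarrow> \<psi>i x ^ 3 = 1"
    using a \<psi>_nonzero \<psi>_cube by auto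
qed

lemma \<psi>i_minus_1: "\<psi>i (- 1) = 1"
proof -
  have "\<psi>i (- 1) = \<psi>i (int (m - 1))" using m_ge by (intro \<psi>i_cong) (simp add: cong_def of_nat_diff mod_diff_eq[symmetric])
  then show ?thesis by (simp only: \<psi>i_nat \<psi>_minus_1)
qed

lemma not_coprime_3: "3 dvd x \<Longrightarrow> \<psi>i x = 0"
proof -
  assume "3 dvd x"
  moreover have "3 dvd int m" by (simp add: m)
  ultimately have "\<not> coprime x (int m)" using coprime_common_divisor[of x "int m" 3] by auto
  then show ?thesis using \<psi>i_coprime(1) by blast
qed

definition K :: "int \<Rightarrow> complex" where "K x = \<psi>i (x * (1 - x))"

lemma K_mod_3: "K x \<noteq> 0 \<Longrightarrow> x mod 3 = 2"
proof (rule ccontr)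
  assume "K x \<noteq> 0" "x mod 3 \<noteq> 2"
  then have "x mod 3 = 0 \<or> (1 - x) mod 3 = 0" by presburger
  then have "3 dvd x * (1 - x)" by (auto simp: dvd_eq_mod_eq_0[symmetric])
  with \<open>K x \<noteq> 0\<close> show False by (simp add: K_def not_coprime_3)
qed

lemma K_cong: assumes "[x = y] (mod 3 * int n)" shows "K x = K y"
proof -
  obtain k where k: "x = y + 3 * int n * k" using assms by (metis cong_iff_lin cong_sym)
  have xy: "x mod 3 = y mod 3" unfolding k mult.assoc by (rule mod_mult_self2)
  show ?thesis
  proof (cases "y mod 3 = 2")
    case True
    then have "y = 3 * (y div 3) + 2" by presburger
    then obtain t where t: "y = 3 * t + 2" by blast
    have "x * (1 - x) = y * (1 - y) + int m * (k * (- 1 - 2 * t - int n * k))"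
      unfolding k t m by (simp add: algebra_simps)
    then show ?thesis unfolding K_def by (intro \<psi>i_cong) (simp add: cong_def)
  next
    case False
    then show ?thesis using xy K_mod_3[of x] K_mod_3[of y] by metis
  qed
qed

text \<open>
  The summand depends only on the residue modulo \<open>3 n\<close>, so each value is counted
  three times.
\<close>

lemma J_eq: "J = 3 * (\<Sum>x\<in>{0..<3 * int n}. K x)"
proof -
  have u: "\<psi> (u a) = K (int a)" if "a < m" for a
  proof -
    have "int (m + 1 - a) = int m + 1 - int a" using that by simp
    then have "int (u a) = int a * (1 - int a) + int m * int a" unfolding u_def of_nat_mult by (simp add: algebra_simps)
    then have "\<psi>i (int (u a)) = K (int a)" unfolding K_def by (intro \<psi>i_cong) (simp add: cong_def)
    then show ?thesis by (simp only: \<psi>i_nat)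
  qed
  have m3: "m = 3 * (3 * n)" by (simp add: m)
  have "J = (\<Sum>a<m. K (int a))" unfolding J_def by (intro sum.cong refl u) simp
  also have "\<dots> = (\<Sum>a<3 * (3 * n). K (int a))" by (simp only: m3)
  also have "\<dots> = (\<Sum>t<3. \<Sum>a\<in>{t * (3 * n)..<t * (3 * n) + 3 * n}. K (int a))"
    by (simp only: sum.nat_group)
  also have "\<dots> = (\<Sum>t<3::nat. \<Sum>a<3 * n. K (int a))"
  proof (rule sum.cong[OF refl])
    fix t :: nat assume "t \<in> {..<3}"
    have "(\<Sum>a\<in>{t * (3 * n)..<t * (3 * n) + 3 * n}. K (int a)) = (\<Sum>a\<in>{0 + t * (3 * n)..<3 * n + t * (3 * n)}. K (int a))"
      by (simp only: add_0 add.commute)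
    also have "\<dots> = (\<Sum>a\<in>{0..<3 * n}. K (int (a + t * (3 * n))))" by (rule sum.shift_bounds_nat_ivl)
    also have "\<dots> = (\<Sum>a<3 * n. K (int a))"
      unfolding atLeast0LessThan by (intro sum.cong refl K_cong) (simp add: cong_iff_dvd_diff)
    finally show "(\<Sum>a\<in>{t * (3 * n)..<t * (3 * n) + 3 * n}. K (int a)) = (\<Sum>a<3 * n. K (int a))" .
  qed
  also have "\<dots> = 3 * (\<Sum>a<3 * n. K (int a))" by simp
  also have "(\<Sum>a<3 * n. K (int a)) = (\<Sum>x\<in>{0..<3 * int n}. K x)"
    by (rule sum.reindex_bij_witness[of _ nat int]) auto
  finally show ?thesis .
qed

text \<open>
  The kernel of reduction from \<open>9 n\<close> to \<open>3 n\<close> is cyclic of order three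
  and primitivity makes \<open>\<psi>\<close> nontrivial on it.
\<close>

lemma \<psi>_1_6n: "\<psi>i (1 + 6 * int n) = \<omega> \<or> \<psi>i (1 + 6 * int n) = \<omega>\<^sup>2"
proof -
  obtain b where b: "coprime b m" "[b = 1] (mod (3 * n))" "\<psi> b \<noteq> 1"
  proof -
    have d: "m div 3 = 3 * n" by (simp add: m)
    have "\<exists>b. coprime b m \<and> [b = 1] (mod (m div 3)) \<and> \<psi> b \<noteq> 1" by (rule \<psi>_primitive) (simp_all add: m)
    then show ?thesis using that unfolding d by blast
  qed
  have "[int b = 1] (mod (3 * int n))" using b(2) by (metis cong_int_iff of_nat_1 of_nat_mult of_nat_numeral)
  then obtain k where k: "int b = 1 + 3 * int n * k" by (metis cong_iff_lin cong_sym)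
  define y where "y = \<psi>i (1 + 3 * int n)"
  have m9: "int m = 9 * int n" by (simp add: m)
  have sq: "\<psi>i (1 + 6 * int n) = y * y"
    unfolding y_def \<psi>i_mult[symmetric] by (rule \<psi>i_cong) (simp add: m9 cong_iff_dvd_diff algebra_simps)
  have "coprime (1 + 3 * int n) (int m)"
  proof -
    have "coprime (1 + 3 * int n) (3 * int n)" by (metis add.commute coprime_add_one_left)
    then have c: "coprime (1 + 3 * int n) 3" "coprime (1 + 3 * int n) (int n)" unfolding coprime_mult_right_iff by blast+
    have "coprime (1 + 3 * int n) (3 * (3 * int n))" unfolding coprime_mult_right_iff using c by blast
    moreover have "int m = 3 * (3 * int n)" by (simp add: m9)
    ultimately show ?thesis by (simp only:)
  qed
  then have "y \<noteq> 0" unfolding y_def by (simp only: \<psi>i_coprime(1))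
  then have y3: "y ^ 3 = 1" unfolding y_def by (rule \<psi>i_coprime(2))
  have "y \<noteq> 1"
  proof
    assume y1: "y = 1"
    have yk: "\<psi>i (1 + 3 * int n * int j) = y ^ j" for j
    proof (induction j)
      case 0
      show ?case using \<psi>i_nat[of 1] \<psi>_1 by simp
    next
      case (Suc j)
      have "\<psi>i (1 + 3 * int n * int (Suc j)) = \<psi>i ((1 + 3 * int n) * (1 + 3 * int n * int j))"
        by (rule \<psi>i_cong) (simp add: m9 cong_iff_dvd_diff algebra_simps)
      then show ?case using Suc by (simp add: \<psi>i_mult y_def)
    qed
    have "\<psi> b = \<psi>i (1 + 3 * int n * int (nat (k mod 3)))"
    proof (subst \<psi>i_nat[symmetric], rule \<psi>i_cong)
      have "int b = 1 + 3 * int n * (k mod 3) + int m * (k div 3)"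
      proof -
        have "3 * N * (3 * d + r) = 3 * N * r + 9 * N * d" for N d r :: int by (simp add: algebra_simps)
        from this[of "int n" "k div 3" "k mod 3"] show ?thesis unfolding k m9 by simp
      qed
      then show "[int b = 1 + 3 * int n * int (nat (k mod 3))] (mod int m)" by (simp add: cong_def)
    qed
    then have "\<psi> b = 1" unfolding yk y1 by (simp only: power_one)
    with b(3) show False by contradiction
  qed
  with y3 have "y = \<omega> \<or> y = \<omega>\<^sup>2" by (simp add: cube_root_unity)
  then show ?thesis
  proof
    assume "y = \<omega>" then show ?thesis unfolding sq by (simp add: power2_eq_square)
  next
    assume y: "y = \<omega>\<^sup>2"
    have "y * y = \<omega> ^ 3 * \<omega>" unfolding y by (simp only: power2_eq_square power3_eq_cube mult.assoc)
    then have "y * y = \<omega>" unfolding \<omega>_cube by (simp only: mult_1)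
    then show ?thesis unfolding sq by (rule disjI1)
  qed
qed

text \<open>
  The map \<open>x \<mapsto> 1 / (1 - x)\<close> has order three and preserves \<open>K\<close>;
  its fixed points take the excluded value.
\<close>

lemma card_K:
  assumes z: "z \<noteq> 0" "z \<noteq> \<psi>i (1 + 6 * int n)"
  shows "3 dvd card {x \<in> {0..<3 * int n}. K x = z}"
proof -
  define M where "M = 3 * int n"
  have M: "M > 0" "M dvd int m" using n_pos by (auto simp: M_def m)
  define r0 where "r0 x = (SOME r. [(1 - x) * r = 1] (mod int m))" for x
  define R where "R x = r0 x mod M" for x
  have cop: "coprime x (int m)" "coprime (1 - x) (int m)" if "K x = z" for x
  proof -
    have "\<psi>i x * \<psi>i (1 - x) \<noteq> 0" using that z(1) unfolding K_def \<psi>i_mult by simp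
    then have "\<psi>i x \<noteq> 0" "\<psi>i (1 - x) \<noteq> 0" unfolding mult_eq_0_iff by simp_all
    then show "coprime x (int m)" "coprime (1 - x) (int m)" by (simp_all only: \<psi>i_coprime(1))
  qed
  have r0: "[(1 - x) * r0 x = 1] (mod int m)" if "K x = z" for x
    unfolding r0_def by (rule someI_ex) (use cong_solve_coprime_int[OF cop(2)[OF that]] in blast)
  have RM: "M dvd R x * (1 - x) - 1" if "K x = z" for x
  proof -
    have "[R x = r0 x] (mod M)" by (simp add: R_def cong_def)
    then have "[(1 - x) * R x = (1 - x) * r0 x] (mod M)" by (rule cong_scalar_left)
    also have "[(1 - x) * r0 x = 1] (mod M)" using r0[OF that] M(2) by (rule cong_dvd_modulus)
    finally show ?thesis by (simp add: cong_iff_dvd_diff mult.commute)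
  qed
  have KR: "K (R x) = z" if x: "K x = z" for x
  proof -
    let ?r = "r0 x"
    have "K (R x) = K ?r" by (rule K_cong) (simp add: R_def M_def cong_def)
    also have "\<dots> = \<psi>i (- 1 * x * ?r * ?r)" unfolding K_def
    proof (rule \<psi>i_cong)
      have "?r * (1 - ?r) - (- 1 * x * ?r * ?r) = - ?r * ((1 - x) * ?r - 1)" by (simp add: algebra_simps)
      then show "[?r * (1 - ?r) = - 1 * x * ?r * ?r] (mod int m)"
        unfolding cong_iff_dvd_diff using r0[OF x] by (metis cong_iff_dvd_diff dvd_mult)
    qed
    also have "\<dots> = \<psi>i x * (\<psi>i ?r * \<psi>i ?r)" by (simp only: \<psi>i_mult \<psi>i_minus_1 mult_1 mult.assoc)
    also have "\<psi>i ?r * \<psi>i ?r = \<psi>i (1 - x)"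
    proof -
      have e: "\<psi>i (1 - x) * \<psi>i ?r = 1"
        using \<psi>i_cong[OF r0[OF x]] \<psi>i_nat[of 1] \<psi>_1 by (simp add: \<psi>i_mult)
      have "\<psi>i ?r \<noteq> 0" using e by auto
      then have "\<psi>i ?r ^ 3 = 1" by (rule \<psi>i_coprime(2))
      then have "(\<psi>i ?r * \<psi>i ?r) * \<psi>i ?r = 1" by (simp only: power3_eq_cube)
      with e show ?thesis by (simp only: unit_cancel)
    qed
    also have "\<psi>i x * \<psi>i (1 - x) = z" using x by (simp only: K_def \<psi>i_mult)
    finally show ?thesis .
  qed
  show ?thesis
  proof (rule card_dvd_3_if_free_order_3[where f = R])
    fix x assume "x \<in> {x \<in> {0..<3 * int n}. K x = z}"
    then have x: "0 \<le> x" "x < M" "K x = z" by (auto simp: M_def)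
    show "R x \<in> {x \<in> {0..<3 * int n}. K x = z}"
      using KR[OF x(3)] M(1) by (simp add: R_def M_def[symmetric])
    define y where "y = R x"
    define w where "w = R y"
    define v where "v = R w"
    have A: "M dvd y * (1 - x) - 1" "M dvd w * (1 - y) - 1" "M dvd v * (1 - w) - 1"
      unfolding y_def w_def v_def by (intro RM KR x(3))+
    have "x * (1 - w) - 1 = w * (y * (1 - x) - 1) - (x - 1) * (w * (1 - y) - 1)" by (simp add: algebra_simps)
    then have B: "M dvd x * (1 - w) - 1" using A(1,2) by simp
    have "v - x = x * (v * (1 - w) - 1) - v * (x * (1 - w) - 1)" by (simp add: algebra_simps)
    then have "M dvd v - x" using A(3) B by simp
    then have "v mod M = x mod M" by (simp add: mod_eq_dvd_iff)
    then have "v = x" using x M(1) by (simp add: v_def R_def)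
    then show "R (R (R x)) = x" by (simp only: v_def w_def y_def)
    show "R x \<noteq> x"
    proof
      assume e: "R x = x"
      then have M1: "M dvd x * (1 - x) - 1" using RM[OF x(3)] by simp
      have "x mod 3 = 2" using K_mod_3 x(3) z(1) by blast
      then have "x = 3 * (x div 3) + 2" by presburger
      then obtain t where t: "x = 3 * t + 2" by blast
      have "int n = 3 * int (n div 3) + 1" using n by presburger
      then obtain s where s: "int n = 3 * s + 1" by blast
      have "x * (1 - x) - (1 + 6 * int n) = 9 * (- 1 - t - t * t - 2 * s)" unfolding t s by (simp add: algebra_simps)
      then have "9 dvd x * (1 - x) - (1 + 6 * int n)" by (simp only: dvd_triv_left)
      moreover have "int n dvd x * (1 - x) - (1 + 6 * int n)"
      proof -
        have "int n dvd x * (1 - x) - 1" by (rule dvd_trans[OF dvd_triv_right M1[unfolded M_def]])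
        then have "int n dvd (x * (1 - x) - 1) - 6 * int n" by (rule dvd_diff[OF _ dvd_triv_right])
        then show ?thesis by (simp only: diff_diff_add)
      qed
      moreover have "coprime 9 (int n)"
      proof -
        have "coprime 3 (int n)" unfolding s
          by (rule coprimeI) (metis dvd_add_right_iff dvd_mult2)
        then have "coprime (3 * 3) (int n)" by (simp only: coprime_mult_left_iff)
        then show ?thesis by simp
      qed
      ultimately have "int m dvd x * (1 - x) - (1 + 6 * int n)" by (simp add: m divides_mult)
      then have "K x = \<psi>i (1 + 6 * int n)" unfolding K_def by (intro \<psi>i_cong) (simp add: cong_iff_dvd_diff)
      with x(3) z(2) show False by simp
    qed
  next
    show "finite {x \<in> {0..<3 * int n}. K x = z}" by (rule finite_subset[of _ "{0..<3 * int n}"]) auto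
  qed
qed

text \<open>
  The Jacobi sum is three times an Eisenstein integer of norm \<open>n\<close>. The count of the
  summands modulo three shows that the coefficient of \<open>\<omega>\<close> is prime to three.
\<close>

theorem gauss_sum_cube:
  obtains a b :: int where "G 1 ^ 3 = of_nat (27 * n) * (of_int a + of_int b * \<omega>)" "a\<^sup>2 - a * b + b\<^sup>2 = int n" "\<not> 3 dvd b"
proof -
  let ?S = "{0..<3 * int n}"
  define d where "d z = card {x \<in> ?S. K x = z}" for z
  define a b where "a = int (d 1) - int (d (\<omega>\<^sup>2))" and "b = int (d \<omega>) - int (d (\<omega>\<^sup>2))"
  have Kv: "K x = (if K x = 1 then 1 else 0) + \<omega> * (if K x = \<omega> then 1 else 0) + \<omega>\<^sup>2 * (if K x = \<omega>\<^sup>2 then 1 else 0)" for x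
  proof (cases "K x = 0")
    case False
    then have "K x ^ 3 = 1" unfolding K_def by (rule \<psi>i_coprime(2))
    then show ?thesis using \<omega>_ne unfolding cube_root_unity by auto
  qed (use \<omega>_ne in auto)
  have cnt: "(\<Sum>x\<in>?S. if K x = z then 1 else 0 :: complex) = of_nat (d z)" for z
    unfolding d_def by (subst sum.inter_filter[symmetric]) auto
  have "(\<Sum>x\<in>?S. K x) = (\<Sum>x\<in>?S. (if K x = 1 then 1 else 0) + \<omega> * (if K x = \<omega> then 1 else 0) + \<omega>\<^sup>2 * (if K x = \<omega>\<^sup>2 then 1 else 0))"
    by (intro sum.cong refl Kv)
  also have "\<dots> = of_nat (d 1) + \<omega> * of_nat (d \<omega>) + \<omega>\<^sup>2 * of_nat (d (\<omega>\<^sup>2))"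
    by (simp only: sum.distrib sum_distrib_left[symmetric] cnt)
  also have "\<dots> = of_int a + of_int b * \<omega>" unfolding a_def b_def \<omega>_square by (simp add: algebra_simps)
  finally have J: "J = 3 * (of_int a + of_int b * \<omega>)" using J_eq by simp
  have G3: "G 1 ^ 3 = of_nat (27 * n) * (of_int a + of_int b * \<omega>)" unfolding G_cube J by (simp add: m)
  have n0: "(of_nat n :: complex) \<noteq> 0" using n_pos by simp
  have N: "a\<^sup>2 - a * b + b\<^sup>2 = int n"
  proof -
    have nrm: "(of_int a + of_int b * \<omega>) * cnj (of_int a + of_int b * \<omega>) = of_int (a\<^sup>2 - a * b + b\<^sup>2)"
      using \<omega>_combination_norm[of "of_int a" "of_int b"] by simp
    have "G 1 ^ 3 * cnj (G 1 ^ 3) = (G 1 * cnj (G 1)) ^ 3" by (simp add: power_mult_distrib)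
    also have "\<dots> = of_nat m ^ 3" by (simp only: G_norm)
    also have "\<dots> = of_nat (9 * n) ^ 3" by (simp only: m)
    finally have "of_nat (27 * n) * of_nat (27 * n) * ((of_int a + of_int b * \<omega>) * cnj (of_int a + of_int b * \<omega>)) = of_nat (9 * n) ^ 3"
      unfolding G3 complex_cnj_mult complex_cnj_of_nat by (simp only: mult_ac)
    then have "(of_int (729 * (int n * int n) * (a\<^sup>2 - a * b + b\<^sup>2)) :: complex) = of_int (729 * (int n * int n) * int n)"
      unfolding nrm by (simp add: power3_eq_cube mult_ac)
    then have "729 * (int n * int n) * (a\<^sup>2 - a * b + b\<^sup>2) = 729 * (int n * int n) * int n" unfolding of_int_eq_iff .
    then show ?thesis using n_pos by simp
  qed
  have "\<not> 3 dvd b"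
  proof
    assume b: "3 dvd b"
    have n3: "\<not> 3 dvd int n" using n by presburger
    have dz: "3 dvd int (d z)" if "z \<noteq> 0" "z \<noteq> \<psi>i (1 + 6 * int n)" for z
      using card_K[OF that] unfolding d_def by presburger
    have z2: "\<omega>\<^sup>2 \<noteq> 0" using \<omega>_ne(2) by simp
    have "3 dvd a"
    proof (rule disjE[OF \<psi>_1_6n])
      assume e: "\<psi>i (1 + 6 * int n) = \<omega>"
      have "3 dvd int (d 1)" "3 dvd int (d (\<omega>\<^sup>2))" by (rule dz; simp add: e \<omega>_ne \<omega>_ne[symmetric])+
      then show ?thesis unfolding a_def by (rule dvd_diff)
    next
      assume e: "\<psi>i (1 + 6 * int n) = \<omega>\<^sup>2"
      have "3 dvd int (d 1)" "3 dvd int (d \<omega>)" by (rule dz; simp add: e \<omega>_ne \<omega>_ne[symmetric])+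
      then show ?thesis using b unfolding a_def b_def by presburger
    qed
    then have "3 dvd a\<^sup>2 - a * b + b\<^sup>2" using b by (simp add: power2_eq_square)
    with N n3 show False by simp
  qed
  with G3 N show ?thesis by (rule that)
qed

end

section \<open>The Gauss sum generator of a field of given conductor\<close>

lemma rpoly_pCons [simp]: "rpoly (pCons a f) = pCons (of_rat a) (rpoly f)"
  by (rule of_rat_hom.map_poly_pCons_hom)

lemma rpoly_uminus [simp]: "rpoly (- f) = - rpoly f"
  using rpoly_ring(2)[of 0 f] unfolding rpoly_ring(8) by simp

lemma cyclotomic_field_closed:
  "x \<in> \<rat> \<Longrightarrow> x \<in> cyclotomic_field d" "cis (2 * pi / real d) \<in> cyclotomic_field d"
  "x \<in> cyclotomic_field d \<Longrightarrow> y \<in> cyclotomic_field d \<Longrightarrow> x + y \<in> cyclotomic_field d"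
  "x \<in> cyclotomic_field d \<Longrightarrow> y \<in> cyclotomic_field d \<Longrightarrow> x * y \<in> cyclotomic_field d"
  "x \<in> cyclotomic_field d \<Longrightarrow> - x \<in> cyclotomic_field d"
  unfolding cyclotomic_field_def
  using generate_field.eng_add[of x CC _ y] generate_field.eng_mult[of x CC _ y] generate_field.a_inv[of x CC]
  by (auto intro: generate_field.incl)

lemma cyclotomic_field_power: "x \<in> cyclotomic_field d \<Longrightarrow> x ^ k \<in> cyclotomic_field d"
  by (induction k) (auto intro: cyclotomic_field_closed)

lemma cyclotomic_field_sum: "(\<And>i. i \<in> A \<Longrightarrow> f i \<in> cyclotomic_field d) \<Longrightarrow> sum f A \<in> cyclotomic_field d"
  by (induction A rule: infinite_finite_induct) (auto intro: cyclotomic_field_closed)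

lemma rpoly_inverse:
  fixes z :: complex
  assumes m: "m > 0" "z ^ m = 1" and f: "poly (rpoly f) z \<noteq> 0"
  shows "\<exists>g. inverse (poly (rpoly f) z) = poly (rpoly g) z"
proof -
  define U :: "rat poly" where "U = monom 1 m - 1"
  have U: "poly (rpoly U) z = 0" using m by (simp add: U_def rpoly_ring poly_monom)
  have "Polynomial.coeff U m = 1" using m by (simp add: U_def)
  then have U0: "U \<noteq> 0" by auto
  obtain g where g: "Polynomial.lead_coeff g = 1" "poly (rpoly g) z = 0" "\<And>f. poly (rpoly f) z = 0 \<Longrightarrow> g dvd f"
    using minimal_polynomial[OF U0 U] by blast
  have g0: "g \<noteq> 0" using g(1) by auto
  define d where "d = gcd f g"
  obtain a where a: "f = d * a" using gcd_dvd1[of f g] unfolding d_def by (rule dvdE)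
  obtain b where b: "g = d * b" using gcd_dvd2[of f g] unfolding d_def by (rule dvdE)
  have dz: "poly (rpoly d) z \<noteq> 0" using f unfolding a by (simp add: rpoly_ring)
  have "poly (rpoly b) z = 0" using g(2) dz unfolding b by (simp add: rpoly_ring)
  then have "g dvd b" by (rule g(3))
  have b0: "b \<noteq> 0" "d \<noteq> 0" using g0 b by auto
  have "degree g \<le> degree b" using \<open>g dvd b\<close> b0(1) by (rule dvd_imp_degree_le)
  moreover have "degree g = degree d + degree b" unfolding b by (rule degree_mult_eq[OF b0(2,1)])
  ultimately have "degree d = 0" by simp
  then obtain c where c: "d = [:c:]" by (rule degree_eq_zeroE)
  have c0: "c \<noteq> 0" using b0 c by auto
  obtain u v where "u * f + v * g = d" using bezout_coefficients_fst_snd[of f g] unfolding d_def by blast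
  then have "poly (rpoly (u * f + v * g)) z = poly (rpoly d) z" by simp
  then have "poly (rpoly u) z * poly (rpoly f) z = of_rat c" using g(2) unfolding c by (simp add: rpoly_ring)
  note uf = this
  have "poly (rpoly f) z * poly (rpoly (Polynomial.smult (inverse c) u)) z = of_rat (inverse c) * (poly (rpoly u) z * poly (rpoly f) z)"
    unfolding rpoly_ring poly_smult by (simp only: mult_ac)
  also have "\<dots> = of_rat (inverse c * c)" unfolding uf by (simp only: of_rat_mult)
  also have "\<dots> = 1" using c0 by simp
  finally have "inverse (poly (rpoly f) z) = poly (rpoly (Polynomial.smult (inverse c) u)) z" by (rule inverse_unique)
  then show ?thesis by blast
qed

text \<open>
  The rational polynomials in a root of unity are closed under inverses, so they already form
  the generated field.
\<close>

lemma cyclotomic_field_rpoly: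
  assumes m: "m > 0" and x: "x \<in> cyclotomic_field m"
  shows "\<exists>f. x = poly (rpoly f) (cis (2 * pi / real m))"
  using x unfolding cyclotomic_field_def
proof (induction rule: generate_field.induct)
  case one
  show ?case by (intro exI[of _ 1]) (simp add: rpoly_ring)
next
  case (incl h)
  then show ?case
  proof
    assume "h \<in> \<rat>"
    then obtain r where "h = of_rat r" by (rule Rats_cases)
    then show ?thesis by (intro exI[of _ "[:r:]"]) simp
  next
    assume "h \<in> {cis (2 * pi / real m)}"
    then show ?thesis by (intro exI[of _ "[:0, 1:]"]) simp
  qed
next
  case (a_inv h)
  then obtain f where f: "h = poly (rpoly f) (cis (2 * pi / real m))" by blast
  show ?case by (rule exI[of _ "- f"]) (simp only: f CC_uminus rpoly_uminus poly_minus)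
next
  case (m_inv h)
  then obtain f where f: "h = poly (rpoly f) (cis (2 * pi / real m))" by blast
  have h0: "h \<noteq> 0" using m_inv.hyps by simp
  have "cis (2 * pi / real m) ^ m = 1" unfolding Complex.DeMoivre using m by simp
  from rpoly_inverse[OF m this] h0 obtain g where "inverse h = poly (rpoly g) (cis (2 * pi / real m))" unfolding f by blast
  then show ?case unfolding CC_inv[OF h0] by blast
next
  case (eng_add h1 h2)
  then obtain f g where f: "h1 = poly (rpoly f) (cis (2 * pi / real m))" "h2 = poly (rpoly g) (cis (2 * pi / real m))" by blast
  show ?case by (rule exI[of _ "f + g"]) (simp only: f CC_simps rpoly_ring poly_add)
next
  case (eng_mult h1 h2)
  then obtain f g where f: "h1 = poly (rpoly f) (cis (2 * pi / real m))" "h2 = poly (rpoly g) (cis (2 * pi / real m))" by blast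
  show ?case by (rule exI[of _ "f * g"]) (simp only: f CC_simps rpoly_ring poly_mult)
qed

text \<open>
  The conductor enters through two facts: \<open>F\<close> lies in the \<open>m\<close>-th
  cyclotomic field, and in no smaller one.
\<close>

locale cubic_conductor = cyclic_cubic +
  fixes n m :: nat
  assumes m: "m = 9 * n" and n: "n mod 3 = 1" and conductor: "is_conductor F m"
begin

lemma m_pos: "m > 0" using conductor by (simp add: is_conductor_def)

definition z :: complex where "z = cis (2 * pi / real m)"

lemma z_m: "z ^ m = 1"
  unfolding z_def Complex.DeMoivre using m_pos by simp

lemma z_cong: assumes "[a = b] (mod m)" shows "z ^ a = z ^ b"
proof -
  have "z ^ a = z ^ (a mod m)" for a
  proof -
    have "z ^ a = z ^ (a mod m + m * (a div m))" by simp
    also have "\<dots> = z ^ (a mod m)" unfolding power_add power_mult z_m by simp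
    finally show ?thesis .
  qed
  then show ?thesis using assms unfolding cong_def by metis
qed

definition \<beta> :: complex where "\<beta> = (SOME b. b \<in> F \<and> b \<notin> \<rat> \<and> b + \<sigma> b + \<sigma> (\<sigma> b) = 0)"

lemma \<beta>: "\<beta> \<in> F" "\<beta> \<notin> \<rat>" "\<beta> + \<sigma> \<beta> + \<sigma> (\<sigma> \<beta>) = 0"
proof -
  obtain x where x: "x \<in> F" "x \<notin> \<rat>" using not_small(1) by blast
  define t where "t = x + \<sigma> x + \<sigma> (\<sigma> x)"
  have t: "t \<in> \<rat>" unfolding t_def by (rule symmetric_rational(1)[OF x(1)])
  define b where "b = 3 * x - t"
  have three: "(3 :: complex) \<in> \<rat>" by simp
  have bF: "b \<in> F" unfolding b_def by (intro F_diff F_mult Rats_F three t x)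
  have \<sigma>b: "\<sigma> (3 * y - t) = 3 * \<sigma> y - t" if "y \<in> F" for y
    using that by (simp add: \<sigma>_simps \<sigma>_mult \<sigma>_rat[OF three] \<sigma>_rat[OF t] Rats_F[OF three] Rats_F[OF t] F_mult)
  have "b + \<sigma> b + \<sigma> (\<sigma> b) = 0"
    unfolding b_def \<sigma>b[OF x(1)] \<sigma>b[OF \<sigma>_closed[OF x(1)]] by (simp add: t_def)
  moreover have "b \<notin> \<rat>"
  proof
    assume "b \<in> \<rat>"
    then have "(b + t) / 3 \<in> \<rat>" using t by simp
    then show False using x(2) by (simp add: b_def)
  qed
  ultimately have "\<exists>b. b \<in> F \<and> b \<notin> \<rat> \<and> b + \<sigma> b + \<sigma> (\<sigma> b) = 0" using bF by blast
  from someI_ex[OF this] show "\<beta> \<in> F" "\<beta> \<notin> \<rat>" "\<beta> + \<sigma> \<beta> + \<sigma> (\<sigma> \<beta>) = 0"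
    unfolding \<beta>_def by blast+
qed

definition f :: "rat poly" where "f = (SOME f. \<beta> = poly (rpoly f) z)"

lemma f: "\<beta> = poly (rpoly f) z"
proof -
  have "\<beta> \<in> cyclotomic_field m" using \<beta>(1) conductor unfolding is_conductor_def by blast
  from someI_ex[OF cyclotomic_field_rpoly[OF m_pos this]] show ?thesis unfolding f_def z_def .
qed

definition conj :: "nat \<Rightarrow> complex" where "conj a = poly (rpoly f) (z ^ a)"

lemma conj_sum: "conj a = (\<Sum>i\<le>degree f. of_rat (Polynomial.coeff f i) * z ^ (a * i))"
  unfolding conj_def poly_altdef
  by (simp only: power_mult of_rat_hom.degree_map_poly_hom of_rat_hom.coeff_map_poly_hom)

lemma transfer: "coprime a m \<Longrightarrow> poly (rpoly g) z = 0 \<Longrightarrow> poly (rpoly g) (z ^ a) = 0"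
  by (rule root_of_unity_conjugate[OF m_pos z_m])

lemma \<sigma>_pow: "(\<sigma> ^^ k) \<beta> \<in> F"
  by (induction k) (auto simp: \<beta>(1) \<sigma>_closed)

lemma \<sigma>_pow_mod: "(\<sigma> ^^ (k mod 3)) \<beta> = (\<sigma> ^^ k) \<beta>"
proof -
  have 3: "(\<sigma> ^^ (3 * j)) \<beta> = \<beta>" for j
    by (induction j) (simp_all add: numeral_3_eq_3 \<sigma>_cube \<beta>(1))
  have "(\<sigma> ^^ k) \<beta> = (\<sigma> ^^ (k mod 3 + 3 * (k div 3))) \<beta>" by simp
  also have "\<dots> = (\<sigma> ^^ (k mod 3)) \<beta>" unfolding funpow_add comp_def 3 ..
  finally show ?thesis by simp
qed

lemma \<sigma>_distinct: "\<sigma> \<beta> \<noteq> \<beta>" "\<sigma> (\<sigma> \<beta>) \<noteq> \<beta>" "\<sigma> (\<sigma> \<beta>) \<noteq> \<sigma> \<beta>"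
proof -
  show 1: "\<sigma> \<beta> \<noteq> \<beta>" using \<sigma>_fixed[OF \<beta>(1)] \<beta>(2) by blast
  then show 3: "\<sigma> (\<sigma> \<beta>) \<noteq> \<sigma> \<beta>" using \<sigma>_inj \<beta>(1) \<sigma>_closed[OF \<beta>(1)] unfolding inj_on_def by blast
  show "\<sigma> (\<sigma> \<beta>) \<noteq> \<beta>"
  proof
    assume e: "\<sigma> (\<sigma> \<beta>) = \<beta>"
    then have "\<sigma> (\<sigma> (\<sigma> \<beta>)) = \<sigma> \<beta>" by (rule arg_cong)
    then have "\<beta> = \<sigma> \<beta>" unfolding \<sigma>_cube[OF \<beta>(1)] .
    with 1 show False by (metis)
  qed
qed

lemma \<sigma>_pow_inj: assumes "j < 3" "k < 3" "(\<sigma> ^^ j) \<beta> = (\<sigma> ^^ k) \<beta>" shows "j = k"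
proof -
  have "j = 0 \<or> j = 1 \<or> j = 2" "k = 0 \<or> k = 1 \<or> k = 2" using assms by linarith+
  then show ?thesis using assms(3) \<sigma>_distinct \<sigma>_distinct[symmetric] by (elim disjE) (simp_all add: numeral_2_eq_2)
qed

text \<open>
  The conjugate \<open>conj a\<close> is a root of the cubic equation of \<open>\<beta>\<close>,
  whose roots are the images of \<open>\<beta>\<close> under the powers of
  \<open>\<sigma>\<close>.
\<close>

lemma conj_cases: assumes "coprime a m" shows "\<exists>k<3. conj a = (\<sigma> ^^ k) \<beta>"
proof -
  obtain e1 e2 e3 where e: "\<beta> + \<sigma> \<beta> + \<sigma> (\<sigma> \<beta>) = of_rat e1" "\<beta> * \<sigma> \<beta> + \<sigma> \<beta> * \<sigma> (\<sigma> \<beta>) + \<sigma> (\<sigma> \<beta>) * \<beta> = of_rat e2"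
    "\<beta> * \<sigma> \<beta> * \<sigma> (\<sigma> \<beta>) = of_rat e3"
    using symmetric_rational[OF \<beta>(1)] by (meson Rats_cases)
  define P :: "rat poly" where "P = [:- e3, e2, - e1, 1:]"
  have P: "poly (rpoly P) x = (x - \<beta>) * (x - \<sigma> \<beta>) * (x - \<sigma> (\<sigma> \<beta>))" for x
  proof -
    have "poly (rpoly P) x = x * (x * (x - of_rat e1) + of_rat e2) - of_rat e3"
      by (simp add: P_def of_rat_minus algebra_simps)
    then show ?thesis unfolding e[symmetric] by (simp add: algebra_simps)
  qed
  have Pf: "poly (rpoly (pcompose P f)) x = poly (rpoly P) (poly (rpoly f) x)" for x
    by (simp only: rpoly_ring poly_pcompose)
  have "poly (rpoly (pcompose P f)) z = 0" unfolding Pf f[symmetric] P by simp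
  from transfer[OF assms this] have "poly (rpoly P) (conj a) = 0" unfolding Pf conj_def .
  then have "conj a = \<beta> \<or> conj a = \<sigma> \<beta> \<or> conj a = \<sigma> (\<sigma> \<beta>)" unfolding P by auto
  then show ?thesis
  proof (elim disjE)
    assume "conj a = \<beta>" then show ?thesis by (intro exI[of _ 0]) simp
  next
    assume "conj a = \<sigma> \<beta>" then show ?thesis by (intro exI[of _ 1]) simp
  next
    assume "conj a = \<sigma> (\<sigma> \<beta>)" then show ?thesis by (intro exI[of _ 2]) (simp add: numeral_2_eq_2)
  qed
qed

definition e :: "nat \<Rightarrow> nat" where "e a = (SOME k. k < 3 \<and> conj a = (\<sigma> ^^ k) \<beta>)"

lemma e: assumes "coprime a m" shows "e a < 3" "conj a = (\<sigma> ^^ e a) \<beta>"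
  using someI_ex[OF conj_cases[OF assms]] unfolding e_def by blast+

lemma e_eqI: "coprime a m \<Longrightarrow> conj a = (\<sigma> ^^ k) \<beta> \<Longrightarrow> e a = k mod 3"
  using e[of a] \<sigma>_pow_mod[of k] \<sigma>_pow_inj[of "e a" "k mod 3"] by simp

lemma e_cong: "[a = b] (mod m) \<Longrightarrow> e a = e b"
  unfolding e_def conj_def using z_cong by simp

text \<open>
  Both sides describe the same automorphism: \<open>\<sigma> \<beta>\<close> is a rational
  polynomial in \<open>\<beta>\<close>, and substitution of powers of \<open>z\<close> commutes
  with rational polynomials.
\<close>

lemma e_mult: assumes a: "coprime a m" and b: "coprime b m"
  shows "e (a * b) = (e a + e b) mod 3"
proof -
  obtain r s t where rst: "r \<in> \<rat>" "s \<in> \<rat>" "t \<in> \<rat>" "\<sigma> \<beta> = r + s * \<beta> + t * \<beta>\<^sup>2"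
    by (rule cubic_relation[OF \<beta>(1,2) \<sigma>_closed[OF \<beta>(1)]])
  obtain r' s' t' where r': "r = of_rat r'" "s = of_rat s'" "t = of_rat t'"
    using rst(1-3) by (meson Rats_cases)
  define h where "h = [:r', s', t':]"
  have hQ: "Polynomial.coeff (rpoly h) i \<in> \<rat>" for i by simp
  have h: "poly (rpoly h) \<beta> = \<sigma> \<beta>" unfolding rst(4) r' h_def by (simp add: algebra_simps power2_eq_square)
  define hh where "hh x = poly (rpoly h) x" for x
  have hhF: "hh x \<in> F" "\<sigma> (hh x) = hh (\<sigma> x)" if "x \<in> F" for x
    unfolding hh_def by (rule \<sigma>_poly[OF hQ that])+
  have 1: "hh ((\<sigma> ^^ j) \<beta>) = (\<sigma> ^^ Suc j) \<beta>" for j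
  proof (induction j)
    case 0
    show ?case by (simp add: hh_def h)
  next
    case (Suc j)
    have "hh ((\<sigma> ^^ Suc j) \<beta>) = \<sigma> (hh ((\<sigma> ^^ j) \<beta>))" using hhF(2)[OF \<sigma>_pow, of j] by simp
    then show ?case unfolding Suc by simp
  qed
  have 2: "(hh ^^ k) ((\<sigma> ^^ j) \<beta>) = (\<sigma> ^^ (k + j)) \<beta>" for j k
    by (induction k) (simp_all add: 1)
  define H where "H k = ((\<lambda>g. pcompose h g) ^^ k) f" for k
  have H: "poly (rpoly (H k)) x = (hh ^^ k) (poly (rpoly f) x)" for k x
    by (induction k) (simp_all add: H_def rpoly_ring poly_pcompose hh_def)
  define D where "D = pcompose f (monom 1 a) - H (e a)"
  have D: "poly (rpoly D) x = poly (rpoly f) (x ^ a) - (hh ^^ e a) (poly (rpoly f) x)" for x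
    by (simp add: D_def rpoly_ring poly_pcompose poly_monom H)
  have "poly (rpoly D) z = 0"
    unfolding D conj_def[symmetric] f[symmetric] using e(2)[OF a] 2[of "e a" 0] by simp
  from transfer[OF b this] have "poly (rpoly f) ((z ^ b) ^ a) = (hh ^^ e a) (poly (rpoly f) (z ^ b))"
    unfolding D by simp
  also have "(z ^ b) ^ a = z ^ (a * b)" by (simp only: power_mult[symmetric] mult.commute)
  finally have "conj (a * b) = (hh ^^ e a) (conj b)" unfolding conj_def .
  also have "\<dots> = (\<sigma> ^^ (e a + e b)) \<beta>" unfolding e(2)[OF b] 2 ..
  finally show ?thesis using a b by (intro e_eqI) simp_all
qed

definition \<psi> :: "nat \<Rightarrow> complex" where "\<psi> a = (if coprime a m then \<omega> ^ e a else 0)"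

lemma \<omega>_power_mod: "\<omega> ^ (k mod 3) = \<omega> ^ k"
proof -
  have "\<omega> ^ k = \<omega> ^ (k mod 3 + 3 * (k div 3))" by simp
  also have "\<dots> = \<omega> ^ (k mod 3)" unfolding power_add power_mult \<omega>_cube by simp
  finally show ?thesis by simp
qed

text \<open>
  Averaging over the substitutions congruent to one modulo \<open>d\<close> leaves only terms
  that lie in the smaller cyclotomic field. Together with the minimality of the conductor this
  gives primitivity of the character.
\<close>

lemma in_smaller_field:
  assumes p: "Factorial_Ring.prime p" "m = p * d"
    and triv: "\<And>k. coprime (1 + d * k) m \<Longrightarrow> conj (1 + d * k) = \<beta>"
  shows "\<beta> \<in> cyclotomic_field d"
proof -
  have p0: "p > 0" and d0: "d > 0" using p m_pos by (auto simp: prime_gt_0_nat intro!: Nat.gr0I)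
  define \<zeta>d where "\<zeta>d = cis (2 * pi / real d)"
  have \<zeta>d: "z ^ p = \<zeta>d"
  proof -
    have "real p * (2 * pi / real m) = 2 * pi / real d" unfolding p(2) using p0 by simp
    then show ?thesis unfolding z_def \<zeta>d_def Complex.DeMoivre by (rule arg_cong)
  qed
  have zp: "z ^ i \<in> cyclotomic_field d" if pi: "p dvd i" for i
  proof -
    obtain j where "i = p * j" using pi by (rule dvdE)
    then have "z ^ i = \<zeta>d ^ j" by (simp only: power_mult \<zeta>d)
    then show ?thesis unfolding \<zeta>d_def by (simp only: cyclotomic_field_power cyclotomic_field_closed(2))
  qed
  define A where "A = {k. k < p \<and> \<not> p dvd 1 + d * k}"
  define A' where "A' = {k. k < p \<and> p dvd 1 + d * k}"
  have AA: "A \<union> A' = {..<p}" "A \<inter> A' = {}" unfolding A_def A'_def lessThan_def by blast+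
  have "A \<subseteq> {..<p}" "A' \<subseteq> {..<p}" using AA(1) by blast+
  from this[THEN finite_subset[OF _ finite_lessThan]] have fin: "finite A" "finite A'" .
  have "\<not> p dvd 1" using prime_gt_1_nat[OF p(1)] by simp
  then have "0 \<in> A" using p0 by (simp add: A_def)
  then have cA: "card A \<noteq> 0" using card_0_eq[OF fin(1)] by blast
  have cop: "coprime (1 + d * k) m" if "k \<in> A" for k
  proof -
    have "coprime p (1 + d * k)" using that p(1) by (simp add: A_def prime_imp_coprime)
    moreover have "coprime (1 + d * k) d"
    proof (rule cong_imp_coprime)
      show "[1 = 1 + d * k] (mod d)" unfolding cong_def by (rule mod_mult_self2[symmetric])
    qed simp
    ultimately show ?thesis unfolding p(2) coprime_mult_right_iff by (simp only: coprime_commute)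
  qed
  have S: "(\<Sum>k\<in>A. z ^ ((1 + d * k) * i)) \<in> cyclotomic_field d" for i
  proof -
    have "(\<Sum>k<p. z ^ ((1 + d * k) * i)) = (\<Sum>k\<in>A. z ^ ((1 + d * k) * i)) + (\<Sum>k\<in>A'. z ^ ((1 + d * k) * i))"
      unfolding AA(1)[symmetric] by (rule sum.union_disjoint[OF fin AA(2)])
    then have "(\<Sum>k\<in>A. z ^ ((1 + d * k) * i)) = (\<Sum>k<p. z ^ ((1 + d * k) * i)) + - (\<Sum>k\<in>A'. z ^ ((1 + d * k) * i))"
      by simp
    moreover have "(\<Sum>k\<in>A'. z ^ ((1 + d * k) * i)) \<in> cyclotomic_field d"
      by (intro cyclotomic_field_sum zp dvd_mult2) (simp add: A'_def)
    moreover have "(\<Sum>k<p. z ^ ((1 + d * k) * i)) \<in> cyclotomic_field d"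
    proof -
      define \<eta> where "\<eta> = z ^ (d * i)"
      have "(\<Sum>k<p. z ^ ((1 + d * k) * i)) = z ^ i * (\<Sum>k<p. \<eta> ^ k)"
        unfolding sum_distrib_left
      proof (rule sum.cong[OF refl])
        fix k
        have "(1 + d * k) * i = i + d * i * k" by (simp add: algebra_simps)
        then show "z ^ ((1 + d * k) * i) = z ^ i * \<eta> ^ k" by (simp only: \<eta>_def power_add power_mult)
      qed
      moreover have "(\<Sum>k<p. \<eta> ^ k) = 0" if "\<not> p dvd i"
      proof -
        have "\<eta> ^ p = z ^ (m * i)" unfolding \<eta>_def p(2) power_mult[symmetric] by (simp only: mult_ac)
        then have ep: "\<eta> ^ p = 1" unfolding power_mult z_m by simp
        have "\<eta> \<noteq> 1"
        proof
          assume "\<eta> = 1"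
          then have "z ^ (d * i mod m) = 1" unfolding \<eta>_def using z_cong[of "d * i mod m" "d * i"] by (simp add: cong_def)
          then have "cis (2 * pi * real (d * i mod m) / real m) = cis (2 * pi * real 0 / real m)"
            unfolding z_def Complex.DeMoivre by (simp add: mult_ac)
          then have "d * i mod m = 0"
            using inj_on_eq_iff[OF bij_betw_imp_inj_on[OF Complex.bij_betw_roots_unity[OF m_pos]], of "d * i mod m" 0] m_pos by simp
          then have "d * p dvd d * i" unfolding p(2) by (simp only: mult.commute[of p] mod_eq_0_iff_dvd)
          then show False using that d0 by simp
        qed
        then show ?thesis using geometric_sum[of \<eta> p] ep by simp
      qed
      moreover have "(\<Sum>k<p. \<eta> ^ k) = of_nat p" if "p dvd i"
      proof -
        have "m dvd d * i" unfolding p(2) using that by (simp add: mult.commute mult_dvd_mono)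
        then have "\<eta> = 1" unfolding \<eta>_def using z_cong[of "d * i" 0] by (simp add: cong_0_iff)
        then show ?thesis by simp
      qed
      ultimately show ?thesis using zp[of i]
        by (cases "p dvd i") (simp_all add: cyclotomic_field_closed(1,4))
    qed
    ultimately show ?thesis by (simp only: cyclotomic_field_closed(3,5))
  qed
  have "of_nat (card A) * \<beta> = (\<Sum>k\<in>A. conj (1 + d * k))"
    using triv[OF cop] by simp
  also have "\<dots> = (\<Sum>k\<in>A. \<Sum>i\<le>degree f. of_rat (Polynomial.coeff f i) * z ^ ((1 + d * k) * i))"
    by (simp only: conj_sum)
  also have "\<dots> = (\<Sum>i\<le>degree f. of_rat (Polynomial.coeff f i) * (\<Sum>k\<in>A. z ^ ((1 + d * k) * i)))"
    unfolding sum_distrib_left by (rule sum.swap)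
  also have "\<dots> \<in> cyclotomic_field d"
    by (intro cyclotomic_field_sum cyclotomic_field_closed(4) S cyclotomic_field_closed(1)) simp
  finally have "of_nat (card A) * \<beta> \<in> cyclotomic_field d" .
  note h = this
  have "1 / of_nat (card A) \<in> (\<rat> :: complex set)" by (intro Rats_divide Rats_1 Rats_of_nat)
  from cyclotomic_field_closed(4)[OF cyclotomic_field_closed(1)[OF this] h]
  have "(1 / of_nat (card A)) * (of_nat (card A) * \<beta>) \<in> cyclotomic_field d" .
  then show ?thesis using cA by simp
qed

sublocale \<psi>: cubic_character n m \<psi>
proof
  show "m = 9 * n" "n mod 3 = 1" by (fact m n)+
  show "\<psi> (a * b) = \<psi> a * \<psi> b" for a b
  proof (cases "coprime a m \<and> coprime b m")
    case True
    then have "coprime (a * b) m" by simp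
    then show ?thesis using True e_mult[of a b] by (simp add: \<psi>_def \<omega>_power_mod power_add)
  next
    case False
    then have "\<not> coprime (a * b) m" by simp
    then show ?thesis using False by (auto simp: \<psi>_def)
  qed
  show "\<psi> a = \<psi> b" if "[a = b] (mod m)" for a b
    using e_cong[OF that] cong_imp_coprime[OF that] cong_imp_coprime[OF cong_sym[OF that]] by (auto simp: \<psi>_def)
  show "\<not> coprime a m \<Longrightarrow> \<psi> a = 0" for a by (simp add: \<psi>_def)
  show "coprime a m \<Longrightarrow> \<psi> a ^ 3 = 1" for a
    by (simp add: \<psi>_def power_mult[symmetric] mult.commute[of _ 3]) (simp add: power_mult \<omega>_cube)
  show "\<exists>b. coprime b m \<and> [b = 1] (mod (m div p)) \<and> \<psi> b \<noteq> 1" if p: "Factorial_Ring.prime p" "p dvd m" for p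
  proof (rule ccontr)
    assume contra: "\<not> ?thesis"
    define d where "d = m div p"
    have pd: "m = p * d" using p by (simp add: d_def)
    have d0: "d > 0" using pd m_pos by (auto intro!: Nat.gr0I)
    have dm: "d < m" using pd d0 prime_gt_1_nat[OF p(1)] by simp
    have "\<beta> \<in> cyclotomic_field d"
    proof (rule in_smaller_field[OF p(1) pd])
      fix k assume c: "coprime (1 + d * k) m"
      have "[1 + d * k = 1] (mod d)" unfolding cong_def by (rule mod_mult_self2)
      then have "\<psi> (1 + d * k) = 1" using contra c unfolding d_def by blast
      then have w: "\<omega> ^ e (1 + d * k) = 1" using c by (simp add: \<psi>_def)
      have "e (1 + d * k) = 0 \<or> e (1 + d * k) = 1 \<or> e (1 + d * k) = 2" using e(1)[OF c] by linarith
      then have "e (1 + d * k) = 0" using w \<omega>_ne by (elim disjE) simp_all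
      then show "conj (1 + d * k) = \<beta>" using e(2)[OF c] by simp
    qed
    note b = this
    have "F \<subseteq> cyclotomic_field d"
    proof (intro subsetI)
      fix x assume x: "x \<in> F"
      obtain r s t where rst: "r \<in> \<rat>" "s \<in> \<rat>" "t \<in> \<rat>" "x = r + s * \<beta> + t * \<beta>\<^sup>2"
        by (rule cubic_relation[OF \<beta>(1,2) x])
      show "x \<in> cyclotomic_field d" unfolding rst(4)
        by (rule cyclotomic_field_closed(3) cyclotomic_field_closed(4) cyclotomic_field_power b cyclotomic_field_closed(1)[OF rst(1)] cyclotomic_field_closed(1)[OF rst(2)] cyclotomic_field_closed(1)[OF rst(3)])+
    qed
    note sub = this
    have "\<forall>k>0. F \<subseteq> cyclotomic_field k \<longrightarrow> m \<le> k" using conductor unfolding is_conductor_def by (elim conjE)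
    from mp[OF mp[OF spec[OF this, of d] d0] sub] dm show False by simp
  qed
qed

lemma z_eq: "\<psi>.\<zeta> = z" by (simp add: \<psi>.\<zeta>_def z_def)

definition \<tau> :: complex where "\<tau> = \<psi>.G 1"

text \<open>
  Sum \<open>\<psi> a\<close> times the conjugate \<open>conj a\<close> over all units
  \<open>a\<close>. Each power of \<open>\<sigma>\<close> occurs equally often, so this is a
  rational multiple of the resolvent; expanding the conjugates in powers of \<open>z\<close>
  gives Gauss sums \<open>G i\<close>, all of which are multiples of \<open>G 1\<close>.
\<close>

lemma resolvent_multiple:
  "\<exists>r\<in>\<rat>. \<exists>s\<in>\<rat>. \<beta> + \<omega> * \<sigma> \<beta> + \<omega>\<^sup>2 * \<sigma> (\<sigma> \<beta>) = (r + s * \<omega>) * \<tau>"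
proof -
  define N where "N j = {a. a < m \<and> coprime a m \<and> e a = j}" for j
  have finN: "finite (N j)" for j by (simp add: N_def)
  have cop: "coprime a m" "e a = j" "a < m" if "a \<in> N j" for a j using that by (simp_all add: N_def)
  obtain b where b: "coprime b m" "\<psi> b \<noteq> 1"
    using \<psi>.\<psi>_primitive[of 3] by (auto simp: m)
  have b0: "e b \<noteq> 0"
  proof
    assume "e b = 0"
    then have "\<psi> b = 1" using b(1) by (simp add: \<psi>_def)
    with b(2) show False by contradiction
  qed
  have step: "card (N j) \<le> card (N ((j + e b) mod 3))" for j
  proof (rule card_inj_on_le[of "\<lambda>a. a * b mod m"])
    show "finite (N ((j + e b) mod 3))" by (rule finN)
    show "(\<lambda>a. a * b mod m) ` N j \<subseteq> N ((j + e b) mod 3)"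
    proof (rule image_subsetI)
      fix a assume a: "a \<in> N j"
      have c: "coprime (a * b) m" using cop[OF a] b(1) by simp
      have "e (a * b mod m) = e (a * b)" by (rule e_cong) (simp add: cong_def)
      then have "e (a * b mod m) = (j + e b) mod 3" using e_mult[OF cop(1)[OF a] b(1)] cop(2)[OF a] by simp
      then show "a * b mod m \<in> N ((j + e b) mod 3)" using c m_pos by (simp add: N_def)
    qed
    show "inj_on (\<lambda>a. a * b mod m) (N j)"
    proof (rule inj_onI)
      fix x y assume h: "x \<in> N j" "y \<in> N j" "x * b mod m = y * b mod m"
      then have "[x * b = y * b] (mod m)" by (simp add: cong_def)
      then have "[x = y] (mod m)" using cong_mult_rcancel_nat b(1) by blast
      then show "x = y" using cop(3)[OF h(1)] cop(3)[OF h(2)] by (simp add: cong_def)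
    qed
  qed
  have cN: "card (N 1) = card (N 0) \<and> card (N 2) = card (N 0)"
  proof -
    have "e b = 1 \<or> e b = 2" using e(1)[OF b(1)] b0 by linarith
    then show ?thesis
    proof
      assume "e b = 1"
      then show ?thesis using step[of 0] step[of 1] step[of 2] by (simp add: numeral_2_eq_2)
    next
      assume "e b = 2"
      then show ?thesis using step[of 0] step[of 1] step[of 2] by (simp add: numeral_2_eq_2)
    qed
  qed
  define c where "c = card (N 0)"
  have e1: "e 1 = 0" 
  proof -
    have "conj 1 = (\<sigma> ^^ 0) \<beta>" by (simp add: conj_def f[symmetric])
    from e_eqI[OF _ this] show ?thesis by simp
  qed
  have "1 \<in> N 0" using e1 \<psi>.m_ge by (simp add: N_def)
  then have c0: "c \<noteq> 0" unfolding c_def using finN[of 0] by auto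
  have "(\<Sum>a<m. \<psi> a * conj a) = (\<Sum>a\<in>{a. a < m \<and> coprime a m}. \<omega> ^ e a * (\<sigma> ^^ e a) \<beta>)"
    by (rule sum.mono_neutral_cong_right) (auto simp: \<psi>_def e(2))
  also have "{a. a < m \<and> coprime a m} = N 0 \<union> (N 1 \<union> N 2)"
  proof (intro equalityI subsetI)
    fix a assume a: "a \<in> {a. a < m \<and> coprime a m}"
    then have "e a = 0 \<or> e a = 1 \<or> e a = 2" using e(1)[of a] by simp linarith
    with a show "a \<in> N 0 \<union> (N 1 \<union> N 2)" by (simp add: N_def)
  next
    fix a assume "a \<in> N 0 \<union> (N 1 \<union> N 2)"
    then show "a \<in> {a. a < m \<and> coprime a m}" by (elim UnE) (simp_all add: N_def)
  qed
  also have "(\<Sum>a\<in>N 0 \<union> (N 1 \<union> N 2). \<omega> ^ e a * (\<sigma> ^^ e a) \<beta>) =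
      (\<Sum>a\<in>N 0. \<omega> ^ e a * (\<sigma> ^^ e a) \<beta>) + ((\<Sum>a\<in>N 1. \<omega> ^ e a * (\<sigma> ^^ e a) \<beta>) + (\<Sum>a\<in>N 2. \<omega> ^ e a * (\<sigma> ^^ e a) \<beta>))"
    by (subst sum.union_disjoint, use finN in \<open>auto simp: N_def\<close>)+
  also have "\<dots> = of_nat c * (\<beta> + \<omega> * \<sigma> \<beta> + \<omega>\<^sup>2 * \<sigma> (\<sigma> \<beta>))"
  proof -
    have "(\<Sum>a\<in>N j. \<omega> ^ e a * (\<sigma> ^^ e a) \<beta>) = of_nat (card (N j)) * (\<omega> ^ j * (\<sigma> ^^ j) \<beta>)" for j
      using cop(2) by simp
    note s = this
    have cs: "card (N 0) = c" "card (N 1) = c" "card (N 2) = c" using cN by (simp_all add: c_def)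
    show ?thesis unfolding s cs by (simp add: numeral_2_eq_2 algebra_simps)
  qed
  finally have 1: "(\<Sum>a<m. \<psi> a * conj a) = of_nat c * (\<beta> + \<omega> * \<sigma> \<beta> + \<omega>\<^sup>2 * \<sigma> (\<sigma> \<beta>))" .
  have "(\<Sum>a<m. \<psi> a * conj a) = (\<Sum>a<m. \<Sum>i\<le>degree f. of_rat (Polynomial.coeff f i) * (\<psi> a * z ^ (a * i)))"
    unfolding conj_sum sum_distrib_left by (simp only: mult_ac)
  also have "\<dots> = (\<Sum>i\<le>degree f. of_rat (Polynomial.coeff f i) * \<psi>.G i)"
    unfolding \<psi>.G_def z_eq sum_distrib_left by (rule sum.swap)
  also have "\<dots> = (\<Sum>i\<le>degree f. of_rat (Polynomial.coeff f i) * (cnj (\<psi> i) * \<tau>))"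
    unfolding \<tau>_def by (simp only: \<psi>.G_eq[symmetric])
  also have "\<dots> = (\<Sum>i\<le>degree f. of_rat (Polynomial.coeff f i) * cnj (\<psi> i)) * \<tau>"
    by (simp only: sum_distrib_right mult.assoc)
  finally have 2: "of_nat c * (\<beta> + \<omega> * \<sigma> \<beta> + \<omega>\<^sup>2 * \<sigma> (\<sigma> \<beta>)) = (\<Sum>i\<le>degree f. of_rat (Polynomial.coeff f i) * cnj (\<psi> i)) * \<tau>"
    unfolding 1 .
  define Q where "Q = {r + s * \<omega> | r s. r \<in> \<rat> \<and> s \<in> \<rat>}"
  have QI: "r + s * \<omega> \<in> Q" if "r \<in> \<rat>" "s \<in> \<rat>" for r s unfolding Q_def mem_Collect_eq using that by (intro exI conjI) (rule refl)
  have Qadd: "x + y \<in> Q" if xy: "x \<in> Q" "y \<in> Q" for x y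
  proof -
    obtain r s where x: "x = r + s * \<omega>" "r \<in> \<rat>" "s \<in> \<rat>" using xy(1)[unfolded Q_def mem_Collect_eq] by - (elim exE conjE, (rule that; assumption))
    obtain r' s' where y: "y = r' + s' * \<omega>" "r' \<in> \<rat>" "s' \<in> \<rat>" using xy(2)[unfolded Q_def mem_Collect_eq] by - (elim exE conjE, (rule that; assumption))
    have "x + y = (r + r') + (s + s') * \<omega>" unfolding x(1) y(1) by (simp only: distrib_right add.assoc add.left_commute)
    then show ?thesis using QI[OF Rats_add[OF x(2) y(2)] Rats_add[OF x(3) y(3)]] by (simp only:)
  qed
  have Qscale: "q * x \<in> Q" if xy: "q \<in> \<rat>" "x \<in> Q" for x q
  proof -
    obtain r s where x: "x = r + s * \<omega>" "r \<in> \<rat>" "s \<in> \<rat>" using xy(2)[unfolded Q_def mem_Collect_eq] by - (elim exE conjE, (rule that; assumption))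
    have "q * x = q * r + q * s * \<omega>" unfolding x(1) by (simp only: distrib_left mult.assoc)
    then show ?thesis using QI[OF Rats_mult[OF xy(1) x(2)] Rats_mult[OF xy(1) x(3)]] by (simp only:)
  qed
  have Qsum: "sum g A \<in> Q" if "finite A" "\<And>i. i \<in> A \<Longrightarrow> g i \<in> Q" for A and g :: "nat \<Rightarrow> complex"
    using that QI[OF Rats_0 Rats_0] by (induction A rule: finite_induct) (simp_all add: Qadd)
  have Q\<psi>: "cnj (\<psi> i) \<in> Q" for i
  proof (cases "coprime i m")
    case True
    have "1 + 0 * \<omega> \<in> Q" "0 + 1 * \<omega> \<in> Q" "- 1 + (- 1) * \<omega> \<in> Q" by (rule QI; simp)+
    then have Q: "1 \<in> Q" "\<omega> \<in> Q" "- 1 - \<omega> \<in> Q" by simp_all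
    have c2: "cnj (\<omega>\<^sup>2) = \<omega>" unfolding \<omega>_square complex_cnj_diff cnj_\<omega> by simp
    have "\<psi> i ^ 3 = 1" by (rule \<psi>.\<psi>_cube[OF True])
    then consider "\<psi> i = 1" | "\<psi> i = \<omega>" | "\<psi> i = \<omega>\<^sup>2" unfolding cube_root_unity by blast
    then show ?thesis
    proof cases
      case 1 show ?thesis unfolding 1 using Q by (simp only: complex_cnj_one)
    next
      case 2 show ?thesis unfolding 2 cnj_\<omega> by (rule Q)
    next
      case 3 show ?thesis unfolding 3 c2 by (rule Q)
    qed
  next
    case False
    then show ?thesis using QI[OF Rats_0 Rats_0] by (simp add: \<psi>_def)
  qed
  have "(\<Sum>i\<le>degree f. of_rat (Polynomial.coeff f i) * cnj (\<psi> i)) \<in> Q"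
    by (rule Qsum[OF finite_atMost Qscale[OF Rats_of_rat Q\<psi>]])
  then have "1 / of_nat c * (\<Sum>i\<le>degree f. of_rat (Polynomial.coeff f i) * cnj (\<psi> i)) \<in> Q"
    by (rule Qscale[OF Rats_divide[OF Rats_1 Rats_of_nat]])
  then obtain r s where rs: "1 / of_nat c * (\<Sum>i\<le>degree f. of_rat (Polynomial.coeff f i) * cnj (\<psi> i)) = r + s * \<omega>" "r \<in> \<rat>" "s \<in> \<rat>"
    unfolding Q_def mem_Collect_eq by - (elim exE conjE, (rule that; assumption))
  have "\<beta> + \<omega> * \<sigma> \<beta> + \<omega>\<^sup>2 * \<sigma> (\<sigma> \<beta>) = 1 / of_nat c * (of_nat c * (\<beta> + \<omega> * \<sigma> \<beta> + \<omega>\<^sup>2 * \<sigma> (\<sigma> \<beta>)))"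
    using c0 by simp
  also have "\<dots> = (r + s * \<omega>) * \<tau>" unfolding 2 rs(1)[symmetric] by (simp only: mult.assoc)
  finally show ?thesis using rs(2,3) by blast
qed

lemma F_cnj: "x \<in> F \<Longrightarrow> cnj x = x"
  using F_real Reals_cnj_iff by blast

text \<open>
  Starting from any element of trace zero, its resolvent is a nonzero element of
  \<open>\<rat>(\<omega>)\<close> times the Gauss sum. Since \<open>\<sigma>\<close> multiplies
  resolvents by a cube root of unity, a rational combination of conjugates has the Gauss sum
  itself as its resolvent.
\<close>

theorem gauss_generator:
  obtains \<theta> and a b :: int where
    "\<theta> * cnj \<theta> = of_nat n" "\<theta> ^ 3 = of_nat n * (of_int a + of_int b * \<omega>)"
    "a\<^sup>2 - a * b + b\<^sup>2 = int n" "\<not> 3 dvd b"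
    "\<theta> + cnj \<theta> \<in> F" "\<sigma> (\<theta> + cnj \<theta>) = \<omega>\<^sup>2 * \<theta> + cnj (\<omega>\<^sup>2 * \<theta>)"
    "\<sigma> (\<sigma> (\<theta> + cnj \<theta>)) = \<omega> * \<theta> + cnj (\<omega> * \<theta>)"
proof -
  define Res where "Res y = y + \<omega> * \<sigma> y + \<omega>\<^sup>2 * \<sigma> (\<sigma> y)" for y
  define T where "T y \<longleftrightarrow> y \<in> F \<and> y + \<sigma> y + \<sigma> (\<sigma> y) = 0" for y
  have T\<sigma>: "T (\<sigma> y)" if "T y" for y
  proof -
    have y: "y \<in> F" "y + \<sigma> y + \<sigma> (\<sigma> y) = 0" using that by (simp_all only: T_def)
    have "\<sigma> y + \<sigma> (\<sigma> y) + \<sigma> (\<sigma> (\<sigma> y)) = 0" unfolding \<sigma>_cube[OF y(1)] using y(2) by (simp only: ac_simps)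
    then show ?thesis unfolding T_def using \<sigma>_closed[OF y(1)] by (rule conjI[rotated])
  qed
  have w3: "\<omega>\<^sup>2 * \<omega> = 1" "\<omega>\<^sup>2 * \<omega>\<^sup>2 = \<omega>"
    unfolding \<omega>_square by (simp_all add: algebra_simps \<omega>_mult)
  have Res\<sigma>: "Res (\<sigma> y) = \<omega>\<^sup>2 * Res y" if "y \<in> F" for y
  proof -
    have "\<omega>\<^sup>2 * Res y = \<omega>\<^sup>2 * y + (\<omega>\<^sup>2 * \<omega>) * \<sigma> y + (\<omega>\<^sup>2 * \<omega>\<^sup>2) * \<sigma> (\<sigma> y)"
      unfolding Res_def by (simp only: distrib_left mult.assoc)
    then show ?thesis unfolding w3 Res_def \<sigma>_cube[OF that] by (simp only: mult_1 ac_simps)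
  qed
  have Res_cnj: "Res y + cnj (Res y) = 3 * y" if "T y" for y
  proof -
    have y: "y \<in> F" "y + \<sigma> y + \<sigma> (\<sigma> y) = 0" using that by (simp_all only: T_def)
    have c: "cnj y = y" "cnj (\<sigma> y) = \<sigma> y" "cnj (\<sigma> (\<sigma> y)) = \<sigma> (\<sigma> y)"
      using y(1) by (simp_all add: F_cnj \<sigma>_closed)
    have "Res y + cnj (Res y) = 3 * y - (y + \<sigma> y + \<sigma> (\<sigma> y))"
      unfolding Res_def \<omega>_square by (simp add: c cnj_\<omega> algebra_simps)
    then show ?thesis unfolding y(2) by simp
  qed
  have T\<beta>: "T \<beta>" using \<beta> by (simp only: T_def)
  obtain r where r: "r \<in> \<rat>" "\<exists>s\<in>\<rat>. \<beta> + \<omega> * \<sigma> \<beta> + \<omega>\<^sup>2 * \<sigma> (\<sigma> \<beta>) = (r + s * \<omega>) * \<tau>"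
    by (rule bexE[OF resolvent_multiple])
  obtain s where s: "s \<in> \<rat>" "\<beta> + \<omega> * \<sigma> \<beta> + \<omega>\<^sup>2 * \<sigma> (\<sigma> \<beta>) = (r + s * \<omega>) * \<tau>"
    by (rule bexE[OF r(2)])
  have rs: "r \<in> \<rat>" "s \<in> \<rat>" "Res \<beta> = (r + s * \<omega>) * \<tau>" unfolding Res_def by (fact r s)+
  have \<beta>0: "\<beta> \<noteq> 0" using \<beta>(2) by auto
  have R0: "Res \<beta> \<noteq> 0"
  proof
    assume "Res \<beta> = 0"
    then have "3 * \<beta> = 0" using Res_cnj[OF T\<beta>] by simp
    with \<beta>0 show False by simp
  qed
  have c: "cnj r = r" "cnj s = s" using rs(1,2) by (simp_all add: F_cnj Rats_F)
  define N where "N = r * r - r * s + s * s"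
  have N: "(r + s * \<omega>) * (r - s - s * \<omega>) = N"
    unfolding N_def by (simp add: algebra_simps \<omega>_mult)
  have Nc: "r - s - s * \<omega> = cnj (r + s * \<omega>)" by (simp add: c cnj_\<omega> algebra_simps)
  have "r + s * \<omega> \<noteq> 0" using R0 rs(3) by auto
  then have N0: "N \<noteq> 0" unfolding N[symmetric] Nc by (simp only: mult_eq_0_iff complex_cnj_zero_iff simp_thms not_False_eq_True)
  have NQ: "N \<in> \<rat>" unfolding N_def by (intro Rats_add Rats_diff Rats_mult rs)
  define u v where "u = (r - s) / N" and "v = - s / N"
  have uv: "u \<in> \<rat>" "v \<in> \<rat>" unfolding u_def v_def by (intro Rats_divide Rats_diff NQ rs Rats_minus_iff[THEN iffD2])+
  have \<tau>: "(u + v * \<omega>) * Res \<beta> = \<tau>"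
  proof -
    have "(u + v * \<omega>) * (r + s * \<omega>) = ((r + s * \<omega>) * (r - s - s * \<omega>)) / N"
      unfolding u_def v_def using N0 by (simp add: field_simps)
    then have "(u + v * \<omega>) * (r + s * \<omega>) = 1" unfolding N using N0 by simp
    then show ?thesis unfolding rs(3) mult.assoc[symmetric] by simp
  qed
  define \<beta>2 where "\<beta>2 = \<sigma> (\<sigma> \<beta>)"
  have \<beta>2: "\<beta>2 \<in> F" "T \<beta>2" "Res \<beta>2 = \<omega> * Res \<beta>"
  proof -
    show "\<beta>2 \<in> F" unfolding \<beta>2_def by (intro \<sigma>_closed \<beta>)
    show "T \<beta>2" unfolding \<beta>2_def by (intro T\<sigma> T\<beta>)
    have "Res \<beta>2 = (\<omega>\<^sup>2 * \<omega>\<^sup>2) * Res \<beta>"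
      unfolding \<beta>2_def Res\<sigma>[OF \<sigma>_closed[OF \<beta>(1)]] Res\<sigma>[OF \<beta>(1)] by (simp only: mult.assoc)
    then show "Res \<beta>2 = \<omega> * Res \<beta>" unfolding w3 .
  qed
  define \<alpha> where "\<alpha> = u * \<beta> + v * \<beta>2"
  have lin: "\<sigma> (u * x + v * y) = u * \<sigma> x + v * \<sigma> y" if "x \<in> F" "y \<in> F" for x y
    using that uv by (simp add: \<sigma>_add \<sigma>_mult \<sigma>_rat F_mult Rats_F)
  have \<alpha>F: "\<alpha> \<in> F" unfolding \<alpha>_def by (intro F_add F_mult Rats_F uv \<beta>(1) \<beta>2(1))
  have \<alpha>1: "\<sigma> \<alpha> = u * \<sigma> \<beta> + v * \<sigma> \<beta>2" unfolding \<alpha>_def by (rule lin[OF \<beta>(1) \<beta>2(1)])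
  have \<alpha>2: "\<sigma> (\<sigma> \<alpha>) = u * \<sigma> (\<sigma> \<beta>) + v * \<sigma> (\<sigma> \<beta>2)"
    unfolding \<alpha>1 by (rule lin[OF \<sigma>_closed[OF \<beta>(1)] \<sigma>_closed[OF \<beta>2(1)]])
  have "\<alpha> + \<sigma> \<alpha> + \<sigma> (\<sigma> \<alpha>) = u * (\<beta> + \<sigma> \<beta> + \<sigma> (\<sigma> \<beta>)) + v * (\<beta>2 + \<sigma> \<beta>2 + \<sigma> (\<sigma> \<beta>2))"
    unfolding \<alpha>2 unfolding \<alpha>1 unfolding \<alpha>_def by (simp add: algebra_simps)
  also have "\<dots> = 0"
  proof -
    have "\<beta>2 + \<sigma> \<beta>2 + \<sigma> (\<sigma> \<beta>2) = 0" using \<beta>2(2) by (simp only: T_def)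
    then show ?thesis using \<beta>(3) by (simp only: mult_zero_right add_0)
  qed
  finally have T\<alpha>: "T \<alpha>" unfolding T_def using \<alpha>F by blast
  have "Res \<alpha> = u * Res \<beta> + v * Res \<beta>2"
    unfolding Res_def unfolding \<alpha>2 unfolding \<alpha>1 unfolding \<alpha>_def by (simp add: algebra_simps)
  also have "\<dots> = (u + v * \<omega>) * Res \<beta>" unfolding \<beta>2(3) by (simp only: distrib_right mult.assoc)
  finally have R\<alpha>: "Res \<alpha> = \<tau>" unfolding \<tau> .
  define \<theta> where "\<theta> = \<tau> / 3"
  have third: "x / 3 + cnj (x / 3) = y" if "x + cnj x = 3 * y" for x y
    using arg_cong[OF that, of "\<lambda>z. z / 3"] by (simp add: add_divide_distrib)
  have 1: "\<theta> + cnj \<theta> = \<alpha>" unfolding \<theta>_def by (rule third) (use Res_cnj[OF T\<alpha>] in \<open>simp only: R\<alpha>\<close>)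
  have "\<omega>\<^sup>2 * \<tau> + cnj (\<omega>\<^sup>2 * \<tau>) = 3 * \<sigma> \<alpha>"
    using Res_cnj[OF T\<sigma>[OF T\<alpha>]] unfolding Res\<sigma>[OF \<alpha>F] R\<alpha> .
  then have 2: "\<sigma> \<alpha> = \<omega>\<^sup>2 * \<theta> + cnj (\<omega>\<^sup>2 * \<theta>)"
    unfolding \<theta>_def times_divide_eq_right by (rule third[symmetric])
  obtain a b :: int where ab: "\<tau> ^ 3 = of_nat (27 * n) * (of_int a + of_int b * \<omega>)" "a\<^sup>2 - a * b + b\<^sup>2 = int n" "\<not> 3 dvd b"
    unfolding \<tau>_def by (rule \<psi>.gauss_sum_cube)
  have 3: "\<theta> ^ 3 = of_nat n * (of_int a + of_int b * \<omega>)"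
    unfolding \<theta>_def power_divide ab(1) by simp
  have G: "\<tau> * cnj \<tau> = of_nat m" unfolding \<tau>_def by (rule \<psi>.G_norm)
  have m': "(of_nat m :: complex) = 9 * of_nat n"
    using arg_cong[OF m, of "of_nat :: nat \<Rightarrow> complex"] by (simp only: of_nat_mult of_nat_numeral)
  have "\<theta> * cnj \<theta> = (\<tau> * cnj \<tau>) / 9" unfolding \<theta>_def by simp
  then have 4: "\<theta> * cnj \<theta> = of_nat n" unfolding G m' by simp
  have "\<alpha> + \<sigma> \<alpha> + \<sigma> (\<sigma> \<alpha>) = 0" using T\<alpha> by (simp only: T_def)
  then have "\<sigma> (\<sigma> \<alpha>) = - (\<alpha> + \<sigma> \<alpha>)" by (rule minus_unique[symmetric])
  also have "\<dots> = - ((\<theta> + cnj \<theta>) + (\<omega>\<^sup>2 * \<theta> + cnj (\<omega>\<^sup>2 * \<theta>)))" by (simp only: 1 2)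
  also have "\<dots> = \<omega> * \<theta> + cnj (\<omega> * \<theta>)" unfolding \<omega>_square by (simp add: algebra_simps)
  finally have 5: "\<sigma> (\<sigma> \<alpha>) = \<omega> * \<theta> + cnj (\<omega> * \<theta>)" .
  show ?thesis by (rule that[OF 4 3 ab(2,3)]) (simp_all only: 1 \<alpha>F 2[symmetric] 5[symmetric])
qed

end

section \<open>Eisenstein integers\<close>

text \<open>
  \<open>Eis x y\<close> stands for \<open>x + y \<omega>\<close>. A datatype of pairs of
  integers keeps divisibility statements inside the ring.
\<close>

datatype eis = Eis (epart: int) (wpart: int)

lemma eis_eqI: "epart u = epart v \<Longrightarrow> wpart u = wpart v \<Longrightarrow> u = v"
  by (cases u; cases v) simp

instantiation eis :: comm_ring_1
begin

definition "0 = Eis 0 0"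
definition "1 = Eis 1 0"
definition "u + v = Eis (epart u + epart v) (wpart u + wpart v)"
definition "u - v = Eis (epart u - epart v) (wpart u - wpart v)"
definition "- u = Eis (- epart u) (- wpart u)"
definition "u * v = Eis (epart u * epart v - wpart u * wpart v) (epart u * wpart v + wpart u * epart v - wpart u * wpart v)"

instance
  by standard (simp_all add: zero_eis_def one_eis_def plus_eis_def minus_eis_def uminus_eis_def times_eis_def algebra_simps)

end

lemma eis_parts [simp]:
  "epart 0 = 0" "wpart 0 = 0" "epart 1 = 1" "wpart 1 = 0"
  "epart (u + v) = epart u + epart v" "wpart (u + v) = wpart u + wpart v"
  "epart (u - v) = epart u - epart v" "wpart (u - v) = wpart u - wpart v"
  "epart (- u) = - epart u" "wpart (- u) = - wpart u"
  "epart (u * v) = epart u * epart v - wpart u * wpart v"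
  "wpart (u * v) = epart u * wpart v + wpart u * epart v - wpart u * wpart v"
  by (simp_all add: zero_eis_def one_eis_def plus_eis_def minus_eis_def uminus_eis_def times_eis_def)

lemma eis_of_nat [simp]: "epart (of_nat k) = int k" "wpart (of_nat k) = 0"
  by (induction k) simp_all

lemma eis_of_int [simp]: "epart (of_int k) = k" "wpart (of_int k) = 0"
  by (cases k rule: int_cases2; simp)+

lemma eis_numeral [simp]: "epart (numeral k) = numeral k" "wpart (numeral k) = 0"
  using eis_of_int[of "numeral k"] by simp_all

definition econj :: "eis \<Rightarrow> eis" where "econj u = Eis (epart u - wpart u) (- wpart u)"
definition etr :: "eis \<Rightarrow> int" where "etr u = 2 * epart u - wpart u"
definition enorm :: "eis \<Rightarrow> int" where "enorm u = epart u * epart u - epart u * wpart u + wpart u * wpart u"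

lemma econj_simps [simp]: "epart (econj u) = epart u - wpart u" "wpart (econj u) = - wpart u"
  by (simp_all add: econj_def)

lemma econj_hom: "econj (u + v) = econj u + econj v" "econj (u - v) = econj u - econj v"
  "econj (u * v) = econj u * econj v" "econj (of_int k) = of_int k" "econj (- u) = - econj u"
  "econj (econj u) = u" "econj 0 = 0" "econj 1 = 1"
  by (rule eis_eqI; simp add: algebra_simps)+

lemma econj_power: "econj (u ^ k) = econj u ^ k"
  by (induction k) (simp_all add: econj_hom)

lemma etr_eq: "of_int (etr u) = u + econj u"
  by (rule eis_eqI) (simp_all add: etr_def)

lemma enorm_eq: "of_int (enorm u) = u * econj u"
  by (rule eis_eqI) (simp_all add: enorm_def algebra_simps)

lemma enorm_mult: "enorm (u * v) = enorm u * enorm v"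
  by (simp add: enorm_def algebra_simps)

lemma enorm_econj: "enorm (econj u) = enorm u"
  by (simp add: enorm_def algebra_simps)

lemma etr_simps: "etr (u + v) = etr u + etr v" "etr (u - v) = etr u - etr v" "etr (of_int k * u) = k * etr u" "etr (econj u) = etr u"
  by (simp_all add: etr_def algebra_simps)

lemma enorm_of_int: "enorm (of_int k) = k * k"
  by (simp add: enorm_def)

lemma four_enorm: "4 * enorm u = (2 * epart u - wpart u)\<^sup>2 + 3 * (wpart u)\<^sup>2"
  by (simp add: enorm_def power2_eq_square algebra_simps)

lemma enorm_nonneg: "enorm u \<ge> 0"
proof -
  have "4 * enorm u \<ge> 0" unfolding four_enorm by (intro add_nonneg_nonneg mult_nonneg_nonneg zero_le_power2) simp
  then show ?thesis by simp
qed

lemma enorm_zero: "enorm u = 0 \<longleftrightarrow> u = 0"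
proof
  assume "enorm u = 0"
  then have "(2 * epart u - wpart u)\<^sup>2 + 3 * (wpart u)\<^sup>2 = 0" using four_enorm[of u] by simp
  moreover have "(2 * epart u - wpart u)\<^sup>2 \<ge> 0" "(wpart u)\<^sup>2 \<ge> 0" by simp_all
  ultimately have "(2 * epart u - wpart u)\<^sup>2 = 0" "(wpart u)\<^sup>2 = 0" by linarith+
  then show "u = 0" by (intro eis_eqI) simp_all
qed (simp add: enorm_def)

instance eis :: idom
proof
  fix u v :: eis assume "u \<noteq> 0" "v \<noteq> 0"
  then have "enorm u \<noteq> 0" "enorm v \<noteq> 0" by (simp_all add: enorm_zero)
  then have "enorm (u * v) \<noteq> 0" unfolding enorm_mult by simp
  then show "u * v \<noteq> 0" unfolding enorm_zero .
qed

lemma of_int_dvd_eis: "of_int k dvd u \<longleftrightarrow> k dvd epart u \<and> k dvd wpart u"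
proof
  assume "of_int k dvd u"
  then obtain v where "u = of_int k * v" by (rule dvdE)
  then show "k dvd epart u \<and> k dvd wpart u" by simp
next
  assume "k dvd epart u \<and> k dvd wpart u"
  then obtain x y where "epart u = k * x" "wpart u = k * y" by (auto elim!: dvdE)
  then have "u = of_int k * Eis x y" by (intro eis_eqI) simp_all
  then show "of_int k dvd u" by simp
qed

lemma of_int_eq_0_eis [simp]: "(of_int k :: eis) = 0 \<longleftrightarrow> k = 0"
  by (metis eis_of_int(1) eis_parts(1) of_int_0)

lemma of_int_dvd_of_int_eis: "(of_int k :: eis) dvd of_int l \<longleftrightarrow> k dvd l"
  by (simp add: of_int_dvd_eis)

lemma prime_dvd_of_int_mult:
  assumes "Factorial_Ring.prime (p :: int)" "\<not> p dvd t" "of_int p dvd of_int t * (u :: eis)"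
  shows "of_int p dvd u"
  using assms by (simp add: of_int_dvd_eis prime_dvd_mult_iff)

lemma dvd_etr: "of_int p dvd u \<Longrightarrow> p dvd etr u"
  by (simp add: of_int_dvd_eis etr_def)

text \<open>Two opposite prime ideals above p are separated by the divisor pi of n.\<close>

locale eis_prime =
  fixes p n :: int and \<pi> :: eis
  assumes p: "Factorial_Ring.prime p" "p \<noteq> 3" "p \<noteq> 2" and n: "enorm \<pi> = n" "p dvd n" "\<not> p * p dvd n"
begin

abbreviation "P \<equiv> (of_int p :: eis)"

lemma conj_locale: "eis_prime p n (econj \<pi>)"
  using p n by unfold_locales (simp_all add: enorm_econj)

lemma P_norm: "P dvd \<pi> * econj \<pi>"
  unfolding enorm_eq[symmetric] n(1) of_int_dvd_of_int_eis by (rule n(2))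

text \<open>
  Otherwise \<open>p\<close> would divide \<open>\<pi>\<close>, and \<open>p\<^sup>2\<close> its
  norm \<open>n\<close>.
\<close>

lemma trace_unit: "\<not> p dvd etr \<pi>"
proof
  assume t: "p dvd etr \<pi>"
  have "4 * n = (etr \<pi>)\<^sup>2 + 3 * (wpart \<pi>)\<^sup>2" using four_enorm[of \<pi>] n(1) by (simp add: etr_def)
  then have e: "3 * (wpart \<pi>)\<^sup>2 = 4 * n - etr \<pi> * etr \<pi>" by (simp add: power2_eq_square)
  have "p dvd 3 * (wpart \<pi>)\<^sup>2" unfolding e using t n(2) by simp
  moreover have "\<not> p dvd 3"
  proof
    assume "p dvd 3"
    moreover have "Factorial_Ring.prime (3 :: int)" by simp
    ultimately show False using p(1,2) primes_dvd_imp_eq by blast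
  qed
  ultimately have "p dvd (wpart \<pi>)\<^sup>2" using prime_dvd_multD[OF p(1)] by blast
  then have "p dvd wpart \<pi>" by (rule prime_dvd_power[OF p(1)])
  then have "p * p dvd 3 * (wpart \<pi> * wpart \<pi>)" by (intro dvd_mult mult_dvd_mono)
  moreover have "p * p dvd etr \<pi> * etr \<pi>" using t by (intro mult_dvd_mono)
  ultimately have "p * p dvd etr \<pi> * etr \<pi> + 3 * (wpart \<pi> * wpart \<pi>)" by (rule dvd_add[rotated])
  also have "etr \<pi> * etr \<pi> + 3 * (wpart \<pi> * wpart \<pi>) = 4 * n" using e by (simp add: power2_eq_square)
  finally have "p * p dvd 4 * n" .
  moreover have "coprime (p * p) 4"
  proof -
    have "\<not> p dvd 2"
    proof
      assume "p dvd 2"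
      moreover have "Factorial_Ring.prime (2 :: int)" by simp
      ultimately show False using p(1,3) primes_dvd_imp_eq by blast
    qed
    then have "coprime p 2" using p(1) by (rule prime_imp_coprime[rotated])
    then have "coprime (p * p) (2 * 2)" unfolding coprime_mult_left_iff coprime_mult_right_iff by blast
    then show ?thesis by simp
  qed
  ultimately have "p * p dvd n" using coprime_dvd_mult_right_iff by blast
  with n(3) show False by blast
qed

text \<open>
  The prime \<open>p\<close> splits and \<open>\<pi>\<close> lies in exactly one of the two
  primes above it. The trace of \<open>u \<pi>\<close> then sees \<open>u \<pi>\<close> modulo
  the other one.
\<close>

lemma dvd_pi_mult:
  assumes "p dvd etr (u * \<pi>)"
  shows "P dvd u * \<pi>"
proof -
  define t where "t = etr \<pi>"
  have T: "of_int t = \<pi> + econj \<pi>" unfolding t_def by (rule etr_eq)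
  have "of_int t * (u * \<pi>) = (u * \<pi> + econj u * econj \<pi>) * \<pi> + (u - econj u) * (\<pi> * econj \<pi>)"
    unfolding T by (simp add: algebra_simps)
  also have "u * \<pi> + econj u * econj \<pi> = of_int (etr (u * \<pi>))" by (simp add: etr_eq econj_hom)
  finally have "of_int t * (u * \<pi>) = of_int (etr (u * \<pi>)) * \<pi> + (u - econj u) * (\<pi> * econj \<pi>)" .
  moreover have "P dvd of_int (etr (u * \<pi>))" using assms by (simp only: of_int_dvd_of_int_eis)
  ultimately have "P dvd of_int t * (u * \<pi>)" using P_norm by simp
  then show ?thesis using prime_dvd_of_int_mult[OF p(1)] trace_unit unfolding t_def by blast
qed

lemma dvd_cube_trace:
  assumes "p dvd etr (u ^ 3 * \<pi>)"
  shows "P dvd u * \<pi>"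
proof (rule dvd_pi_mult)
  define v where "v = econj u"
  define \<rho> where "\<rho> = econj \<pi>"
  have N: "P dvd \<pi> * \<rho>" unfolding \<rho>_def by (rule P_norm)
  have "of_int (etr (u * \<pi>) ^ 3) = (u * \<pi> + v * \<rho>) ^ 3"
    by (simp add: etr_eq econj_hom v_def \<rho>_def)
  also have "\<dots> = (u ^ 3 * \<pi> + v ^ 3 * \<rho>) * (\<pi> + \<rho>)\<^sup>2
     + (\<pi> * \<rho>) * (3 * u\<^sup>2 * v * \<pi> + 3 * u * v\<^sup>2 * \<rho> - 2 * (u ^ 3 * \<pi> + v ^ 3 * \<rho>) - u ^ 3 * \<rho> - v ^ 3 * \<pi>)"
    by (simp add: power3_eq_cube power2_eq_square algebra_simps)
  also have "u ^ 3 * \<pi> + v ^ 3 * \<rho> = of_int (etr (u ^ 3 * \<pi>))"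
    by (simp add: etr_eq econj_hom econj_power v_def \<rho>_def)
  finally have "P dvd of_int (etr (u * \<pi>) ^ 3)"
    using N assms by (simp add: of_int_dvd_of_int_eis)
  then have "p dvd etr (u * \<pi>) ^ 3" by (simp only: of_int_dvd_of_int_eis)
  then show "p dvd etr (u * \<pi>)" by (rule prime_dvd_power[OF p(1)])
qed

end

text \<open>
  One factor \<open>p\<close> of the trace already gives that \<open>p\<close> divides \<open>u
  \<pi>\<close>, which is divisibility of \<open>u\<close> by one of the two primes above
  \<open>p\<close>; the second factor takes care of the other prime.
\<close>

lemma (in eis_prime) dvd_if_square_dvd_cube_trace:
  assumes "p * p dvd etr (u ^ 3 * \<pi>)"
  shows "P dvd u"
proof -
  have p0: "p \<noteq> 0" using p(1) by auto
  have "p dvd etr (u ^ 3 * \<pi>)" using assms by (rule dvd_mult_left)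
  then have d1: "P dvd u * \<pi>" by (rule dvd_cube_trace)
  then obtain v where v: "u * \<pi> = P * v" by (rule dvdE)
  obtain c where c: "n = p * c" using n(2) by (rule dvdE)
  have pc: "\<not> p dvd c" using n(3) unfolding c by (auto simp: p0)
  have "u ^ 3 * \<pi> = P * (u\<^sup>2 * v)"
  proof -
    have "u ^ 3 * \<pi> = u\<^sup>2 * (u * \<pi>)" by (simp only: power3_eq_cube power2_eq_square mult.assoc)
    then show ?thesis unfolding v by (simp only: mult_ac)
  qed
  then have "etr (u ^ 3 * \<pi>) = p * etr (u\<^sup>2 * v)" by (simp add: etr_simps)
  with assms p0 have tv: "p dvd etr (u\<^sup>2 * v)" by simp
  have cu: "econj \<pi> * v = of_int c * u"
  proof -
    have "P * (econj \<pi> * v) = u * (\<pi> * econj \<pi>)" using v by (simp add: mult_ac)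
    also have "\<dots> = P * (of_int c * u)" unfolding enorm_eq[symmetric] n(1) c by (simp add: mult_ac)
    finally have e: "P * (econj \<pi> * v) = P * (of_int c * u)" .
    have "P \<noteq> 0" using p0 by simp
    from mult_left_cancel[OF this, THEN iffD1, OF e] show ?thesis .
  qed
  have "of_int (etr (u\<^sup>2 * v)) * (econj \<pi>)\<^sup>2 = of_int c * (u ^ 3 * econj \<pi>) + P * (econj u * econj \<pi> * econj v * econj v)"
  proof -
    have 1: "u\<^sup>2 * v * (econj \<pi>)\<^sup>2 = of_int c * (u ^ 3 * econj \<pi>)"
    proof -
      have "u\<^sup>2 * v * (econj \<pi>)\<^sup>2 = u\<^sup>2 * econj \<pi> * (econj \<pi> * v)" by (simp only: power2_eq_square mult_ac)
      then show ?thesis unfolding cu by (simp only: power2_eq_square power3_eq_cube mult_ac)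
    qed
    have 2: "econj (u\<^sup>2 * v) * (econj \<pi>)\<^sup>2 = P * (econj u * econj \<pi> * econj v * econj v)"
    proof -
      have e: "econj u * econj \<pi> = P * econj v" using arg_cong[OF v, of econj] by (simp only: econj_hom)
      have "econj (u\<^sup>2 * v) * (econj \<pi>)\<^sup>2 = econj u * econj \<pi> * econj v * (econj u * econj \<pi>)"
        by (simp only: econj_hom econj_power power2_eq_square mult_ac)
      also have "\<dots> = econj u * econj \<pi> * econj v * (P * econj v)" by (simp only: e)
      finally show ?thesis by (simp only: mult_ac)
    qed
    show ?thesis unfolding etr_eq distrib_right 1 2 ..
  qed
  moreover have "P dvd of_int (etr (u\<^sup>2 * v))" using tv by (simp only: of_int_dvd_of_int_eis)
  ultimately have "P dvd of_int c * (u ^ 3 * econj \<pi>) + P * (econj u * econj \<pi> * econj v * econj v)"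
    by (metis dvd_mult2)
  then have "P dvd of_int c * (u ^ 3 * econj \<pi>)" by (simp only: dvd_add_left_iff dvd_triv_left)
  then have "P dvd u ^ 3 * econj \<pi>" by (rule prime_dvd_of_int_mult[OF p(1) pc])
  then have "p dvd etr (u ^ 3 * econj \<pi>)" by (rule dvd_etr)
  then have d2: "P dvd u * econj \<pi>" by (rule eis_prime.dvd_cube_trace[OF conj_locale])
  have "of_int (etr \<pi>) * u = u * \<pi> + u * econj \<pi>" unfolding etr_eq by (simp add: algebra_simps)
  then have "P dvd of_int (etr \<pi>) * u" using d1 d2 by simp
  then show ?thesis by (rule prime_dvd_of_int_mult[OF p(1) trace_unit])
qed

definition eC :: "eis \<Rightarrow> complex" where "eC u = of_int (epart u) + of_int (wpart u) * \<omega>"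

lemma eC_hom: "eC (u + v) = eC u + eC v" "eC (u - v) = eC u - eC v" "eC (u * v) = eC u * eC v"
  "eC (of_int k) = of_int k" "eC (- u) = - eC u" "eC 0 = 0" "eC 1 = 1"
  by (simp_all add: eC_def algebra_simps \<omega>_mult)

lemma eC_power: "eC (u ^ k) = eC u ^ k"
  by (induction k) (simp_all add: eC_hom)

lemma eC_econj: "eC (econj u) = cnj (eC u)"
  by (simp add: eC_def cnj_\<omega> algebra_simps)

lemma eC_etr: "eC u + cnj (eC u) = of_int (etr u)"
  unfolding eC_econj[symmetric] eC_hom(1)[symmetric] etr_eq[symmetric] eC_hom(4) ..

lemma eC_enorm: "eC u * cnj (eC u) = of_int (enorm u)"
  unfolding eC_econj[symmetric] eC_hom(3)[symmetric] enorm_eq[symmetric] eC_hom(4) ..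

text \<open>The condition at 3, where the field is wildly ramified.\<close>

text \<open>
  Integrality at \<open>3\<close>: this is where it matters that \<open>\<pi>\<close> is not
  congruent to a rational integer modulo three. It excludes denominators \<open>3\<close>.
\<close>

lemma wild_condition:
  fixes a b k x y n :: int
  assumes n: "n = a * a - a * b + b * b" "n mod 3 = 1" and b: "\<not> 3 dvd b"
    and 1: "3 dvd k * k - (x * x - x * y + y * y)"
    and 2: "27 dvd k ^ 3 - 3 * n * k * (x * x - x * y + y * y) + n * ((2 * a - b) * (x ^ 3 + y ^ 3 - 3 * x * y\<^sup>2) - 3 * (a + b) * (x\<^sup>2 * y - x * y\<^sup>2))"
  shows "3 dvd k \<and> 3 dvd x \<and> 3 dvd y"
proof -
  define C where "C = (2 * a - b) * (x ^ 3 + y ^ 3 - 3 * x * y\<^sup>2) - 3 * (a + b) * (x\<^sup>2 * y - x * y\<^sup>2)"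
  define N where "N = x * x - x * y + y * y"
  have N3: "N = (x + y) * (x + y) - 3 * (x * y)" by (simp add: N_def algebra_simps)
  have n1: "\<not> 3 dvd n" using n(2) by presburger
  have cop: "coprime 27 n"
  proof -
    have "Factorial_Ring.prime (3 :: int)" by simp
    then have "coprime 3 n" using n1 by (rule prime_imp_coprime)
    then have "coprime ((3 :: int) ^ 3) n" unfolding coprime_power_left_iff by blast
    moreover have "(3 :: int) ^ 3 = 27" by simp
    ultimately show ?thesis by (simp only:)
  qed
  have three: "3 dvd u \<or> 3 dvd v" if "3 dvd u * v" for u v :: int
    using that prime_dvd_multD[of 3 u v] by simp
  show ?thesis
  proof (cases "3 dvd k")
    case True
    then obtain k' where k': "k = 3 * k'" by (rule dvdE)
    have "3 dvd k * k" using True by (rule dvd_mult)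
    from dvd_diff[OF this 1[folded N_def]] have "3 dvd N" by simp
    have "N + 3 * (x * y) = (x + y) * (x + y)" unfolding N3 by simp
    then have "3 dvd (x + y) * (x + y)" using dvd_add[OF \<open>3 dvd N\<close> dvd_triv_left[of 3 "x * y"]] by (simp only:)
    then have "3 dvd x + y" using three[of "x + y" "x + y"] by blast
    then obtain w where w: "x + y = 3 * w" by (rule dvdE)
    then have x: "x = 3 * w - y" by simp
    obtain N' where N': "N = 3 * N'" using \<open>3 dvd N\<close> by (rule dvdE)
    have "27 dvd n * C"
    proof -
      have "k ^ 3 - 3 * n * k * N + n * C = 27 * (k' ^ 3 - n * k' * N') + n * C"
        unfolding k' N' by (simp add: power3_eq_cube algebra_simps)
      moreover have "27 dvd k ^ 3 - 3 * n * k * N + n * C" using 2 unfolding C_def N_def .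
      moreover have "27 dvd v" if "e = 27 * w + v" "27 dvd e" for e w v :: int using that by presburger
      ultimately show ?thesis by blast
    qed
    then have "27 dvd C" using cop by (simp add: coprime_dvd_mult_right_iff)
    moreover have "C = 27 * ((2 * a - b) * (w ^ 3 - w * w * y) - (a + b) * (w * w * y - w * y * y)) + (- 9 * (b * y ^ 3))
        + 27 * ((2 * a - b) * (w * y * y - w * y * y))"
      unfolding C_def x by (simp add: power2_eq_square power3_eq_cube algebra_simps)
    moreover have "3 dvd u" if "e = 27 * w + (- 9 * u) + 27 * v" "27 dvd e" for e u v w :: int using that by presburger
    ultimately have "3 dvd b * y ^ 3" by blast
    then have y3: "3 dvd y ^ 3" using three[of b "y ^ 3"] b by blast
    have "Factorial_Ring.prime (3 :: int)" by simp
    then have "3 dvd y" using y3 by (rule prime_dvd_power)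
    then show ?thesis using True x by presburger
  next
    case False
    have kk: "k mod 3 = 1 \<or> k mod 3 = 2" using False by presburger
    have sq: "(u * u) mod 3 = 1" if "u mod 3 = 1 \<or> u mod 3 = 2" for u :: int
    proof -
      have "(u * u) mod 3 = ((u mod 3) * (u mod 3)) mod 3" by (rule mod_mult_eq[symmetric])
      then show ?thesis using that by auto
    qed
    have cube9: "u ^ 3 = \<delta>0 + 9 * (w + 3 * (w * w * \<delta>0) + 3 * w ^ 3)"
      if "u = \<delta>0 + 3 * w" "\<delta>0 = 1 \<or> \<delta>0 = - 1" for u w \<delta>0 :: int
      unfolding that(1) using that(2) by (elim disjE) (simp_all add: power3_eq_cube algebra_simps)
    have unit: "\<exists>\<delta> w. (\<delta> = 1 \<or> \<delta> = - 1) \<and> u = \<delta> + 3 * w" if "u mod 3 = 1 \<or> u mod 3 = 2" for u :: int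
      using that by presburger
    obtain \<kappa> l where \<kappa>: "\<kappa> = 1 \<or> \<kappa> = - 1" "k = \<kappa> + 3 * l" using unit[OF kk] by blast
    have N1: "N mod 3 = 1"
    proof -
      have "v mod 3 = 1" if "3 dvd u - v" "u mod 3 = 1" for u v :: int using that by presburger
      from this[OF 1[folded N_def] sq[OF kk]] show ?thesis .
    qed
    have "(x + y) mod 3 = 1 \<or> (x + y) mod 3 = 2"
    proof (rule ccontr)
      assume "\<not> ?thesis"
      then have "3 dvd x + y" by presburger
      then have "3 dvd (x + y) * (x + y)" by (rule dvd_mult)
      moreover have "u mod 3 \<noteq> 1" if "3 dvd v" "u = v - 3 * w" for u v w :: int using that by presburger
      ultimately show False using N1 N3 by blast
    qed
    then obtain \<delta> w where \<delta>: "\<delta> = 1 \<or> \<delta> = - 1" "x + y = \<delta> + 3 * w" using unit by blast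
    then have x: "x = \<delta> + 3 * w - y" by simp
    have dd: "\<delta> * \<delta> = 1" "\<kappa> * \<kappa> = 1" using \<delta>(1) \<kappa>(1) by auto
    obtain s where s: "y ^ 3 = y + 3 * s"
    proof -
      have "y mod 3 = 0 \<or> y mod 3 = 1 \<or> y mod 3 = 2" by presburger
      moreover have "(y ^ 3) mod 3 = ((y mod 3) ^ 3) mod 3" by (rule power_mod[symmetric])
      ultimately have "(y ^ 3) mod 3 = y mod 3" by auto
      moreover have "u = v + 3 * ((u - v) div 3)" if "u mod 3 = v mod 3" for u v :: int using that by presburger
      ultimately have "y ^ 3 = y + 3 * ((y ^ 3 - y) div 3)" by blast
      then show ?thesis by (rule that)
    qed
    obtain j1 where X: "x ^ 3 + y ^ 3 - 3 * x * y\<^sup>2 = \<delta> + 9 * j1"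
    proof -
      have "x ^ 3 + y ^ 3 - 3 * x * y\<^sup>2 = \<delta> * (\<delta> * \<delta>) - 3 * (\<delta> * \<delta>) * y + 3 * y ^ 3
          + 9 * (w * (\<delta> * \<delta>) + 3 * w * w * \<delta> + 3 * w ^ 3 - 2 * w * \<delta> * y - 3 * w * w * y)"
        unfolding x by (simp add: power2_eq_square power3_eq_cube algebra_simps)
      also have "\<dots> = \<delta> + 9 * (s + (w + 3 * w * w * \<delta> + 3 * w ^ 3 - 2 * w * \<delta> * y - 3 * w * w * y))"
        unfolding dd s by (simp add: algebra_simps)
      finally show ?thesis using that by blast
    qed
    obtain j2 where Y: "x\<^sup>2 * y - x * y\<^sup>2 = 3 * j2"
    proof -
      have "x\<^sup>2 * y - x * y\<^sup>2 = (\<delta> * \<delta>) * y + 2 * y ^ 3 + 3 * (2 * \<delta> * w * y + 3 * w * w * y - \<delta> * y * y - 3 * w * y * y)"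
        unfolding x by (simp add: power2_eq_square power3_eq_cube algebra_simps)
      also have "\<dots> = 3 * (y + 2 * s + (2 * \<delta> * w * y + 3 * w * w * y - \<delta> * y * y - 3 * w * y * y))"
        unfolding dd s by (simp add: algebra_simps)
      finally show ?thesis using that by blast
    qed
    have C: "C = (2 * a - b) * \<delta> + 9 * ((2 * a - b) * j1 - (a + b) * j2)"
      unfolding C_def X Y by (simp add: algebra_simps)
    define j3 where "j3 = l + 3 * (l * l * \<kappa>) + 3 * l ^ 3"
    have K: "k ^ 3 = \<kappa> + 9 * j3" unfolding j3_def by (rule cube9[OF \<kappa>(2,1)])
    obtain n' where n': "n = 1 + 3 * n'"
    proof -
      have "n = 1 + 3 * (n div 3)" using n(2) by presburger
      then show ?thesis using that by blast
    qed
    obtain N' where N': "N = 1 + 3 * N'"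
    proof -
      have "N = 1 + 3 * (N div 3)" using N1 by presburger
      then show ?thesis using that by blast
    qed
    obtain \<epsilon> j4 where nt: "\<epsilon> = 1 \<or> \<epsilon> = - 1" "n * (2 * a - b) = \<epsilon> + 9 * j4"
    proof -
      have bu: "b mod 3 = 1 \<or> b mod 3 = 2" using b by presburger
      have "3 dvd a \<or> 3 dvd b - a"
      proof (rule ccontr)
        assume "\<not> ?thesis"
        then have "3 dvd a + b" using bu by presburger
        then obtain g where "a + b = 3 * g" by (rule dvdE)
        then have ab: "a = 3 * g - b" by simp
        have "n = 3 * (3 * g * g - 3 * g * b + b * b)" unfolding n(1) ab by (simp add: algebra_simps)
        moreover have "u mod 3 \<noteq> 1" if "u = 3 * v" for u v :: int using that by presburger
        ultimately have "n mod 3 \<noteq> 1" by blast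
        with n(2) show False by contradiction
      qed
      then show ?thesis
      proof
        assume "3 dvd a"
        then obtain a1 where a1: "a = 3 * a1" by (rule dvdE)
        obtain \<epsilon> g where g: "\<epsilon> = 1 \<or> \<epsilon> = - 1" "b = \<epsilon> + 3 * g" using unit[OF bu] by blast
        have "n * (2 * a - b) = - (b ^ 3) + 9 * (6 * a1 ^ 3 - 3 * a1 * a1 * b + a1 * b * b)"
          unfolding n(1) a1 by (simp add: power3_eq_cube algebra_simps)
        also have "\<dots> = - \<epsilon> + 9 * (6 * a1 ^ 3 - 3 * a1 * a1 * b + a1 * b * b - (g + 3 * (g * g * \<epsilon>) + 3 * g ^ 3))"
          unfolding cube9[OF g(2,1)] by (simp add: algebra_simps)
        finally have "\<exists>j. n * (2 * a - b) = - \<epsilon> + 9 * j" by (rule exI)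
        then obtain j where j: "n * (2 * a - b) = - \<epsilon> + 9 * j" by (elim exE)
        have "- \<epsilon> = 1 \<or> - \<epsilon> = - 1" using g(1) by presburger
        from that[OF this j] show ?thesis .
      next
        assume "3 dvd b - a"
        then obtain w1 where "b - a = 3 * w1" by (rule dvdE)
        then have w1: "b = a + 3 * w1" by simp
        have "a mod 3 = 1 \<or> a mod 3 = 2" using bu w1 by presburger
        from unit[OF this] obtain \<epsilon> g where g: "\<epsilon> = 1 \<or> \<epsilon> = - 1" "a = \<epsilon> + 3 * g" by blast
        have "n * (2 * a - b) = a ^ 3 + 9 * (- 3 * w1 ^ 3)"
          unfolding n(1) w1 by (simp add: power3_eq_cube algebra_simps)
        also have "\<dots> = \<epsilon> + 9 * (g + 3 * (g * g * \<epsilon>) + 3 * g ^ 3 - 3 * w1 ^ 3)"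
          unfolding cube9[OF g(2,1)] by (simp add: algebra_simps)
        finally have "\<exists>j. n * (2 * a - b) = \<epsilon> + 9 * j" by (rule exI)
        then obtain j where j: "n * (2 * a - b) = \<epsilon> + 9 * j" by (elim exE)
        from that[OF g(1) j] show ?thesis .
      qed
    qed
    have nC: "n * C = (\<epsilon> + 9 * j4) * \<delta> + 9 * (n * ((2 * a - b) * j1 - (a + b) * j2))"
      unfolding C nt(2)[symmetric] by (simp add: algebra_simps)
    have "k ^ 3 - 3 * n * k * N + n * C = \<epsilon> * \<delta> - 2 * \<kappa> +
        9 * (j3 - (l + n' * k * N + k * N' - n' * 0) + j4 * \<delta> + n * ((2 * a - b) * j1 - (a + b) * j2))"
    proof -
      have "3 * n * k * N = 3 * k + 9 * (n' * k * N + k * N')" unfolding n' N' by (simp add: algebra_simps)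
      also have "3 * k = 3 * \<kappa> + 9 * l" unfolding \<kappa>(2) by simp
      finally have "3 * n * k * N = 3 * \<kappa> + 9 * l + 9 * (n' * k * N + k * N')" .
      then show ?thesis unfolding K nC by (simp add: algebra_simps)
    qed
    moreover have "9 dvd k ^ 3 - 3 * n * k * N + n * C"
    proof -
      have "9 dvd u" if "27 dvd u" for u :: int using that by presburger
      from this[OF 2[folded C_def N_def]] show ?thesis .
    qed
    moreover have "9 dvd u" if "e = u + 9 * w" "9 dvd e" for e u w :: int using that by presburger
    ultimately have "9 dvd \<epsilon> * \<delta> - 2 * \<kappa>" by blast
    moreover have "\<not> 9 dvd \<epsilon> * \<delta> - 2 * \<kappa>" using nt(1) \<delta>(1) \<kappa>(1) by (elim disjE; simp)
    ultimately show ?thesis by contradiction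
  qed
qed

section \<open>The ring of integers\<close>

text \<open>
  The properties of the Gauss sum generator from which the arithmetic of \<open>F\<close> is
  derived.
\<close>

locale cubic_datum = cyclic_cubic +
  fixes \<theta> :: complex and \<pi> :: eis and n :: int
  assumes \<theta>_norm: "\<theta> * cnj \<theta> = of_int n" and \<theta>_cube: "\<theta> ^ 3 = of_int n * eC \<pi>"
    and \<pi>_norm: "enorm \<pi> = n" and \<pi>_3: "\<not> 3 dvd wpart \<pi>"
    and \<alpha>_F: "\<theta> + cnj \<theta> \<in> F" and \<alpha>_1: "\<sigma> (\<theta> + cnj \<theta>) = \<omega>\<^sup>2 * \<theta> + cnj (\<omega>\<^sup>2 * \<theta>)"
    and \<alpha>_2: "\<sigma> (\<sigma> (\<theta> + cnj \<theta>)) = \<omega> * \<theta> + cnj (\<omega> * \<theta>)"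
    and n_pos: "n > 0" and n_3: "n mod 3 = 1"
    and n_primes: "Factorial_Ring.prime p \<Longrightarrow> p dvd n \<Longrightarrow> p mod 3 = 1 \<and> \<not> p * p dvd n"
begin

text \<open>
  Coordinates adapted to the decomposition of \<open>F\<close> into its rational part and the
  trace zero part.
\<close>

definition E :: "int \<Rightarrow> eis \<Rightarrow> complex" where "E k u = of_int k + eC u * \<theta> + cnj (eC u * \<theta>)"

lemma \<theta>_0: "\<theta> \<noteq> 0"
  using \<theta>_norm n_pos by auto

lemma \<theta>_square: "\<theta> * \<theta> = eC \<pi> * cnj \<theta>"
proof -
  have "\<theta> * (\<theta> * \<theta>) = \<theta> * (eC \<pi> * cnj \<theta>)"
    using \<theta>_cube unfolding \<theta>_norm[symmetric] power3_eq_cube by (simp only: mult_ac)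
  from mult_left_cancel[OF \<theta>_0, THEN iffD1, OF this] show ?thesis .
qed

lemma E_add: "E k u + E l v = E (k + l) (u + v)"
  by (simp add: E_def eC_hom algebra_simps)

lemma E_diff: "E k u - E l v = E (k - l) (u - v)"
  by (simp add: E_def eC_hom algebra_simps)

lemma E_of_int: "E k 0 = of_int k"
  by (simp add: E_def eC_hom)

lemma E_uminus: "- E k u = E (- k) (- u)"
  by (simp add: E_def eC_hom)

lemma E_mult: "E k u * E l v = E (k * l + n * etr (u * econj v)) (of_int k * v + of_int l * u + econj (\<pi> * u * v))"
proof -
  define A B C where "A = eC u" and "B = eC v" and "C = eC \<pi>"
  have t: "\<theta> * \<theta> = C * cnj \<theta>" "cnj \<theta> * cnj \<theta> = cnj C * \<theta>"
  proof -
    show "\<theta> * \<theta> = C * cnj \<theta>" unfolding C_def by (rule \<theta>_square)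
    from arg_cong[OF this, of cnj] show "cnj \<theta> * cnj \<theta> = cnj C * \<theta>"
      by (simp only: complex_cnj_mult complex_cnj_cnj)
  qed
  have tr: "of_int (etr (u * econj v)) = A * cnj B + cnj A * B"
    unfolding eC_etr[symmetric] eC_hom eC_econj A_def B_def by simp
  have "E k u * E l v = of_int k * of_int l + A * B * (\<theta> * \<theta>) + cnj A * cnj B * (cnj \<theta> * cnj \<theta>)
      + (A * cnj B + cnj A * B) * (\<theta> * cnj \<theta>)
      + (of_int k * B + of_int l * A) * \<theta> + (of_int k * cnj B + of_int l * cnj A) * cnj \<theta>"
    unfolding E_def A_def[symmetric] B_def[symmetric] by (simp add: algebra_simps)
  also have "\<dots> = of_int (k * l + n * etr (u * econj v)) + (of_int k * B + of_int l * A + cnj (C * A * B)) * \<theta>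
      + cnj ((of_int k * B + of_int l * A + cnj (C * A * B)) * \<theta>)"
    unfolding t \<theta>_norm of_int_add of_int_mult tr by (simp add: algebra_simps)
  also have "\<dots> = E (k * l + n * etr (u * econj v)) (of_int k * v + of_int l * u + econj (\<pi> * u * v))"
    unfolding E_def eC_hom eC_econj A_def B_def C_def by simp
  finally show ?thesis .
qed

lemma E_scale: "of_int l * E k u = E (l * k) (of_int l * u)"
  by (simp add: E_def eC_hom algebra_simps)

lemma E_basis: "E k u = of_int k + of_int (epart u) * (\<theta> + cnj \<theta>) + of_int (wpart u) * \<sigma> (\<sigma> (\<theta> + cnj \<theta>))"
  unfolding E_def eC_def \<alpha>_2 by (simp add: algebra_simps)

lemma E_F: "E k u \<in> F"
  unfolding E_basis by (intro F_add F_mult \<sigma>_closed \<alpha>_F Rats_F Rats_of_int)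

definition w2 :: eis where "w2 = Eis (- 1) (- 1)"

lemma w2: "eC w2 = \<omega>\<^sup>2" "w2 * w2 * w2 = 1" "eC (w2 * w2) = \<omega>" "enorm w2 = 1" "1 + w2 + w2 * w2 = 0"
proof -
  show 1: "eC w2 = \<omega>\<^sup>2" unfolding \<omega>_square by (simp add: w2_def eC_def)
  show "w2 * w2 * w2 = 1" "1 + w2 + w2 * w2 = 0" by (rule eis_eqI; simp add: w2_def)+
  have "w2 * w2 = Eis 0 1" by (rule eis_eqI) (simp_all add: w2_def)
  then show "eC (w2 * w2) = \<omega>" by (simp add: eC_def)
  show "enorm w2 = 1" by (simp add: enorm_def w2_def)
qed

lemma \<sigma>_E: "\<sigma> (E k u) = E k (w2 * u)"
proof -
  let ?\<alpha> = "\<theta> + cnj \<theta>"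
  have s: "\<sigma> (of_int x + of_int y * a + of_int z * b) = of_int x + of_int y * \<sigma> a + of_int z * \<sigma> b"
    if "a \<in> F" "b \<in> F" for a b x y z
    using that by (simp add: \<sigma>_add \<sigma>_mult \<sigma>_rat F_mult F_add Rats_F)
  have "\<sigma> (E k u) = of_int k + of_int (epart u) * \<sigma> ?\<alpha> + of_int (wpart u) * ?\<alpha>"
    unfolding E_basis using s[OF \<alpha>_F \<sigma>_closed[OF \<sigma>_closed[OF \<alpha>_F]]] unfolding \<sigma>_cube[OF \<alpha>_F] .
  also have "\<dots> = E k (w2 * u)"
    unfolding \<alpha>_1 E_def eC_hom w2 unfolding eC_def \<omega>_square by (simp add: cnj_\<omega> algebra_simps \<omega>_mult)
  finally show ?thesis .
qed

text \<open>
  Trace, second symmetric function and norm of an element in these coordinates.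
\<close>

lemma E_symmetric:
  "E k u + \<sigma> (E k u) + \<sigma> (\<sigma> (E k u)) = of_int (3 * k)"
  "E k u * \<sigma> (E k u) + \<sigma> (E k u) * \<sigma> (\<sigma> (E k u)) + \<sigma> (\<sigma> (E k u)) * E k u = of_int (3 * (k * k) - 3 * n * enorm u)"
  "E k u * \<sigma> (E k u) * \<sigma> (\<sigma> (E k u)) = of_int (k ^ 3 - 3 * n * k * enorm u + n * etr (u ^ 3 * \<pi>))"
proof -
  define S S' :: complex where "S = eC u * \<theta>" and "S' = cnj S"
  have SS: "S * S' = of_int (n * enorm u)"
  proof -
    have "S * S' = (eC u * cnj (eC u)) * (\<theta> * cnj \<theta>)" unfolding S_def S'_def by simp
    then show ?thesis unfolding eC_enorm \<theta>_norm by simp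
  qed
  have S3: "S ^ 3 + S' ^ 3 = of_int (n * etr (u ^ 3 * \<pi>))"
  proof -
    have "S ^ 3 = of_int n * eC (u ^ 3 * \<pi>)" unfolding S_def power_mult_distrib \<theta>_cube eC_hom eC_power by (simp only: mult_ac)
    moreover from arg_cong[OF this, of cnj] have "S' ^ 3 = of_int n * cnj (eC (u ^ 3 * \<pi>))"
      unfolding S'_def by (simp only: complex_cnj_power complex_cnj_mult complex_cnj_of_int)
    ultimately have "S ^ 3 + S' ^ 3 = of_int n * (eC (u ^ 3 * \<pi>) + cnj (eC (u ^ 3 * \<pi>)))" by (simp only: distrib_left)
    then show ?thesis unfolding eC_etr by simp
  qed
  have 0: "E k u = of_int k + S + S'" unfolding E_def S_def S'_def ..
  have 1: "\<sigma> (E k u) = of_int k + (- 1 - \<omega>) * S + \<omega> * S'"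
    unfolding \<sigma>_E unfolding E_def eC_hom w2 \<omega>_square S_def S'_def by (simp add: cnj_\<omega> algebra_simps)
  have 2: "\<sigma> (\<sigma> (E k u)) = of_int k + \<omega> * S + (- 1 - \<omega>) * S'"
  proof -
    have w: "w2 * (w2 * u) = (w2 * w2) * u" by (simp only: mult.assoc)
    show ?thesis unfolding \<sigma>_E unfolding w unfolding E_def eC_hom(3)[of "w2 * w2" u] w2(3) S_def S'_def by (simp add: cnj_\<omega> algebra_simps)
  qed
  show "E k u + \<sigma> (E k u) + \<sigma> (\<sigma> (E k u)) = of_int (3 * k)"
    unfolding 2 unfolding 1 unfolding 0 by (simp add: algebra_simps)
  have "E k u * \<sigma> (E k u) + \<sigma> (E k u) * \<sigma> (\<sigma> (E k u)) + \<sigma> (\<sigma> (E k u)) * E k u = 3 * (of_int k * of_int k) - 3 * (S * S')"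
    unfolding 2 unfolding 1 unfolding 0 by (simp add: algebra_simps \<omega>_mult)
  then show "E k u * \<sigma> (E k u) + \<sigma> (E k u) * \<sigma> (\<sigma> (E k u)) + \<sigma> (\<sigma> (E k u)) * E k u = of_int (3 * (k * k) - 3 * n * enorm u)"
    unfolding SS by simp
  have "E k u * \<sigma> (E k u) * \<sigma> (\<sigma> (E k u)) = of_int k ^ 3 - 3 * of_int k * (S * S') + (S ^ 3 + S' ^ 3)"
    unfolding 2 unfolding 1 unfolding 0 by (simp add: algebra_simps \<omega>_mult power3_eq_cube)
  then show "E k u * \<sigma> (E k u) * \<sigma> (\<sigma> (E k u)) = of_int (k ^ 3 - 3 * n * k * enorm u + n * etr (u ^ 3 * \<pi>))"
    unfolding SS S3 by simp
qed

lemma E_square_sum: "(E k u)\<^sup>2 + (\<sigma> (E k u))\<^sup>2 + (\<sigma> (\<sigma> (E k u)))\<^sup>2 = of_int (3 * (k * k) + 6 * n * enorm u)"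
proof -
  have e: "x\<^sup>2 + y\<^sup>2 + z\<^sup>2 = (x + y + z) * (x + y + z) - 2 * (x * y + y * z + z * x)" for x y z :: complex
    by (simp add: power2_eq_square algebra_simps)
  show ?thesis unfolding e E_symmetric by simp
qed

lemma E_eq_0: "E k u = 0 \<longleftrightarrow> k = 0 \<and> u = 0"
proof
  assume "E k u = 0"
  then have "of_int (3 * (k * k) + 6 * n * enorm u) = (0 :: complex)"
    using E_square_sum[of k u] by (simp add: \<sigma>_simps)
  then have e: "3 * (k * k) + 6 * n * enorm u = 0" unfolding of_int_eq_0_iff .
  moreover have "k * k \<ge> 0" "6 * n * enorm u \<ge> 0" using n_pos enorm_nonneg[of u] by simp_all
  ultimately have "k * k = 0" "6 * n * enorm u = 0" by linarith+
  then show "k = 0 \<and> u = 0" using n_pos enorm_zero[of u] by simp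
qed (simp add: E_of_int)

lemma E_inj: "E k u = E l v \<longleftrightarrow> k = l \<and> u = v"
proof -
  have "E k u = E l v \<longleftrightarrow> E (k - l) (u - v) = 0" unfolding E_diff[symmetric] by simp
  then show ?thesis unfolding E_eq_0 by simp
qed

lemma algebraic_int_\<sigma>:
  assumes "x \<in> F" "algebraic_int x" shows "algebraic_int (\<sigma> x)"
  using assms(2)
proof cases
  case (1 p)
  have "Polynomial.coeff p i \<in> \<rat>" for i using 1(2) Ints_subset_Rats by blast
  from \<sigma>_poly(2)[OF this assms(1)] have "poly p (\<sigma> x) = 0" using 1(3) by (simp add: \<sigma>_simps)
  with 1 show ?thesis by (intro algebraic_int.intros) auto
qed

lemma algebraic_int_E: "algebraic_int (E k u)"
proof -
  let ?\<alpha> = "E 0 1"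
  have \<alpha>: "?\<alpha> = \<theta> + cnj \<theta>" by (simp add: E_def eC_hom)
  have e: "?\<alpha> * ?\<alpha> * ?\<alpha> = of_int (3 * n) * ?\<alpha> + of_int (n * etr \<pi>)"
  proof -
    have "?\<alpha> * ?\<alpha> * ?\<alpha> = \<theta> ^ 3 + cnj (\<theta> ^ 3) + 3 * (\<theta> * cnj \<theta>) * ?\<alpha>"
      unfolding \<alpha> by (simp add: power3_eq_cube algebra_simps)
    also have "\<theta> ^ 3 + cnj (\<theta> ^ 3) = of_int n * (eC \<pi> + cnj (eC \<pi>))" unfolding \<theta>_cube by (simp add: distrib_left)
    finally show ?thesis unfolding eC_etr \<theta>_norm by simp
  qed
  have "algebraic_int ?\<alpha>"
  proof (rule algebraic_int.intros)
    let ?p = "[:- of_int (n * etr \<pi>), - of_int (3 * n), 0, 1:] :: complex poly"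
    show "Polynomial.lead_coeff ?p = 1" by simp
    show "\<forall>i. Polynomial.coeff ?p i \<in> \<int>" by (auto simp: coeff_pCons split: nat.splits)
    have "poly ?p ?\<alpha> = ?\<alpha> * ?\<alpha> * ?\<alpha> - (of_int (3 * n) * ?\<alpha> + of_int (n * etr \<pi>))" by (simp add: algebra_simps)
    then show "poly ?p ?\<alpha> = 0" unfolding e by simp
  qed
  then have a: "algebraic_int (\<theta> + cnj \<theta>)" unfolding \<alpha> .
  show ?thesis unfolding E_basis
    by (intro algebraic_int_add algebraic_int_mult algebraic_int_\<sigma> \<sigma>_closed \<alpha>_F a algebraic_int_of_int)
qed

lemma rational_integer:
  assumes "algebraic_int x" "x \<in> \<rat>" shows "\<exists>k. x = of_int k"
  using rational_algebraic_int_is_int[OF assms] by (auto simp: Ints_def)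

text \<open>
  The elementary symmetric functions of the conjugates of an integral element are integers.
\<close>

lemma integral_multiple:
  assumes x: "x \<in> F" "algebraic_int x" and D: "of_int D * x = E k u" "D \<noteq> 0"
  shows "D dvd 3 * k" "D * D dvd 3 * (k * k) - 3 * n * enorm u" "D * D * D dvd k ^ 3 - 3 * n * k * enorm u + n * etr (u ^ 3 * \<pi>)"
proof -
  let ?y = "\<sigma> x" and ?z = "\<sigma> (\<sigma> x)"
  have yz: "?y \<in> F" "?z \<in> F" "algebraic_int ?y" "algebraic_int ?z"
    using x by (simp_all add: \<sigma>_closed algebraic_int_\<sigma>)
  have s: "\<sigma> (of_int D * w) = of_int D * \<sigma> w" if "w \<in> F" for w
    using that by (simp add: \<sigma>_mult \<sigma>_rat Rats_F)
  have E: "E k u = of_int D * x" "\<sigma> (E k u) = of_int D * ?y" "\<sigma> (\<sigma> (E k u)) = of_int D * ?z"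
    unfolding D(1)[symmetric] using s x yz by simp_all
  obtain e1 where e1: "x + ?y + ?z = of_int e1"
    using rational_integer[OF _ symmetric_rational(1)[OF x(1)]] x yz by (auto intro: algebraic_int_add)
  obtain e2 where e2: "x * ?y + ?y * ?z + ?z * x = of_int e2"
    using rational_integer[OF _ symmetric_rational(2)[OF x(1)]] x yz by (auto intro: algebraic_int_add algebraic_int_mult)
  obtain e3 where e3: "x * ?y * ?z = of_int e3"
    using rational_integer[OF _ symmetric_rational(3)[OF x(1)]] x yz by (auto intro: algebraic_int_mult)
  have "of_int (3 * k) = of_int D * (x + ?y + ?z)"
    unfolding E_symmetric(1)[of k u, symmetric] unfolding E(3) unfolding E(2) unfolding E(1) by (simp only: distrib_left)
  then have "(of_int (3 * k) :: complex) = of_int (D * e1)" unfolding e1 by simp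
  then show "D dvd 3 * k" unfolding of_int_eq_iff by simp
  have "of_int (3 * (k * k) - 3 * n * enorm u) = of_int D * of_int D * (x * ?y + ?y * ?z + ?z * x)"
    unfolding E_symmetric(2)[of k u, symmetric] unfolding E(3) unfolding E(2) unfolding E(1) by (simp only: distrib_left mult_ac)
  then have "(of_int (3 * (k * k) - 3 * n * enorm u) :: complex) = of_int (D * D * e2)" unfolding e2 by simp
  then show "D * D dvd 3 * (k * k) - 3 * n * enorm u" unfolding of_int_eq_iff by simp
  have "of_int (k ^ 3 - 3 * n * k * enorm u + n * etr (u ^ 3 * \<pi>)) = of_int D * of_int D * of_int D * (x * ?y * ?z)"
    unfolding E_symmetric(3)[of k u, symmetric] unfolding E(3) unfolding E(2) unfolding E(1) by (simp only: mult_ac)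
  then have "(of_int (k ^ 3 - 3 * n * k * enorm u + n * etr (u ^ 3 * \<pi>)) :: complex) = of_int (D * D * D * e3)" unfolding e3 by simp
  then show "D * D * D dvd k ^ 3 - 3 * n * k * enorm u + n * etr (u ^ 3 * \<pi>)" unfolding of_int_eq_iff by simp
qed

lemma eis_prime_n: "Factorial_Ring.prime p \<Longrightarrow> p dvd n \<Longrightarrow> eis_prime p n \<pi>"
proof unfold_locales
  assume p: "Factorial_Ring.prime p" "p dvd n"
  show "Factorial_Ring.prime p" "p dvd n" "enorm \<pi> = n" by (fact p \<pi>_norm)+
  show "\<not> p * p dvd n" "p \<noteq> 3" "p \<noteq> 2" using n_primes[OF p] by auto
qed

lemma n_dvd_if_primes:
  assumes "\<And>p. Factorial_Ring.prime p \<Longrightarrow> p dvd n \<Longrightarrow> p dvd x" shows "n dvd x"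
proof -
  define g where "g = gcd n x"
  obtain h where h: "n = g * h" using gcd_dvd1[of n x] unfolding g_def by (rule dvdE)
  have "is_unit h"
  proof (rule ccontr)
    assume "\<not> is_unit h"
    moreover have "h \<noteq> 0" using h n_pos by auto
    ultimately obtain p where p: "p dvd h" "Factorial_Ring.prime p" using prime_divisor_exists by blast
    have pn: "p dvd n" unfolding h using p(1) by (rule dvd_mult)
    have "p dvd g" unfolding g_def using pn assms[OF p(2) pn] by (rule gcd_greatest)
    then have "p * p dvd n" unfolding h using p(1) by (rule mult_dvd_mono)
    with n_primes[OF p(2) pn] show False by blast
  qed
  then have "n dvd g" unfolding h by (simp add: mult_unit_dvd_iff)
  then show ?thesis unfolding g_def by simp
qed

lemma etr_cube_pi:
  "etr (u ^ 3 * \<pi>) = (2 * epart \<pi> - wpart \<pi>) * (epart u ^ 3 + wpart u ^ 3 - 3 * epart u * (wpart u)\<^sup>2)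
     - 3 * (epart \<pi> + wpart \<pi>) * ((epart u)\<^sup>2 * wpart u - epart u * (wpart u)\<^sup>2)"
  by (simp add: etr_def power3_eq_cube power2_eq_square algebra_simps)

lemma rational_common_denominator:
  fixes r s t :: complex
  assumes "r \<in> \<rat>" "s \<in> \<rat>" "t \<in> (\<rat> :: complex set)"
  obtains D a b c :: int where "D > 0" "of_int D * r = of_int a" "of_int D * s = of_int b" "of_int D * t = of_int c"
proof -
  have 1: "\<exists>d e :: int. d > 0 \<and> of_int d * q = of_int e" if q: "q \<in> \<rat>" for q :: complex
  proof -
    obtain i j :: int where ij: "j > 0" "q = of_int i / of_int j" using q by (rule Rats_cases')
    then have "of_int j * q = of_int i" by simp
    with ij(1) show ?thesis by blast
  qed
  obtain d1 e1 :: int where 2: "d1 > 0" "of_int d1 * r = of_int e1" using 1[OF assms(1)] by blast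
  obtain d2 e2 :: int where 3: "d2 > 0" "of_int d2 * s = of_int e2" using 1[OF assms(2)] by blast
  obtain d3 e3 :: int where 4: "d3 > 0" "of_int d3 * t = of_int e3" using 1[OF assms(3)] by blast
  show ?thesis
  proof (rule that[of "d1 * d2 * d3" "d2 * d3 * e1" "d1 * d3 * e2" "d1 * d2 * e3"])
    show "d1 * d2 * d3 > 0" using 2 3 4 by simp
    have "of_int (d1 * d2 * d3) * r = of_int (d2 * d3) * (of_int d1 * r)" by (simp only: of_int_mult mult_ac)
    then show "of_int (d1 * d2 * d3) * r = of_int (d2 * d3 * e1)" unfolding 2(2) by simp
    have "of_int (d1 * d2 * d3) * s = of_int (d1 * d3) * (of_int d2 * s)" by (simp only: of_int_mult mult_ac)
    then show "of_int (d1 * d2 * d3) * s = of_int (d1 * d3 * e2)" unfolding 3(2) by simp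
    have "of_int (d1 * d2 * d3) * t = of_int (d1 * d2) * (of_int d3 * t)" by (simp only: of_int_mult mult_ac)
    then show "of_int (d1 * d2 * d3) * t = of_int (d1 * d2 * e3)" unfolding 4(2) by simp
  qed
qed

text \<open>
  A denominator is bounded by pairing with known integers under the trace form. The primes
  dividing \<open>n\<close> are then removed with the norm, and the prime \<open>3\<close> with
  the second symmetric function and the norm.
\<close>

theorem integers_E:
  assumes x: "x \<in> F" "algebraic_int x"
  obtains k u where "x = E k u"
proof -
  let ?\<alpha> = "\<theta> + cnj \<theta>"
  have \<alpha>0: "?\<alpha> \<noteq> 0"
  proof
    assume "?\<alpha> = 0"
    then have "E 0 1 = 0" by (simp add: E_def eC_hom)
    then show False unfolding E_eq_0 by simp
  qed
  have tr: "?\<alpha> + \<sigma> ?\<alpha> + \<sigma> (\<sigma> ?\<alpha>) = 0"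
  proof -
    have "?\<alpha> = E 0 1" by (simp add: E_def eC_hom)
    then show ?thesis using E_symmetric(1)[of 0 1] by simp
  qed
  obtain r s t where rst: "r \<in> \<rat>" "s \<in> \<rat>" "t \<in> \<rat>" "x = r + s * ?\<alpha> + t * \<sigma> ?\<alpha>"
    by (rule trace_zero_basis[OF \<alpha>_F \<alpha>0 tr x(1)])
  obtain D a b c :: int where D: "D > 0" "of_int D * r = of_int a" "of_int D * s = of_int b" "of_int D * t = of_int c"
    by (rule rational_common_denominator[OF rst(1-3)])
  define u where "u = of_int b + of_int c * w2"
  have "of_int D * x = of_int D * r + (of_int D * s) * ?\<alpha> + (of_int D * t) * \<sigma> ?\<alpha>"
    unfolding rst(4) by (simp only: distrib_left mult.assoc)
  also have "\<dots> = E a u"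
    unfolding D \<alpha>_1 E_def u_def eC_hom w2 by (simp add: algebra_simps)
  finally have Dx: "of_int D * x = E a u" .
  have D0: "D \<noteq> 0" using D(1) by simp
  \<comment> \<open>The trace pairing with the integers alpha and omega alpha bounds the denominator.\<close>
  have pair: "D dvd 3 * (n * etr (u * econj v))" for v
  proof (rule integral_multiple(1)[OF _ _ _ D0])
    show "x * E 0 v \<in> F" by (intro F_mult x E_F)
    show "algebraic_int (x * E 0 v)" by (intro algebraic_int_mult x algebraic_int_E)
    have "of_int D * (x * E 0 v) = E a u * E 0 v" unfolding Dx[symmetric] by (simp only: mult.assoc)
    then show "of_int D * (x * E 0 v) = E (n * etr (u * econj v)) (of_int a * v + econj (\<pi> * u * v))"
      unfolding E_mult by simp
  qed
  have "D dvd 3 * (n * (2 * epart u - wpart u))" using pair[of 1] by (simp add: econj_hom etr_def)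
  moreover have "D dvd 3 * (n * (2 * wpart u - epart u))" using pair[of "Eis 0 1"] by (simp add: econj_def etr_def algebra_simps)
  ultimately have "D dvd 2 * (3 * (n * (2 * epart u - wpart u))) + 3 * (n * (2 * wpart u - epart u))"
      "D dvd 3 * (n * (2 * epart u - wpart u)) + 2 * (3 * (n * (2 * wpart u - epart u)))"
    by (simp_all only: dvd_add dvd_mult)
  moreover have "2 * (3 * (n * (2 * epart u - wpart u))) + 3 * (n * (2 * wpart u - epart u)) = 9 * n * epart u"
      "3 * (n * (2 * epart u - wpart u)) + 2 * (3 * (n * (2 * wpart u - epart u))) = 9 * n * wpart u" by (simp_all add: algebra_simps)
  ultimately have d9: "D dvd 9 * n * epart u" "D dvd 9 * n * wpart u" by (simp_all only:)
  obtain y1 where y1: "9 * n * epart u = D * y1" using d9(1) by (rule dvdE)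
  obtain y2 where y2: "9 * n * wpart u = D * y2" using d9(2) by (rule dvdE)
  obtain k1 where k1: "3 * a = D * k1" using integral_multiple(1)[OF x Dx D0] by (rule dvdE)
  define u1 where "u1 = Eis y1 y2"
  have u1: "of_int (9 * n) * u = of_int D * u1" by (rule eis_eqI) (simp_all add: y1 y2 u1_def)
  have x1: "of_int (9 * n) * x = E (3 * n * k1) u1"
  proof -
    have "of_int D * (of_int (9 * n) * x) = of_int (9 * n) * (of_int D * x)" by (simp only: mult_ac)
    also have "\<dots> = E (9 * n * a) (of_int D * u1)" unfolding Dx E_scale u1 ..
    also have "9 * n * a = D * (3 * n * k1)" using k1 by (simp add: algebra_simps)
    finally have e: "of_int D * (of_int (9 * n) * x) = of_int D * E (3 * n * k1) u1" unfolding E_scale .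
    have "(of_int D :: complex) \<noteq> 0" using D0 by simp
    from mult_left_cancel[OF this, THEN iffD1, OF e] show ?thesis .
  qed
  have n0: "n \<noteq> 0" using n_pos by simp
  \<comment> \<open>Removing the tamely ramified primes from the denominator.\<close>
  have "of_int n dvd u1"
  proof -
    have pu: "of_int p dvd u1" if pp: "Factorial_Ring.prime p" "p dvd n" for p
    proof -
      interpret eis_prime p n \<pi> by (rule eis_prime_n[OF pp])
      obtain c where c: "n = p * c" using pp(2) by (rule dvdE)
      have pc: "\<not> p dvd c" using n_primes[OF pp] unfolding c by auto
      have p0: "p \<noteq> 0" using pp(1) by auto
      define y where "y = of_int (3 * c) * (of_int 3 * x - of_int k1)"
      have iF: "of_int j \<in> F" for j by (rule Rats_F[OF Rats_of_int])
      have yF: "y \<in> F" "algebraic_int y" unfolding y_def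
        by (rule F_mult[OF iF F_diff[OF F_mult[OF iF x(1)] iF]],
            rule algebraic_int_mult[OF algebraic_int_of_int algebraic_int_diff[OF algebraic_int_mult[OF algebraic_int_of_int x(2)] algebraic_int_of_int]])
      have "of_int p * y = of_int (9 * n) * x - of_int (3 * n * k1)" unfolding y_def c by (simp add: algebra_simps)
      also have "\<dots> = E (3 * n * k1) u1 - E (3 * n * k1) 0" unfolding x1 E_of_int ..
      also have "\<dots> = E 0 u1" unfolding E_diff by simp
      finally have py: "of_int p * y = E 0 u1" .
      have "p * p * p dvd n * etr (u1 ^ 3 * \<pi>)" using integral_multiple(3)[OF yF py p0] by simp
      then have "p * p dvd c * etr (u1 ^ 3 * \<pi>)" unfolding c using p0 by (simp add: mult.assoc)
      note d = this
      have "coprime (p * p) c" using prime_imp_coprime[OF pp(1) pc] by simp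
      from d[unfolded coprime_dvd_mult_right_iff[OF this]] have "p * p dvd etr (u1 ^ 3 * \<pi>)" .
      then show ?thesis by (rule dvd_if_square_dvd_cube_trace)
    qed
    show ?thesis unfolding of_int_dvd_eis
      by (intro conjI n_dvd_if_primes) (use pu in \<open>simp_all add: of_int_dvd_eis\<close>)
  qed
  then obtain u2 where u2: "u1 = of_int n * u2" by (rule dvdE)
  have x2: "of_int 9 * x = E (3 * k1) u2"
  proof -
    have e: "of_int n * (of_int 9 * x) = of_int n * E (3 * k1) u2"
      using x1 unfolding u2 E_scale by (simp add: mult_ac)
    have "(of_int n :: complex) \<noteq> 0" using n0 by simp
    from mult_left_cancel[OF this, THEN iffD1, OF e] show ?thesis .
  qed
  have p3: "Factorial_Ring.prime (3 :: int)" by simp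
  have cop3: "coprime 3 n"
  proof (rule prime_imp_coprime[OF p3])
    show "\<not> 3 dvd n" using n_3 by presburger
  qed
  have "of_int 3 dvd u2"
  proof -
    have "9 * 9 dvd 3 * (3 * k1 * (3 * k1)) - 3 * n * enorm u2" by (rule integral_multiple(2)[OF x x2]) simp
    then obtain j where "3 * (3 * k1 * (3 * k1)) - 3 * n * enorm u2 = 9 * 9 * j" by (rule dvdE)
    then have "n * enorm u2 = 9 * (k1 * k1 - 3 * j)" by (simp add: algebra_simps)
    then have "9 dvd n * enorm u2" by (simp only: dvd_triv_left)
    moreover have "coprime 9 n"
    proof -
      have "coprime (3 * 3) n" unfolding coprime_mult_left_iff using cop3 by blast
      then show ?thesis by simp
    qed
    ultimately have N9: "9 dvd enorm u2" by (simp add: coprime_dvd_mult_right_iff)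
    have sq3: "3 dvd w" if "3 dvd w\<^sup>2" for w :: int using that by (rule prime_dvd_power[OF p3])
    have "9 dvd (2 * epart u2 - wpart u2)\<^sup>2 + 3 * (wpart u2)\<^sup>2" unfolding four_enorm[symmetric] using N9 by (rule dvd_mult)
    then obtain i where i: "(2 * epart u2 - wpart u2)\<^sup>2 + 3 * (wpart u2)\<^sup>2 = 9 * i" by (rule dvdE)
    have "(2 * epart u2 - wpart u2)\<^sup>2 = 3 * (3 * i - (wpart u2)\<^sup>2)" using i by simp
    then have "3 dvd (2 * epart u2 - wpart u2)\<^sup>2" by (simp only: dvd_triv_left)
    then have a3: "3 dvd 2 * epart u2 - wpart u2" by (rule sq3)
    then obtain l where l: "2 * epart u2 - wpart u2 = 3 * l" by (rule dvdE)
    have "(wpart u2)\<^sup>2 = 3 * (i - l\<^sup>2)" using i unfolding l by (simp add: power2_eq_square)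
    then have "3 dvd (wpart u2)\<^sup>2" by (simp only: dvd_triv_left)
    then have b3: "3 dvd wpart u2" by (rule sq3)
    with a3 have "3 dvd epart u2" by presburger
    with b3 show ?thesis by (simp only: of_int_dvd_eis simp_thms)
  qed
  then obtain v where v: "u2 = of_int 3 * v" by (rule dvdE)
  have x3: "of_int 3 * x = E k1 v"
  proof -
    have e: "of_int 3 * (of_int 3 * x) = of_int 3 * E k1 v"
      using x2 unfolding v E_scale by simp
    have "(of_int 3 :: complex) \<noteq> 0" by simp
    from mult_left_cancel[OF this, THEN iffD1, OF e] show ?thesis .
  qed
  have "3 * 3 dvd 3 * (k1 * k1) - 3 * n * enorm v" by (rule integral_multiple(2)[OF x x3]) simp
  also have "3 * (k1 * k1) - 3 * n * enorm v = 3 * (k1 * k1 - n * enorm v)" by (simp only: right_diff_distrib mult.assoc)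
  finally have "(3 :: int) = 0 \<or> 3 dvd k1 * k1 - n * enorm v" by (simp only: dvd_mult_cancel_left)
  then have 1: "3 dvd k1 * k1 - n * enorm v" by (simp only: zero_neq_numeral[symmetric] simp_thms)
  obtain n' where n': "n = 1 + 3 * n'"
  proof -
    have "n = 1 + 3 * (n div 3)" using n_3 by presburger
    then show ?thesis by (rule that)
  qed
  have "k1 * k1 - enorm v = (k1 * k1 - n * enorm v) + 3 * (n' * enorm v)" unfolding n' by (simp add: algebra_simps)
  then have c1: "3 dvd k1 * k1 - enorm v" using dvd_add[OF 1 dvd_triv_left] by (simp only:)
  have c2: "27 dvd k1 ^ 3 - 3 * n * k1 * enorm v + n * etr (v ^ 3 * \<pi>)"
    using integral_multiple(3)[OF x x3] by simp
  have "3 dvd k1 \<and> 3 dvd epart v \<and> 3 dvd wpart v"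
  proof (rule wild_condition[OF _ n_3 \<pi>_3])
    show "n = epart \<pi> * epart \<pi> - epart \<pi> * wpart \<pi> + wpart \<pi> * wpart \<pi>" using \<pi>_norm by (simp add: enorm_def)
  qed (use c1 c2 in \<open>simp_all only: enorm_def etr_cube_pi\<close>)
  then have "3 dvd k1" "of_int 3 dvd v" by (simp_all only: of_int_dvd_eis simp_thms)
  note d = this
  obtain k3 where k3: "k1 = 3 * k3" using d(1) by (rule dvdE)
  obtain v3 where v3: "v = of_int 3 * v3" using d(2) by (rule dvdE)
  note kv = k3 v3
  have e: "of_int 3 * x = of_int 3 * E k3 v3" unfolding x3 kv E_scale by simp
  have "(of_int 3 :: complex) \<noteq> 0" by simp
  from mult_left_cancel[OF this, THEN iffD1, OF e] show ?thesis by (rule that)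
qed

lemma integers_eq: "{x \<in> F. algebraic_int x} = {E k u | k u. True}"
  using integers_E E_F algebraic_int_E by blast

end

section \<open>Ideals and their norms\<close>

context cubic_datum
begin

abbreviation "R \<equiv> ring_of_integers F"

definition Ok where "Ok = {E k u | k u. True}"

lemma R_simps [simp]: "carrier R = Ok" "x \<otimes>\<^bsub>R\<^esub> y = x * y" "x \<oplus>\<^bsub>R\<^esub> y = x + y" "\<one>\<^bsub>R\<^esub> = 1" "\<zero>\<^bsub>R\<^esub> = 0"
  by (simp_all add: ring_of_integers_def integers_eq Ok_def)

lemma E_O [simp]: "E k u \<in> Ok" unfolding Ok_def by blast

lemma O_cases: assumes "x \<in> Ok" obtains k u where "x = E k u" using assms unfolding Ok_def by blast

lemma O_closed: "x \<in> Ok \<Longrightarrow> y \<in> Ok \<Longrightarrow> x + y \<in> Ok" "x \<in> Ok \<Longrightarrow> y \<in> Ok \<Longrightarrow> x * y \<in> Ok" "x \<in> Ok \<Longrightarrow> - x \<in> Ok" "of_int k \<in> Ok"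
proof -
  show "of_int k \<in> Ok" unfolding E_of_int[symmetric] by simp
  show "- x \<in> Ok" if "x \<in> Ok" using that by (elim O_cases) (simp add: E_uminus)
  show "x + y \<in> Ok" "x * y \<in> Ok" if "x \<in> Ok" "y \<in> Ok" using that by (elim O_cases; simp add: E_add E_mult)+
qed

lemma R_ring: "ring R"
proof -
  have "subring Ok CC"
    using O_closed(4)[of 1] by (intro C.subringI) (auto intro: O_closed)
  then have "ring (CC\<lparr>carrier := Ok\<rparr>)" by (rule C.subring_is_ring)
  then show ?thesis by (simp add: ring_of_integers_def integers_eq Ok_def)
qed

lemma R_minus: "x \<in> Ok \<Longrightarrow> \<ominus>\<^bsub>R\<^esub> x = - x"
proof -
  interpret R: ring R by (rule R_ring)
  show "x \<in> Ok \<Longrightarrow> \<ominus>\<^bsub>R\<^esub> x = - x" by (rule R.minus_equality) (simp_all add: O_closed)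
qed

lemma ideal_iff: "ideal I R \<longleftrightarrow> I \<subseteq> Ok \<and> 0 \<in> I \<and> (\<forall>x\<in>I. \<forall>y\<in>I. x + y \<in> I) \<and> (\<forall>x\<in>I. \<forall>y\<in>Ok. y * x \<in> I)"
proof
  assume "ideal I R"
  then interpret ideal I R .
  have "I \<subseteq> Ok" "0 \<in> I" using a_subset additive_subgroup.zero_closed[OF is_additive_subgroup] by simp_all
  moreover have "x + y \<in> I" if "x \<in> I" "y \<in> I" for x y using additive_subgroup.a_closed[OF is_additive_subgroup that] by simp
  moreover have "y * x \<in> I" if "x \<in> I" "y \<in> Ok" for x y using I_l_closed[of x y] that by simp
  ultimately show "I \<subseteq> Ok \<and> 0 \<in> I \<and> (\<forall>x\<in>I. \<forall>y\<in>I. x + y \<in> I) \<and> (\<forall>x\<in>I. \<forall>y\<in>Ok. y * x \<in> I)"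
    by (intro conjI ballI)
next
  assume I: "I \<subseteq> Ok \<and> 0 \<in> I \<and> (\<forall>x\<in>I. \<forall>y\<in>I. x + y \<in> I) \<and> (\<forall>x\<in>I. \<forall>y\<in>Ok. y * x \<in> I)"
  interpret R: ring R by (rule R_ring)
  show "ideal I R"
  proof (rule idealI[OF R_ring])
    show "subgroup I (add_monoid R)"
    proof (rule R.add.subgroupI)
      show "I \<subseteq> carrier R" "I \<noteq> {}" using I by auto
      show "x \<oplus>\<^bsub>R\<^esub> y \<in> I" if "x \<in> I" "y \<in> I" for x y using I that by simp
      show "\<ominus>\<^bsub>R\<^esub> x \<in> I" if x: "x \<in> I" for x
      proof -
        have "of_int (- 1) * x \<in> I" using I x O_closed(4)[of "- 1"] by blast
        then show ?thesis using R_minus[of x] I x by auto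
      qed
    qed
    show "x \<otimes>\<^bsub>R\<^esub> a \<in> I" "a \<otimes>\<^bsub>R\<^esub> x \<in> I" if "a \<in> I" "x \<in> carrier R" for a x
      using I that by (simp_all add: mult.commute[of a x])
  qed
qed

definition coset :: "complex set \<Rightarrow> complex \<Rightarrow> complex set" where "coset I a = (\<lambda>h. h + a) ` I"

lemma Quot_carrier: "carrier (R Quot I) = coset I ` Ok"
  unfolding FactRing_def A_RCOSETS_def RCOSETS_def r_coset_def coset_def by auto

lemma ideal_norm_card: "ideal_norm F I = card (coset I ` Ok)"
  unfolding ideal_norm_def Coset.order_def Quot_carrier ..

context
  fixes I assumes I: "ideal I R"
begin

lemma I_closed: "I \<subseteq> Ok" "0 \<in> I" "x \<in> I \<Longrightarrow> y \<in> I \<Longrightarrow> x + y \<in> I" "x \<in> I \<Longrightarrow> y \<in> Ok \<Longrightarrow> y * x \<in> I"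
  using I unfolding ideal_iff by blast+

lemma I_int_mult: "x \<in> I \<Longrightarrow> of_int k * x \<in> I"
  using I_closed(4) O_closed(4) by blast

lemma I_diff: "x \<in> I \<Longrightarrow> y \<in> I \<Longrightarrow> x - y \<in> I"
  using I_closed(3)[of x "of_int (- 1) * y"] I_int_mult[of y "- 1"] by simp

lemma coset_eq: "coset I a = coset I b \<longleftrightarrow> a - b \<in> I"
proof
  assume "coset I a = coset I b"
  moreover have "0 + a \<in> coset I a" unfolding coset_def by (rule rev_image_eqI[OF I_closed(2) refl])
  ultimately have "a \<in> coset I b" by simp
  then obtain h where "h \<in> I" "a = h + b" unfolding coset_def by blast
  then show "a - b \<in> I" by simp
next
  have sub: "coset I a \<subseteq> coset I b" if "a - b \<in> I" for a b
  proof
    fix x assume "x \<in> coset I a"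
    then obtain h where h: "h \<in> I" "x = h + a" unfolding coset_def by blast
    have "h + (a - b) \<in> I" "x = (h + (a - b)) + b" using I_closed(3)[OF h(1) that] h(2) by simp_all
    then show "x \<in> coset I b" unfolding coset_def by (rule rev_image_eqI)
  qed
  assume ab: "a - b \<in> I"
  have "b - a \<in> I" using I_diff[OF I_closed(2) ab] by simp
  with ab show "coset I a = coset I b" using sub by blast
qed

text \<open>
  A Sylow subgroup of the additive quotient, pulled back to representatives.
\<close>

lemma power_coset_group:
  assumes N: "card (coset I ` Ok) = N" "N > 0" and p: "Factorial_Ring.prime p" "p ^ a dvd N"
  obtains T where "T \<subseteq> Ok" "card (coset I ` T) = p ^ a" "\<forall>x\<in>T. \<forall>y\<in>T. of_nat (p ^ a) * (x - y) \<in> I"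
proof -
  interpret R: ring R by (rule R_ring)
  interpret I: ideal I R by (rule I)
  define G where "G = add_monoid R Mod I"
  have carr: "carrier G = coset I ` Ok"
    unfolding G_def FactGroup_def RCOSETS_def r_coset_def coset_def by auto
  interpret G: group G unfolding G_def by (rule normal.factorgroup_is_group[OF I.a_normal])
  have co: "r_coset (add_monoid R) I x = coset I x" for x unfolding r_coset_def coset_def by auto
  have mlt: "coset I x \<otimes>\<^bsub>G\<^esub> coset I y = coset I (x + y)" if "x \<in> Ok" "y \<in> Ok" for x y
    using hom_mult[OF normal.r_coset_hom_Mod[OF I.a_normal], of x y] that unfolding G_def[symmetric] co by simp
  have one: "\<one>\<^bsub>G\<^esub> = coset I 0" unfolding G_def FactGroup_def coset_def by simp
  have pw: "coset I x [^]\<^bsub>G\<^esub> k = coset I (of_nat k * x)" if x: "x \<in> Ok" for x and k :: nat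
  proof (induction k)
    case 0
    show ?case by (simp add: one)
  next
    case (Suc k)
    have "of_nat k * x \<in> Ok" using O_closed(2)[OF O_closed(4)[of "int k"] x] by simp
    then show ?case using Suc x by (simp add: mlt algebra_simps)
  qed
  obtain q where q: "N = p ^ a * q" using p(2) by (rule dvdE)
  have "finite (carrier G)" unfolding carr using N by (simp add: card_ge_0_finite)
  moreover have "Coset.order G = p ^ a * q" unfolding Coset.order_def carr N(1) q ..
  ultimately obtain H where H: "subgroup H G" "card H = p ^ a" using sylow_thm[OF p(1) G.group_axioms] by blast
  define T where "T = {x \<in> Ok. coset I x \<in> H}"
  have HT: "coset I ` T = H"
    using subgroup.subset[OF H(1)] unfolding carr T_def by auto
  interpret H: group "G\<lparr>carrier := H\<rparr>" by (rule subgroup.subgroup_is_group[OF H(1) G.group_axioms])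
  have zero: "of_nat (p ^ a) * x \<in> I" if x: "x \<in> T" for x
  proof -
    have xO: "x \<in> Ok" "coset I x \<in> H" using x unfolding T_def by simp_all
    have "coset I x [^]\<^bsub>G\<lparr>carrier := H\<rparr>\<^esub> Coset.order (G\<lparr>carrier := H\<rparr>) = \<one>\<^bsub>G\<lparr>carrier := H\<rparr>\<^esub>"
      by (rule H.pow_order_eq_1) (simp add: xO)
    moreover have "Coset.order (G\<lparr>carrier := H\<rparr>) = p ^ a" unfolding Coset.order_def using H(2) by simp
    ultimately have "coset I x [^]\<^bsub>G\<^esub> (p ^ a) = coset I 0" using G.nat_pow_consistent[of "coset I x" "p ^ a" H] one by simp
    then have "coset I (of_nat (p ^ a) * x) = coset I 0" unfolding pw[OF xO(1)] .
    then show ?thesis unfolding coset_eq by simp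
  qed
  show ?thesis
  proof (rule that[of T])
    show "T \<subseteq> Ok" unfolding T_def by blast
    show "card (coset I ` T) = p ^ a" unfolding HT by (rule H(2))
    have "of_nat (p ^ a) * (x - y) \<in> I" if "x \<in> T" "y \<in> T" for x y
      using I_diff[OF zero[OF that(1)] zero[OF that(2)]] by (simp only: right_diff_distrib)
    then show "\<forall>x\<in>T. \<forall>y\<in>T. of_nat (p ^ a) * (x - y) \<in> I" by blast
  qed
qed

text \<open>
  A function with few values that separates cosets up to a factor \<open>c\<close> prime to
  \<open>p\<close> is injective on the \<open>p\<close>-part of the quotient, so it bounds that
  part.
\<close>

lemma prime_power_bound:
  fixes g :: "complex \<Rightarrow> 'b"
  assumes N: "card (coset I ` Ok) = N" "N > 0" and p: "Factorial_Ring.prime p" "p ^ a dvd N" and c: "\<not> int p dvd c"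
    and V: "finite V" "\<And>x. x \<in> Ok \<Longrightarrow> g x \<in> V" and g: "\<And>x y. x \<in> Ok \<Longrightarrow> y \<in> Ok \<Longrightarrow> g x = g y \<Longrightarrow> of_int c * (x - y) \<in> I"
  shows "p ^ a \<le> card V"
proof -
  obtain T where T: "T \<subseteq> Ok" "card (coset I ` T) = p ^ a" "\<forall>x\<in>T. \<forall>y\<in>T. of_nat (p ^ a) * (x - y) \<in> I"
    by (rule power_coset_group[OF N p])
  have "coprime (int p ^ a) c" using prime_imp_coprime[OF _ c] p(1) by simp
  then have g1: "gcd (int p ^ a) c = 1" by (rule coprime_imp_gcd_eq_1)
  obtain u v where uv: "u * int p ^ a + v * c = 1" using bezout_int[of "int p ^ a" c] unfolding g1 by blast
  define rep where "rep C = (SOME x. x \<in> T \<and> coset I x = C)" for C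
  have rep: "rep C \<in> T" "coset I (rep C) = C" if C: "C \<in> coset I ` T" for C
  proof -
    have "\<exists>x. x \<in> T \<and> coset I x = C" using C by blast
    from someI_ex[OF this] show "rep C \<in> T" "coset I (rep C) = C" unfolding rep_def by blast+
  qed
  have "inj_on (\<lambda>C. g (rep C)) (coset I ` T)"
  proof (rule inj_onI)
    fix C D assume CD: "C \<in> coset I ` T" "D \<in> coset I ` T" "g (rep C) = g (rep D)"
    let ?x = "rep C" and ?y = "rep D"
    have xy: "?x \<in> Ok" "?y \<in> Ok" using rep(1) CD T(1) by blast+
    have "of_int u * (of_nat (p ^ a) * (?x - ?y)) + of_int v * (of_int c * (?x - ?y)) \<in> I"
      by (intro I_closed(3) I_int_mult T(3)[rule_format] g xy rep(1) CD)
    moreover have "of_int u * (of_nat (p ^ a) * (?x - ?y)) + of_int v * (of_int c * (?x - ?y)) = of_int (u * int p ^ a + v * c) * (?x - ?y)"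
      by (simp add: algebra_simps)
    ultimately have "?x - ?y \<in> I" unfolding uv by simp
    then have "coset I ?x = coset I ?y" unfolding coset_eq .
    then show "C = D" using rep(2) CD by simp
  qed
  moreover have "(\<lambda>C. g (rep C)) ` coset I ` T \<subseteq> V"
    using V(2) rep(1) T(1) by blast
  ultimately have "card (coset I ` T) \<le> card V" using V(1) by (rule card_inj_on_le)
  then show ?thesis unfolding T(2) .
qed

lemma norm_in_ideal:
  assumes "E k u \<in> I" shows "of_int (k ^ 3 - 3 * n * k * enorm u + n * etr (u ^ 3 * \<pi>)) \<in> I"
proof -
  have "(\<sigma> (E k u) * \<sigma> (\<sigma> (E k u))) * E k u \<in> I"
    by (rule I_closed(4)[OF assms]) (simp add: \<sigma>_E O_closed(2))
  also have "(\<sigma> (E k u) * \<sigma> (\<sigma> (E k u))) * E k u = E k u * \<sigma> (E k u) * \<sigma> (\<sigma> (E k u))" by (simp only: mult_ac)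
  finally show ?thesis unfolding E_symmetric(3) .
qed

text \<open>
  Translation by one permutes the cosets; summing representatives over this permutation shows
  that the index annihilates the quotient.
\<close>

lemma index_in_ideal:
  assumes N: "card (coset I ` Ok) = N" "N > 0" shows "of_nat N \<in> I"
proof -
  interpret R: ring R by (rule R_ring)
  interpret I: ideal I R by (rule I)
  define f where "f C = coset I ((SOME x. x \<in> Ok \<and> coset I x = C) + 1)" for C
  have f: "f (coset I x) = coset I (x + 1)" if "x \<in> Ok" for x
  proof -
    have "\<exists>y. y \<in> Ok \<and> coset I y = coset I x" using that by blast
    from someI_ex[OF this] have "(SOME y. y \<in> Ok \<and> coset I y = coset I x) - x \<in> I" unfolding coset_eq by blast
    then show ?thesis unfolding f_def coset_eq by simp
  qed
  define r where "r C = (SOME x. x \<in> Ok \<and> coset I x = C)" for C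
  have r: "r C \<in> Ok" "coset I (r C) = C" if C: "C \<in> coset I ` Ok" for C
  proof -
    have "\<exists>x. x \<in> Ok \<and> coset I x = C" using C by blast
    from someI_ex[OF this] show "r C \<in> Ok" "coset I (r C) = C" unfolding r_def by blast+
  qed
  have one: "1 \<in> Ok" using O_closed(4)[of 1] by simp
  have fin: "finite (coset I ` Ok)" using N by (simp add: card_ge_0_finite)
  have inj: "inj_on f (coset I ` Ok)"
  proof (rule inj_onI)
    fix C D assume CD: "C \<in> coset I ` Ok" "D \<in> coset I ` Ok" "f C = f D"
    obtain x y where xy: "x \<in> Ok" "y \<in> Ok" "C = coset I x" "D = coset I y" using CD(1,2) by blast
    have "coset I (x + 1) = coset I (y + 1)" using CD(3) f xy by simp
    then show "C = D" unfolding xy coset_eq by simp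
  qed
  have fsub: "f ` coset I ` Ok \<subseteq> coset I ` Ok"
  proof (rule image_subsetI)
    fix C assume "C \<in> coset I ` Ok"
    then obtain x where x: "C = coset I x" "x \<in> Ok" by (rule imageE)
    show "f C \<in> coset I ` Ok" unfolding x(1) f[OF x(2)] by (rule imageI[OF O_closed(1)[OF x(2) one]])
  qed
  have bij: "bij_betw f (coset I ` Ok) (coset I ` Ok)"
    unfolding bij_betw_def by (rule conjI[OF inj endo_inj_surj[OF fin fsub inj]])
  have sumI: "(\<Sum>C\<in>A. h C) \<in> I" if "finite A" "\<And>C. C \<in> A \<Longrightarrow> h C \<in> I" for A and h :: "complex set \<Rightarrow> complex"
    using that by (induction A rule: finite_induct) (simp_all add: I_closed)
  have "(\<Sum>C\<in>coset I ` Ok. r C + 1 - r (f C)) \<in> I"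
  proof (rule sumI[OF fin])
    fix C assume C: "C \<in> coset I ` Ok"
    have rO: "r C + 1 \<in> Ok" using O_closed(1)[OF r(1)[OF C] one] .
    have "f C = coset I (r C + 1)" using f[OF r(1)[OF C]] unfolding r(2)[OF C] .
    then have "coset I (r C + 1) = coset I (r (f C))" using r(2)[of "f C"] rO by simp
    then show "r C + 1 - r (f C) \<in> I" unfolding coset_eq .
  qed
  also have "(\<Sum>C\<in>coset I ` Ok. r C + 1 - r (f C)) = of_nat N"
    using sum.reindex_bij_betw[OF bij, of r] by (simp add: sum_subtractf sum.distrib N(1))
  finally show ?thesis .
qed

lemma gcd_in_ideal: "of_int x \<in> I \<Longrightarrow> of_int y \<in> I \<Longrightarrow> of_int (gcd x y) \<in> I"
proof -
  assume xy: "of_int x \<in> I" "of_int y \<in> I"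
  obtain u v where uv: "u * x + v * y = gcd x y" using bezout_int by blast
  have "of_int u * of_int x + of_int v * of_int y \<in> I" by (intro I_closed(3) I_int_mult xy)
  then show ?thesis unfolding uv[symmetric] by simp
qed

text \<open>
  If \<open>x\<close> were prime to \<open>p\<close>, the \<open>p\<close>-part of the quotient
  would be annihilated by both \<open>x\<close> and a power of \<open>p\<close>.
\<close>

lemma prime_dvd_norm:
  assumes N: "card (coset I ` Ok) = N" "N > 0" and p: "Factorial_Ring.prime p" "p dvd N" and x: "of_int x \<in> I"
  shows "int p dvd x"
proof (rule ccontr)
  assume nd: "\<not> int p dvd x"
  have "p ^ 1 \<le> card {()}"
  proof (rule prime_power_bound[OF N p(1), where a = 1 and c = x and V = "{()}" and g = "\<lambda>_. ()"])
    show "p ^ 1 dvd N" using p(2) by (simp only: power_one_right)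
    show "\<not> int p dvd x" by (rule nd)
    show "of_int x * (y - z) \<in> I" if "y \<in> Ok" "z \<in> Ok" for y z
    proof -
      have "y + - z \<in> Ok" by (intro O_closed that)
      from I_closed(4)[OF x this] show ?thesis by (simp add: mult.commute)
    qed
  qed simp_all
  then show False using prime_gt_1_nat[OF p(1)] by simp
qed

text \<open>
  If \<open>u \<pi>\<close> is not divisible by \<open>p\<close>, multiples of the given
  element, together with a number divisible by \<open>p\<close> exactly once, produce \<open>c w
  \<theta> + cnj (c w \<theta>)\<close> for all \<open>w\<close>, with \<open>c\<close> prime to
  \<open>p\<close>. Then the residue of \<open>k\<close> modulo \<open>p\<close> separates the
  \<open>p\<close>-part of the quotient, which has at least \<open>p\<^sup>2\<close> elements.
\<close>

lemma square_condition:
  assumes N: "card (coset I ` Ok) = N" "N > 0" and pp: "Factorial_Ring.prime p" "p * p dvd N" "int p dvd n" and x: "E k u \<in> I" "int p dvd k"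
  shows "of_int (int p) dvd u * \<pi>"
proof (rule ccontr)
  assume nd: "\<not> of_int (int p) dvd u * \<pi>"
  have pi: "Factorial_Ring.prime (int p)" using pp(1) by simp
  interpret eis_prime "int p" n \<pi> by (rule eis_prime_n[OF pi pp(3)])
  have p0: "int p \<noteq> 0" using pi by auto
  obtain k' where k': "k = int p * k'" using x(2) by (rule dvdE)
  obtain n' where n': "n = int p * n'" using pp(3) by (rule dvdE)
  have pn': "\<not> int p dvd n'" using n(3) unfolding n' by (auto simp: p0)
  define t h where "t = etr \<pi>" and "h = etr (u * \<pi>)"
  have pt: "\<not> int p dvd t" unfolding t_def by (rule trace_unit)
  have ph: "\<not> int p dvd h" unfolding h_def using dvd_pi_mult nd by blast
  have pc: "\<not> int p dvd etr (u ^ 3 * \<pi>)" using dvd_cube_trace nd by blast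
  define nx where "nx = k ^ 3 - 3 * n * k * enorm u + n * etr (u ^ 3 * \<pi>)"
  define d where "d = gcd (int N) nx"
  have dI: "of_int d \<in> I" unfolding d_def
  proof (rule gcd_in_ideal)
    show "of_int (int N) \<in> I" using index_in_ideal[OF N] by simp
    show "of_int nx \<in> I" unfolding nx_def by (rule norm_in_ideal[OF x(1)])
  qed
  have nx: "nx = int p * (int p * (int p * k' ^ 3 - 3 * n' * k' * enorm u) + n' * etr (u ^ 3 * \<pi>))"
    unfolding nx_def k' n' by (simp add: power3_eq_cube algebra_simps)
  have "p dvd N" using pp(2) by (rule dvd_mult_left)
  then have "int p dvd d" unfolding d_def nx by (intro gcd_greatest) simp_all
  then obtain d' where d': "d = int p * d'" by (rule dvdE)
  have pd': "\<not> int p dvd d'"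
  proof
    assume "int p dvd d'"
    then have "int p * int p dvd d" unfolding d' by (rule mult_dvd_mono[OF dvd_refl])
    also have "d dvd nx" unfolding d_def by simp
    finally have "int p = 0 \<or> int p dvd int p * (int p * k' ^ 3 - 3 * n' * k' * enorm u) + n' * etr (u ^ 3 * \<pi>)"
      unfolding nx by (simp only: dvd_mult_cancel_left)
    with p0 have "int p dvd int p * (int p * k' ^ 3 - 3 * n' * k' * enorm u) + n' * etr (u ^ 3 * \<pi>)" by (simp only: simp_thms)
    then have d: "int p dvd n' * etr (u ^ 3 * \<pi>)" by (simp only: dvd_add_right_iff dvd_triv_left)
    show False using prime_dvd_multD[OF pi d] pn' pc by (elim disjE) (simp_all only: simp_thms)
  qed
  have IE: "E 0 (of_int d' * v) \<in> I" if v: "of_int (int p) dvd v" for v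
  proof -
    obtain v' where "v = of_int (int p) * v'" using v by (rule dvdE)
    then have "E 0 (of_int d' * v) = of_int d * E 0 v'" unfolding E_scale d' by (simp add: mult_ac)
    moreover have "of_int d * E 0 v' \<in> I" using I_closed(4)[OF dI E_O[of 0 v']] by (simp only: mult.commute)
    ultimately show ?thesis by (simp only:)
  qed
  have IW: "E 0 (of_int d' * (of_int k * v + of_int l * u + econj (\<pi> * u * v))) \<in> I" for l v
  proof -
    define A where "A = k' * l + n' * etr (u * econj v)"
    define W where "W = of_int k * v + of_int l * u + econj (\<pi> * u * v)"
    have "E k u * E l v \<in> I" using I_closed(4)[OF x(1) E_O[of l v]] by (simp only: mult.commute)
    then have 1: "of_int d' * (E k u * E l v) \<in> I" by (rule I_int_mult)
    have kA: "k * l + n * etr (u * econj v) = int p * A" unfolding A_def k' n' by (simp add: algebra_simps)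
    have 2: "of_int d' * (E k u * E l v) = E (d' * (int p * A)) (of_int d' * W)" unfolding E_mult kA W_def[symmetric] E_scale ..
    have 3: "of_int A * of_int d = E (A * d) 0" unfolding E_of_int of_int_mult ..
    have z: "d' * (int p * A) - A * d = 0" unfolding d' by (simp add: mult_ac)
    have "E (d' * (int p * A)) (of_int d' * W) - E (A * d) 0 \<in> I"
      using I_diff[OF 1 I_int_mult[OF dI, of A]] unfolding 2 3 .
    then show ?thesis unfolding E_diff z diff_zero W_def .
  qed
  define c where "c = d' * (h * h * t)"
  have pc': "\<not> int p dvd c" unfolding c_def using pd' ph pt prime_dvd_multD[OF pi] by blast
  have cw: "E 0 (of_int c * w) \<in> I" for w
  proof -
    define l where "l = etr (w * \<pi>)"
    define v where "v = \<pi> * econj (of_int h * w - of_int l * u)"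
    define \<rho> where "\<rho> = econj \<pi>"
    have H: "of_int h = u * \<pi> + econj u * \<rho>" "of_int l = w * \<pi> + econj w * \<rho>" "of_int t = \<pi> + \<rho>"
      unfolding h_def l_def t_def \<rho>_def etr_eq econj_hom by simp_all
    have ev: "econj (\<pi> * u * v) = \<rho> * econj u * \<rho> * (of_int h * w - of_int l * u)"
      unfolding v_def \<rho>_def econj_hom by (simp only: mult_ac)
    have dv: "of_int (int p) dvd of_int (h * h * t) * w - (of_int (h * l * t) * u + econj (\<pi> * u * v))"
    proof -
      have id: "(x * P + x' * r) * (x * P + x' * r) * (P + r) * y - ((x * P + x' * r) * (y * P + y' * r) * (P + r) * x + r * x' * r * ((x * P + x' * r) * y - (y * P + y' * r) * x))
        = (P * r) * (y * (x * x * P + 2 * x * x' * P + 2 * x * x' * r + x' * x' * r) - x * (x * y * P + (x * y' + x' * y) * P + (x * y' + x' * y) * r + x' * y' * r))"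
        for x x' y y' P r :: eis by (simp add: algebra_simps)
      show ?thesis unfolding ev of_int_mult H id using P_norm unfolding \<rho>_def by (rule dvd_mult2)
    qed
    have "E 0 (of_int d' * (of_int k * v + of_int (h * l * t) * u + econj (\<pi> * u * v))) \<in> I" by (rule IW)
    moreover have "E 0 (of_int d' * (of_int (h * h * t) * w - (of_int k * v + of_int (h * l * t) * u + econj (\<pi> * u * v)))) \<in> I"
    proof (rule IE)
      have "of_int (int p) dvd of_int k * v" unfolding k' by simp
      have g: "x - (a + b + c) = x - (b + c) - a" for x a b c :: eis by (simp add: algebra_simps)
      show "of_int (int p) dvd of_int (h * h * t) * w - (of_int k * v + of_int (h * l * t) * u + econj (\<pi> * u * v))"
        unfolding g by (rule dvd_diff[OF dv \<open>of_int (int p) dvd of_int k * v\<close>])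
    qed
    ultimately have "E 0 (of_int d' * (of_int k * v + of_int (h * l * t) * u + econj (\<pi> * u * v))) +
       E 0 (of_int d' * (of_int (h * h * t) * w - (of_int k * v + of_int (h * l * t) * u + econj (\<pi> * u * v)))) \<in> I"
      by (rule I_closed(3))
    moreover have eq: "of_int d' * Z + of_int d' * (of_int (h * h * t) * w - Z) = of_int c * w" for Z
      unfolding c_def by (simp add: algebra_simps)
    ultimately show ?thesis by (simp only: E_add eq add_0)
  qed
  define res where "res y = (THE m. \<exists>j v. y = E j v \<and> m = j mod int p)" for y
  have the: "res (E i w) = i mod int p" for i w
    unfolding res_def by (rule the_equality) (auto simp: E_inj)
  have "p ^ 2 \<le> card {0..<int p}"
  proof (rule prime_power_bound[OF N pp(1) _ pc', where a = 2 and V = "{0..<int p}" and g = res])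
    show "p ^ 2 dvd N" using pp(2) by (simp add: power2_eq_square)
    show "res y \<in> {0..<int p}" if yO: "y \<in> Ok" for y
    proof -
      obtain i w where y: "y = E i w" using yO by (rule O_cases)
      have "int p > 0" using p0 by simp
      then show ?thesis unfolding y the by simp
    qed
    show "of_int c * (y - z) \<in> I" if yz: "y \<in> Ok" "z \<in> Ok" "res y = res z" for y z
    proof -
      obtain i w where y: "y = E i w" using yz(1) by (rule O_cases)
      obtain j v where z: "z = E j v" using yz(2) by (rule O_cases)
      have "i mod int p = j mod int p" using yz(3) unfolding y z the .
      then have "int p dvd i - j" by (simp add: mod_eq_dvd_iff)
      then obtain s where s: "i - j = int p * s" by (rule dvdE)
      have cz: "c * (i - j) = 0 + h * h * t * s * d" unfolding s c_def d' by (simp add: mult_ac)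
      have 1: "of_int c * (y - z) = E (c * (i - j)) (of_int c * (w - v) + 0)" unfolding y z E_diff E_scale add_0_right ..
      have 2: "of_int (h * h * t * s) * of_int d = E (h * h * t * s * d) 0" unfolding E_of_int of_int_mult ..
      have "E 0 (of_int c * (w - v)) + of_int (h * h * t * s) * of_int d \<in> I" by (rule I_closed(3)[OF cw I_int_mult[OF dI]])
      then show ?thesis unfolding 1 2 cz E_add[symmetric] .
    qed
  qed simp
  moreover have "card {0..<int p} = p" by simp
  ultimately show False using n_less_m_mult_n[of p p] prime_gt_1_nat[OF pp(1)] by (simp add: power2_eq_square)
qed

end

end

section \<open>The shape of the lattice\<close>

lemma norm_vec3: "(norm (v :: real ^ 3))\<^sup>2 = (v $ 1)\<^sup>2 + (v $ 2)\<^sup>2 + (v $ 3)\<^sup>2"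
  unfolding power2_norm_eq_inner inner_vec_def sum_3 by (simp add: power2_eq_square)

text \<open>
  The Gram matrix of the three vectors is \<open>A\<close> times the all-ones matrix plus
  \<open>B\<close> times that of the cube roots of unity, hence positive definite.
\<close>

lemma hexagonal_independent:
  fixes b0 b1 b2 :: "'a :: euclidean_space" and A B :: real
  assumes pos: "A > 0" "B > 0"
    and n: "(norm b0)\<^sup>2 = A + B" "(norm b1)\<^sup>2 = A + B" "(norm b2)\<^sup>2 = A + B"
    and s: "(norm (b0 + b1))\<^sup>2 = 4 * A + B" "(norm (b0 + b2))\<^sup>2 = 4 * A + B" "(norm (b1 + b2))\<^sup>2 = 4 * A + B"
  shows "independent {b0, b1, b2}" "b0 \<noteq> b1" "b0 \<noteq> b2" "b1 \<noteq> b2"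
proof -
  have d: "inner x y = A - B / 2" if "(norm x)\<^sup>2 = A + B" "(norm y)\<^sup>2 = A + B" "(norm (x + y))\<^sup>2 = 4 * A + B" for x y :: 'a
    using that unfolding power2_norm_eq_inner by (simp add: inner_add_left inner_add_right inner_commute)
  have i: "inner b0 b1 = A - B / 2" "inner b0 b2 = A - B / 2" "inner b1 b2 = A - B / 2"
    "inner b1 b0 = A - B / 2" "inner b2 b0 = A - B / 2" "inner b2 b1 = A - B / 2"
    using d[OF n(1,2) s(1)] d[OF n(1,3) s(2)] d[OF n(2,3) s(3)] by (simp_all add: inner_commute)
  have m: "inner b0 b0 = A + B" "inner b1 b1 = A + B" "inner b2 b2 = A + B"
    using n by (simp_all add: power2_norm_eq_inner)
  have ne: "A + B \<noteq> A - B / 2" using pos by simp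
  show dist: "b0 \<noteq> b1" "b0 \<noteq> b2" "b1 \<noteq> b2" using i m ne by metis+
  show "independent {b0, b1, b2}"
  proof (rule independent_if_scalars_zero)
    fix f v assume z: "(\<Sum>x\<in>{b0, b1, b2}. f x *\<^sub>R x) = 0" and v: "v \<in> {b0, b1, b2}"
    define x y w where "x = f b0" and "y = f b1" and "w = f b2"
    have e: "x *\<^sub>R b0 + y *\<^sub>R b1 + w *\<^sub>R b2 = 0" using z dist by (simp add: x_def y_def w_def add.assoc)
    have "inner (x *\<^sub>R b0 + y *\<^sub>R b1 + w *\<^sub>R b2) (x *\<^sub>R b0 + y *\<^sub>R b1 + w *\<^sub>R b2)
       = A * (x + y + w)\<^sup>2 + B / 2 * ((x - y)\<^sup>2 + (y - w)\<^sup>2 + (x - w)\<^sup>2)"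
      by (simp add: inner_add_left inner_add_right i m power2_eq_square field_simps)
    then have q: "A * (x + y + w)\<^sup>2 + B / 2 * ((x - y)\<^sup>2 + (y - w)\<^sup>2 + (x - w)\<^sup>2) = 0" unfolding e by simp
    have "A * (x + y + w)\<^sup>2 \<ge> 0" "B / 2 * ((x - y)\<^sup>2 + (y - w)\<^sup>2 + (x - w)\<^sup>2) \<ge> 0" using pos by simp_all
    with q have q1: "A * (x + y + w)\<^sup>2 = 0" "B / 2 * ((x - y)\<^sup>2 + (y - w)\<^sup>2 + (x - w)\<^sup>2) = 0" by linarith+
    from q1(1) pos have "x + y + w = 0" by simp
    moreover from q1(2) pos have "(x - y)\<^sup>2 + (y - w)\<^sup>2 + (x - w)\<^sup>2 = 0" by simp
    then have "(x - y)\<^sup>2 = 0" "(y - w)\<^sup>2 = 0"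
      using zero_le_power2[of "x - y"] zero_le_power2[of "y - w"] zero_le_power2[of "x - w"] by linarith+
    then have "x = y" "y = w" by simp_all
    ultimately have "x = 0" "y = 0" "w = 0" by simp_all
    with v show "f v = 0" unfolding x_def y_def w_def by blast
  qed simp
qed

text \<open>
  Used to show that the minimal vectors do not span when they all lie in the plane, or all on
  the axis.
\<close>

lemma orthogonal_not_full:
  fixes d :: "'a :: euclidean_space"
  assumes "independent S" "card S = DIM('a)" "\<And>v. v \<in> S \<Longrightarrow> inner d v = 0"
  shows "d = 0"
proof -
  have "span S = UNIV"
    using card_ge_dim_independent[of S UNIV] assms(1,2) by auto
  then have "d \<in> span S" by simp
  moreover have "S \<subseteq> {v. inner d v = 0}" using assms(3) by blast
  then have "span S \<subseteq> {v. inner d v = 0}" by (rule span_minimal[OF _ subspace_hyperplane])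
  ultimately have "inner d d = 0" by blast
  then show ?thesis by simp
qed

lemma three_dvd_enorm: "3 dvd enorm u \<longleftrightarrow> 3 dvd epart u + wpart u"
proof -
  have e: "enorm u = (epart u + wpart u) * (epart u + wpart u) - 3 * (epart u * wpart u)"
    by (simp add: enorm_def algebra_simps)
  have p3: "Factorial_Ring.prime (3 :: int)" by simp
  have g: "3 dvd a \<longleftrightarrow> 3 dvd b" if "a = b - 3 * c" for a b c :: int using that by presburger
  show ?thesis unfolding g[OF e] prime_dvd_mult_iff[OF p3] by blast
qed

context cubic_datum
begin

abbreviation "emb \<equiv> canonical_embedding \<sigma>"

lemma emb_comp: "emb x $ 1 = Re x" "emb x $ 2 = Re (\<sigma> x)" "emb x $ 3 = Re (\<sigma> (\<sigma> x))"
  unfolding canonical_embedding_def by (simp_all add: vector_3)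

lemma emb_add: "x \<in> F \<Longrightarrow> y \<in> F \<Longrightarrow> emb (x + y) = emb x + emb y"
  by (simp add: Finite_Cartesian_Product.vec_eq_iff forall_3 emb_comp \<sigma>_add \<sigma>_closed)

lemma emb_scale: "x \<in> F \<Longrightarrow> emb (of_int k * x) = of_int k *\<^sub>R emb x"
  by (simp add: Finite_Cartesian_Product.vec_eq_iff forall_3 emb_comp \<sigma>_mult \<sigma>_rat \<sigma>_closed Rats_F)

lemma Re_square: "x \<in> F \<Longrightarrow> (Re x)\<^sup>2 = Re (x\<^sup>2)"
  using F_real[of x] by (auto simp: power2_eq_square complex_is_Real_iff)

lemma emb_norm: "(norm (emb (E k u)))\<^sup>2 = of_int (3 * (k * k) + 6 * n * enorm u)"
proof -
  have "(norm (emb (E k u)))\<^sup>2 = Re ((E k u)\<^sup>2 + (\<sigma> (E k u))\<^sup>2 + (\<sigma> (\<sigma> (E k u)))\<^sup>2)"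
    unfolding norm_vec3 emb_comp using E_F[of k u] by (simp add: Re_square \<sigma>_closed)
  then show ?thesis unfolding E_square_sum by simp
qed

lemma emb_trace: "emb (E k u) $ 1 + emb (E k u) $ 2 + emb (E k u) $ 3 = 3 * of_int k"
  unfolding emb_comp using arg_cong[OF E_symmetric(1)[of k u], of Re] by simp

text \<open>
  In the coordinates \<open>(j, z)\<close> the squared length is \<open>A j\<^sup>2 + B
  N(z)\<close>. By the congruence between \<open>j\<close> and \<open>z\<close> the nonzero
  vectors have squared length at least \<open>9 A\<close> on the axis, at least \<open>3
  B\<close> in the plane, and at least \<open>A + B\<close> elsewhere. If one of the
  inequalities fails, all the minimal vectors are in the plane or all are on the axis.
\<close>

theorem well_rounded_iff:
  fixes M q :: int and \<kappa> :: eis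
  assumes M: "M > 0" and \<kappa>: "enorm \<kappa> = q" "q > 0"
  defines "L \<equiv> {E (M * j) (\<kappa> * z) | j z. 3 dvd j - (epart z + wpart z)}"
  shows "well_rounded (emb ` L) \<longleftrightarrow> 3 * (M * M) \<le> 12 * (n * q) \<and> 6 * (n * q) \<le> 24 * (M * M)"
proof -
  define A B where "A = 3 * (M * M)" and "B = 6 * (n * q)"
  have pos: "A > 0" "B > 0" unfolding A_def B_def using M \<kappa> n_pos by simp_all
  define f where "f j z = emb (E (M * j) (\<kappa> * z))" for j z
  define Q where "Q j z = A * (j * j) + B * enorm z" for j z
  have fN: "(norm (f j z))\<^sup>2 = of_int (Q j z)" for j z
    unfolding f_def emb_norm enorm_mult \<kappa> Q_def A_def B_def by (simp add: algebra_simps)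
  have fadd: "f j z + f j' z' = f (j + j') (z + z')" for j j' z z'
    unfolding f_def emb_add[OF E_F E_F, symmetric] E_add by (simp add: distrib_left)
  have fscale: "of_int c *\<^sub>R f j z = f (c * j) (of_int c * z)" for c j z
    unfolding f_def emb_scale[OF E_F, symmetric] E_scale by (simp add: mult_ac)
  have L: "emb ` L = {f j z | j z. 3 dvd j - (epart z + wpart z)}" unfolding L_def f_def by blast
  have fL: "f j z \<in> emb ` L" if "3 dvd j - (epart z + wpart z)" for j z unfolding L using that by blast
  have Q0: "Q j z = 0 \<longleftrightarrow> j = 0 \<and> z = 0" for j z
  proof
    assume "Q j z = 0"
    moreover have "A * (j * j) \<ge> 0" "B * enorm z \<ge> 0" using pos enorm_nonneg[of z] by simp_all
    ultimately have "A * (j * j) = 0" "B * enorm z = 0" unfolding Q_def by linarith+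
    then show "j = 0 \<and> z = 0" using pos enorm_zero[of z] by simp
  qed (simp add: Q_def enorm_def)
  have f0: "f j z = 0 \<longleftrightarrow> j = 0 \<and> z = 0" for j z
  proof -
    have "f j z = 0 \<longleftrightarrow> (norm (f j z))\<^sup>2 = 0" by simp
    then show ?thesis unfolding fN of_int_eq_0_iff Q0 .
  qed
  have le: "norm (f j z) \<le> norm (f j' z') \<longleftrightarrow> Q j z \<le> Q j' z'" for j z j' z'
  proof -
    have "norm (f j z) \<le> norm (f j' z') \<longleftrightarrow> (norm (f j z))\<^sup>2 \<le> (norm (f j' z'))\<^sup>2"
      by (simp add: power_mono_iff)
    then show ?thesis unfolding fN of_int_le_iff .
  qed
  define w :: eis where "w = Eis 0 1"
  define w' :: eis where "w' = Eis (- 1) (- 1)"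
  define b0 b1 b2 where "b0 = f 1 1" and "b1 = f 1 w" and "b2 = f 1 w'"
  have nw: "enorm 1 = 1" "enorm w = 1" "enorm w' = 1" "enorm (1 + w) = 1" "enorm (1 + w') = 1" "enorm (w + w') = 1"
    by (simp_all add: enorm_def w_def w'_def)
  have bL: "b0 \<in> emb ` L" "b1 \<in> emb ` L" "b2 \<in> emb ` L"
    unfolding b0_def b1_def b2_def by (intro fL; simp add: w_def w'_def)+
  have bQ: "Q 1 1 = A + B" "Q 1 w = A + B" "Q 1 w' = A + B" "Q (1 + 1) (1 + w) = 4 * A + B" "Q (1 + 1) (1 + w') = 4 * A + B" "Q (1 + 1) (w + w') = 4 * A + B"
    unfolding Q_def nw by simp_all
  have ind: "independent {b0, b1, b2}" and dist: "b0 \<noteq> b1" "b0 \<noteq> b2" "b1 \<noteq> b2"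
    using hexagonal_independent[of "of_int A" "of_int B" b0 b1 b2] pos
    unfolding b0_def b1_def b2_def fadd fN bQ by simp_all
  have full: "full_rank_lattice (emb ` L)"
    unfolding full_rank_lattice_def
  proof (intro exI conjI)
    show "independent {b0, b1, b2}" by (rule ind)
    show "card {b0, b1, b2} = DIM(real ^ 3)" using dist by simp
    have sum3: "(\<Sum>b\<in>{b0, b1, b2}. of_int (c b) *\<^sub>R b) = f (c b0 + c b1 + c b2) (of_int (c b0) + of_int (c b1) * w + of_int (c b2) * w')" for c
    proof -
      have "(\<Sum>b\<in>{b0, b1, b2}. of_int (c b) *\<^sub>R b) = of_int (c b0) *\<^sub>R b0 + (of_int (c b1) *\<^sub>R b1 + of_int (c b2) *\<^sub>R b2)"
        using dist by simp
      also have "\<dots> = f (c b0 * 1) (of_int (c b0) * 1) + (f (c b1 * 1) (of_int (c b1) * w) + f (c b2 * 1) (of_int (c b2) * w'))"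
        unfolding b0_def b1_def b2_def fscale ..
      finally show ?thesis unfolding fadd by (simp add: add.assoc)
    qed
    show "emb ` L = {\<Sum>b\<in>{b0, b1, b2}. real_of_int (c b) *\<^sub>R b | c. True}"
    proof (intro equalityI subsetI)
      fix v assume "v \<in> emb ` L"
      then obtain j z where v: "v = f j z" "3 dvd j - (epart z + wpart z)" unfolding L by blast
      obtain t where t: "j - (epart z + wpart z) = 3 * t" using v(2) by (rule dvdE)
      define c where "c b = (if b = b0 then epart z + t else if b = b1 then wpart z + t else t)" for b
      have c: "c b0 = epart z + t" "c b1 = wpart z + t" "c b2 = t" using dist by (simp_all add: c_def)
      have "j = c b0 + c b1 + c b2" unfolding c using t by simp
      moreover have "z = of_int (c b0) + of_int (c b1) * w + of_int (c b2) * w'"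
        by (rule eis_eqI) (simp_all add: c w_def w'_def)
      ultimately have "v = (\<Sum>b\<in>{b0, b1, b2}. of_int (c b) *\<^sub>R b)" unfolding sum3 v(1) by (simp only:)
      then show "v \<in> {\<Sum>b\<in>{b0, b1, b2}. real_of_int (c b) *\<^sub>R b | c. True}" by blast
    next
      fix v assume "v \<in> {\<Sum>b\<in>{b0, b1, b2}. real_of_int (c b) *\<^sub>R b | c. True}"
      then obtain c where "v = (\<Sum>b\<in>{b0, b1, b2}. real_of_int (c b) *\<^sub>R b)" by blast
      then show "v \<in> emb ` L" unfolding sum3 by (simp only:, intro fL) (simp add: w_def w'_def)
    qed
  qed
  have mins: "v \<in> minimal_vectors (emb ` L) \<longleftrightarrow> (\<exists>j z. v = f j z \<and> 3 dvd j - (epart z + wpart z) \<and> Q j z \<noteq> 0 \<and>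
     (\<forall>j' z'. 3 dvd j' - (epart z' + wpart z') \<longrightarrow> Q j' z' \<noteq> 0 \<longrightarrow> Q j z \<le> Q j' z'))" (is "_ \<longleftrightarrow> ?R") for v
  proof
    assume "v \<in> minimal_vectors (emb ` L)"
    then have v: "v \<in> emb ` L" "v \<noteq> 0" "\<And>w. w \<in> emb ` L \<Longrightarrow> w \<noteq> 0 \<Longrightarrow> norm v \<le> norm w"
      unfolding minimal_vectors_def mem_Collect_eq by blast+
    obtain j z where jz: "v = f j z" "3 dvd j - (epart z + wpart z)" using v(1) unfolding L by blast
    have "Q j z \<le> Q j' z'" if "3 dvd j' - (epart z' + wpart z')" "Q j' z' \<noteq> 0" for j' z'
      using v(3)[OF fL[OF that(1)]] that(2) unfolding jz(1) le f0 Q0 by blast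
    moreover have "Q j z \<noteq> 0" using v(2) unfolding jz(1) f0 Q0 .
    ultimately show ?R using jz by blast
  next
    assume ?R
    then obtain j z where jz: "v = f j z" "3 dvd j - (epart z + wpart z)" "Q j z \<noteq> 0"
      "\<And>j' z'. 3 dvd j' - (epart z' + wpart z') \<Longrightarrow> Q j' z' \<noteq> 0 \<Longrightarrow> Q j z \<le> Q j' z'" by blast
    have "norm v \<le> norm w" if w: "w \<in> emb ` L" "w \<noteq> 0" for w
    proof -
      obtain j' z' where w': "w = f j' z'" "3 dvd j' - (epart z' + wpart z')" using w(1) unfolding L by blast
      have "Q j' z' \<noteq> 0" using w(2) unfolding w'(1) f0 Q0 .
      from jz(4)[OF w'(2) this] show ?thesis unfolding jz(1) w'(1) le .
    qed
    moreover have "v \<noteq> 0" using jz(3) unfolding jz(1) f0 Q0 .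
    ultimately show "v \<in> minimal_vectors (emb ` L)" unfolding minimal_vectors_def using fL[OF jz(2)] jz(1) by blast
  qed
  have sq1: "j * j \<ge> 1" if "j \<noteq> 0" for j :: int
  proof -
    have "0 < j * j" unfolding zero_less_mult_iff using that by arith
    then show ?thesis by linarith
  qed
  have sq9: "j * j \<ge> 9" if j: "j \<noteq> 0" "3 dvd j" for j :: int
  proof -
    obtain i where i: "j = 3 * i" using j(2) by (rule dvdE)
    have "i * i \<ge> 1" using j(1) unfolding i by (intro sq1) simp
    then show ?thesis unfolding i by simp
  qed
  have nz1: "enorm z \<ge> 1" if "z \<noteq> 0" for z
    using that enorm_nonneg[of z] enorm_zero[of z] by linarith
  have nz3: "enorm z \<ge> 3" if "z \<noteq> 0" "3 dvd epart z + wpart z" for z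
  proof -
    have "3 \<le> e" if "1 \<le> e" "3 dvd e" for e :: int using that by presburger
    then show ?thesis using nz1[OF that(1)] that(2) unfolding three_dvd_enorm[symmetric] by blast
  qed
  have bounds: "j = 0 \<and> z = 0 \<or> j = 0 \<and> 3 * B \<le> Q j z \<or> z = 0 \<and> 9 * A \<le> Q j z \<or> A + B \<le> Q j z"
    and b1: "j \<noteq> 0 \<Longrightarrow> A + B \<le> Q j z \<or> 9 * A \<le> Q j z" and b2: "z \<noteq> 0 \<Longrightarrow> A + B \<le> Q j z \<or> 3 * B \<le> Q j z"
    if jz: "3 dvd j - (epart z + wpart z)" for j z
  proof -
    have mono: "A * x + B * y \<le> Q j z" if "x \<le> j * j" "y \<le> enorm z" for x y
      unfolding Q_def using that pos by (intro add_mono mult_left_mono) simp_all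
    have mono': "A * x + B * y \<ge> A * x" "A * x + B * y \<ge> B * y" if "x \<ge> 0" "y \<ge> 0" for x y
      using that pos by simp_all
    show "j \<noteq> 0 \<Longrightarrow> A + B \<le> Q j z \<or> 9 * A \<le> Q j z"
    proof (cases "3 dvd j")
      case True
      assume "j \<noteq> 0"
      then show ?thesis using mono[OF sq9[OF _ True] enorm_nonneg] by simp
    next
      case False
      assume j: "j \<noteq> 0"
      have "z \<noteq> 0" using False jz by auto
      then show ?thesis using mono[OF sq1[OF j] nz1] by simp
    qed
    show "z \<noteq> 0 \<Longrightarrow> A + B \<le> Q j z \<or> 3 * B \<le> Q j z"
    proof (cases "3 dvd epart z + wpart z")
      case True
      assume "z \<noteq> 0"
      then show ?thesis using mono[OF zero_le_square nz3[OF _ True]] by simp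
    next
      case False
      assume z: "z \<noteq> 0"
      have "j \<noteq> 0"
      proof
        assume j: "j = 0"
        have "3 dvd epart z + wpart z" using jz unfolding j by presburger
        with False show False by blast
      qed
      then show ?thesis using mono[OF sq1 nz1[OF z]] by simp
    qed
    show "j = 0 \<and> z = 0 \<or> j = 0 \<and> 3 * B \<le> Q j z \<or> z = 0 \<and> 9 * A \<le> Q j z \<or> A + B \<le> Q j z"
    proof (cases "j = 0")
      case True
      have "3 dvd epart z + wpart z" using jz unfolding True by presburger
      then show ?thesis using True mono[OF zero_le_square nz3] by (cases "z = 0") simp_all
    next
      case j: False
      show ?thesis
      proof (cases "z = 0")
        case True
        then have "3 dvd j" using jz by simp
        then show ?thesis using True mono[OF sq9[OF j] enorm_nonneg] by simp
      next
        case False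
        then show ?thesis using mono[OF sq1[OF j] nz1] by simp
      qed
    qed
  qed
  have z3: "Q 0 (1 - w) = 3 * B" "Q 3 0 = 9 * A" unfolding Q_def by (simp_all add: enorm_def w_def)
  show ?thesis
  proof
    assume "well_rounded (emb ` L)"
    then obtain S where S: "S \<subseteq> minimal_vectors (emb ` L)" "independent S" "card S = DIM(real ^ 3)"
      unfolding well_rounded_def by blast
    have "A \<le> 2 * B"
    proof (rule ccontr)
      assume AB: "\<not> A \<le> 2 * B"
      define d :: "real ^ 3" where "d = vector [1, 1, 1]"
      have "d = 0"
      proof (rule orthogonal_not_full[OF S(2,3)])
        fix v assume "v \<in> S"
        then have "v \<in> minimal_vectors (emb ` L)" using S(1) by (rule rev_subsetD)
        from this[unfolded mins] obtain j z where h: "v = f j z \<and> 3 dvd j - (epart z + wpart z) \<and> Q j z \<noteq> 0 \<and>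
          (\<forall>j' z'. 3 dvd j' - (epart z' + wpart z') \<longrightarrow> Q j' z' \<noteq> 0 \<longrightarrow> Q j z \<le> Q j' z')" by (elim exE)
        have jz: "v = f j z" "3 dvd j - (epart z + wpart z)" using h by (simp_all only: simp_thms)
        note jz = jz h[THEN conjunct2, THEN conjunct2, THEN conjunct2, rule_format]
        have "Q j z \<le> 3 * B" using jz(3)[of 0 "1 - w"] unfolding z3 using pos by (simp add: w_def)
        then have "j = 0" using b1[OF jz(2)] AB pos by (cases "j = 0") auto
        then show "inner d v = 0" using emb_trace[of "M * j" "\<kappa> * z"]
          unfolding jz(1) f_def d_def inner_vec_def sum_3 by (simp add: vector_3)
      qed
      then have "d $ 1 = 0" by simp
      then show False by (simp add: d_def vector_3)
    qed
    moreover have "B \<le> 8 * A"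
    proof (rule ccontr)
      assume AB: "\<not> B \<le> 8 * A"
      define d :: "real ^ 3" where "d = vector [1, - 1, 0]"
      have "d = 0"
      proof (rule orthogonal_not_full[OF S(2,3)])
        fix v assume "v \<in> S"
        then have "v \<in> minimal_vectors (emb ` L)" using S(1) by (rule rev_subsetD)
        from this[unfolded mins] obtain j z where h: "v = f j z \<and> 3 dvd j - (epart z + wpart z) \<and> Q j z \<noteq> 0 \<and>
          (\<forall>j' z'. 3 dvd j' - (epart z' + wpart z') \<longrightarrow> Q j' z' \<noteq> 0 \<longrightarrow> Q j z \<le> Q j' z')" by (elim exE)
        have jz: "v = f j z" "3 dvd j - (epart z + wpart z)" using h by (simp_all only: simp_thms)
        note jz = jz h[THEN conjunct2, THEN conjunct2, THEN conjunct2, rule_format]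
        have "Q j z \<le> 9 * A" using jz(3)[of 3 0] unfolding z3 using pos by simp
        then have z0: "z = 0" using b2[OF jz(2)] AB pos by (cases "z = 0") auto
        have "\<sigma> (E (M * j) 0) = E (M * j) 0" unfolding \<sigma>_E by simp
        then show "inner d v = 0"
          unfolding jz(1) z0 f_def d_def inner_vec_def sum_3 by (simp add: vector_3 emb_comp)
      qed
      then have "d $ 1 = 0" by simp
      then show False by (simp add: d_def vector_3)
    qed
    ultimately show "3 * (M * M) \<le> 12 * (n * q) \<and> 6 * (n * q) \<le> 24 * (M * M)" unfolding A_def B_def by simp
  next
    assume h: "3 * (M * M) \<le> 12 * (n * q) \<and> 6 * (n * q) \<le> 24 * (M * M)"
    then have AB: "A \<le> 2 * B" "B \<le> 8 * A" unfolding A_def B_def by simp_all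
    have low: "A + B \<le> Q j z" if "3 dvd j - (epart z + wpart z)" "Q j z \<noteq> 0" for j z
      using bounds[OF that(1)] that(2) AB unfolding Q0[symmetric] by (auto simp: Q0)
    have "b0 \<in> minimal_vectors (emb ` L)" unfolding mins b0_def
      by (rule exI[of _ 1], rule exI[of _ 1]) (use low pos bQ in simp)
    moreover have "b1 \<in> minimal_vectors (emb ` L)" unfolding mins b1_def
      by (rule exI[of _ 1], rule exI[of _ w]) (use low pos bQ in \<open>simp add: w_def\<close>)
    moreover have "b2 \<in> minimal_vectors (emb ` L)" unfolding mins b2_def
      by (rule exI[of _ 1], rule exI[of _ w']) (use low pos bQ in \<open>simp add: w'_def\<close>)
    ultimately have "{b0, b1, b2} \<subseteq> minimal_vectors (emb ` L)" by simp
    moreover have "card {b0, b1, b2} = DIM(real ^ 3)" using dist by simp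
    ultimately show "well_rounded (emb ` L)" unfolding well_rounded_def using full ind by blast
  qed
qed

end

section \<open>The ideal of the given norm\<close>

text \<open>
  Used to count the cosets of an ideal by means of explicit residues.
\<close>

lemma card_image_eq_if_same_fibres:
  assumes "\<And>x y. x \<in> A \<Longrightarrow> y \<in> A \<Longrightarrow> f x = f y \<longleftrightarrow> g x = g y"
  shows "card (f ` A) = card (g ` A)"
proof (rule bij_betw_same_card)
  have i: "inv_into A f C \<in> A" "f (inv_into A f C) = C" if "C \<in> f ` A" for C
    by (rule inv_into_into[OF that], rule f_inv_into_f[OF that])
  show "bij_betw (\<lambda>C. g (inv_into A f C)) (f ` A) (g ` A)"
    unfolding bij_betw_def
  proof
    show "inj_on (\<lambda>C. g (inv_into A f C)) (f ` A)"
    proof (rule inj_onI)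
      fix C D assume C: "C \<in> f ` A" and D: "D \<in> f ` A" and "g (inv_into A f C) = g (inv_into A f D)"
      then have "f (inv_into A f C) = f (inv_into A f D)" using assms[OF i(1)[OF C] i(1)[OF D]] by (simp only:)
      then show "C = D" unfolding i(2)[OF C] i(2)[OF D] .
    qed
    have "g (inv_into A f (f x)) = g x" if x: "x \<in> A" for x
      by (rule assms[OF i(1)[OF imageI[OF x]] x, THEN iffD1, OF i(2)[OF imageI[OF x]]])
    then show "(\<lambda>C. g (inv_into A f C)) ` f ` A = g ` A" unfolding image_image by (rule image_cong[OF refl])
  qed
qed

text \<open>
  Reduction modulo the prime \<open>1 - \<omega>\<close> above \<open>3\<close>: it sends
  \<open>\<omega>\<close> to \<open>1\<close>.
\<close>

definition red :: "eis \<Rightarrow> int" where "red u = epart u + wpart u"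

lemma red_hom: "red (u + v) = red u + red v" "red (u - v) = red u - red v" "red (- u) = - red u" "red (of_int k * u) = k * red u"
  by (simp_all add: red_def algebra_simps)

lemma cong_3I: "a - b = 3 * (c :: int) \<Longrightarrow> [a = b] (mod 3)"
  unfolding cong_iff_dvd_diff by simp

lemma red_cong:
  "[red (u * v) = red u * red v] (mod 3)" "[red (econj u) = red u] (mod 3)" "[etr u = 2 * red u] (mod 3)" "[red u * red u = enorm u] (mod 3)"
proof -
  show "[red (u * v) = red u * red v] (mod 3)"
    by (rule cong_3I[of _ _ "- (wpart u * wpart v)"]) (simp add: red_def algebra_simps)
  show "[red (econj u) = red u] (mod 3)"
    by (rule cong_3I[of _ _ "- wpart u"]) (simp add: red_def)
  show "[etr u = 2 * red u] (mod 3)"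
    by (rule cong_3I[of _ _ "- wpart u"]) (simp add: red_def etr_def)
  show "[red u * red u = enorm u] (mod 3)"
    by (rule cong_3I[of _ _ "epart u * wpart u"]) (simp add: red_def enorm_def algebra_simps)
qed

lemma cube_cong_3: "[(x :: int) ^ 3 = x] (mod 3)"
proof -
  have "x mod 3 = 0 \<or> x mod 3 = 1 \<or> x mod 3 = 2" by presburger
  then have "(x mod 3) ^ 3 mod 3 = x mod 3" by (elim disjE) simp_all
  then show ?thesis unfolding cong_def power_mod .
qed

lemma nearest_multiple: fixes e N :: int assumes "N > 0" obtains z where "\<bar>2 * (e - N * z)\<bar> \<le> N"
proof -
  define r where "r = e mod N"
  have r: "0 \<le> r" "r < N" "e = N * (e div N) + r" using assms unfolding r_def by simp_all
  show ?thesis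
  proof (cases "2 * r \<le> N")
    case True
    have eq: "e - N * (e div N) = r" using r(3) by linarith
    have a: "\<bar>2 * r\<bar> \<le> N" using True r(1) by linarith
    show ?thesis by (rule that[of "e div N", unfolded eq, OF a])
  next
    case False
    have "N * (e div N + 1) = N * (e div N) + N" by (simp add: distrib_left)
    then have eq: "e - N * (e div N + 1) = r - N" using r(3) by linarith
    have a: "\<bar>2 * (r - N)\<bar> \<le> N"
    proof (rule abs_leI)
      have "2 * r < 2 * N" "0 < N" using r(1,2) by linarith+
      then show "2 * (r - N) \<le> N" unfolding right_diff_distrib by linarith
      show "- (2 * (r - N)) \<le> N" using False unfolding right_diff_distrib by linarith
    qed
    show ?thesis by (rule that[of "e div N + 1", unfolded eq, OF a])
  qed
qed

text \<open>
  Rounding both coordinates of the exact quotient leaves a remainder of norm at most three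
  quarters.
\<close>

lemma eis_division:
  assumes "\<kappa> \<noteq> 0" obtains z where "enorm (u - z * \<kappa>) < enorm \<kappa>"
proof -
  define N where "N = enorm \<kappa>"
  have N: "N > 0" using enorm_nonneg[of \<kappa>] enorm_zero[of \<kappa>] assms unfolding N_def by linarith
  obtain z1 where z1: "\<bar>2 * (epart (u * econj \<kappa>) - N * z1)\<bar> \<le> N" by (rule nearest_multiple[OF N])
  obtain z2 where z2: "\<bar>2 * (wpart (u * econj \<kappa>) - N * z2)\<bar> \<le> N" by (rule nearest_multiple[OF N])
  define e f where "e = epart (u * econj \<kappa>) - N * z1" and "f = wpart (u * econj \<kappa>) - N * z2"
  have "(u - Eis z1 z2 * \<kappa>) * econj \<kappa> = u * econj \<kappa> - Eis z1 z2 * of_int N"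
    unfolding N_def enorm_eq by (simp only: left_diff_distrib mult.assoc)
  also have "\<dots> = Eis e f" by (rule eis_eqI) (simp_all add: e_def f_def)
  finally have "enorm (u - Eis z1 z2 * \<kappa>) * N = enorm (Eis e f)"
    unfolding N_def enorm_econj[of \<kappa>, symmetric] enorm_mult[symmetric] by (simp only: enorm_econj)
  also have "\<dots> = e * e - e * f + f * f" by (simp add: enorm_def)
  finally have eq: "4 * (enorm (u - Eis z1 z2 * \<kappa>) * N) = (2 * e) * (2 * e) - (2 * e) * (2 * f) + (2 * f) * (2 * f)" by simp
  have bd: "\<bar>x * y\<bar> \<le> N * N" if "\<bar>x\<bar> \<le> N" "\<bar>y\<bar> \<le> N" for x y
    unfolding abs_mult using that N by (intro mult_mono) simp_all
  have "\<bar>2 * e\<bar> \<le> N" "\<bar>2 * f\<bar> \<le> N" using z1 z2 unfolding e_def f_def .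
  then have "4 * (enorm (u - Eis z1 z2 * \<kappa>) * N) \<le> 3 * (N * N)"
    unfolding eq using bd[of "2 * e" "2 * e"] bd[of "2 * e" "2 * f"] bd[of "2 * f" "2 * f"] by linarith
  moreover have "N * N > 0" using N by simp
  ultimately have "enorm (u - Eis z1 z2 * \<kappa>) * N < N * N" by linarith
  then have "enorm (u - Eis z1 z2 * \<kappa>) < N" using N by simp
  then show ?thesis unfolding N_def by (rule that)
qed

locale cubic_ideal = cubic_datum +
  fixes q q' :: nat
  assumes qq: "int q * int q' dvd n" and coprime_q: "coprime q q'"
begin

abbreviation "Q \<equiv> int q"
abbreviation "M \<equiv> int q * int q'"
abbreviation "s \<equiv> red \<pi>"

lemma n0: "n \<noteq> 0" using n_pos by simp

lemma q_dvd: "Q dvd n" using qq by (rule dvd_mult_left)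

lemma M_pos: "M > 0" "Q > 0" "q > 0" "q' > 0"
proof -
  have "M \<noteq> 0" using qq n0 by auto
  then show "q > 0" "q' > 0" by simp_all
  then show "M > 0" "Q > 0" by simp_all
qed

lemma divisor_mod_3: "int d dvd n \<Longrightarrow> [int d = 1] (mod 3)"
proof (induction d rule: prime_divisors_induct)
  case zero
  then show ?case using n0 by simp
next
  case (unit d)
  then show ?case by simp
next
  case (factor p d)
  have d: "int p * int d dvd n" using factor.prems by simp
  have p: "Factorial_Ring.prime (int p)" using factor.hyps by simp
  have "int p mod 3 = 1" using n_primes[OF p dvd_mult_left[OF d]] by blast
  then have "[int p = 1] (mod 3)" unfolding cong_def by simp
  from cong_mult[OF this factor.IH[OF dvd_mult_right[OF d]]] show ?case by simp
qed

lemma M_3: "[M = 1] (mod 3)" using divisor_mod_3[of "q * q'"] qq by simp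

lemma s_3: "[s * s = 1] (mod 3)"
  using red_cong(4)[of \<pi>] n_3 unfolding \<pi>_norm cong_def by simp

lemma n_cong: "[n = 1] (mod 3)" using n_3 unfolding cong_def by simp

lemma dvd_if_primes:
  assumes d: "d dvd n" and p: "\<And>p :: nat. Factorial_Ring.prime p \<Longrightarrow> int p dvd d \<Longrightarrow> int p dvd x"
  shows "d dvd x"
proof -
  obtain e where e: "n = d * e" using d by (rule dvdE)
  have e0: "e \<noteq> 0" using n0 unfolding e by auto
  have "n dvd x * e"
  proof (rule n_dvd_if_primes)
    fix pp :: int assume pp: "Factorial_Ring.prime pp" "pp dvd n"
    have pn: "0 \<le> pp \<and> Factorial_Ring.prime (nat pp)" using pp(1) by (rule prime_int_nat_transfer[THEN iffD1])
    then have ipn: "int (nat pp) = pp" by simp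
    show "pp dvd x * e"
    proof (cases "pp dvd d")
      case True
      from p[OF pn[THEN conjunct2], unfolded ipn, OF True] show ?thesis by (rule dvd_mult2)
    next
      case False
      have "pp dvd d * e" using pp(2) unfolding e .
      then have "pp dvd e" using prime_dvd_multD[OF pp(1)] False by blast
      then show ?thesis by (rule dvd_mult)
    qed
  qed
  then have "d * e dvd x * e" unfolding e .
  then have "e = 0 \<or> d dvd x" unfolding dvd_mult_cancel_right .
  then show ?thesis using e0 by blast
qed

text \<open>
  A common prime would divide \<open>\<pi>\<close>, so that its square would divide
  \<open>n\<close>.
\<close>

lemma coprime_n_part: "coprime (epart \<pi>) Q"
proof (rule ccontr)
  assume "\<not> coprime (epart \<pi>) Q"
  then have "\<not> is_unit (gcd (epart \<pi>) Q)" unfolding is_unit_gcd .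
  moreover have "gcd (epart \<pi>) Q \<noteq> 0" using M_pos(2) by simp
  ultimately obtain pp where pp: "Factorial_Ring.prime pp" "pp dvd gcd (epart \<pi>) Q"
    using prime_divisor_exists[of "gcd (epart \<pi>) Q"] by blast
  have a: "pp dvd epart \<pi>" and "pp dvd Q" using pp(2) by simp_all
  have pn: "pp dvd n" by (rule dvd_trans[OF \<open>pp dvd Q\<close> q_dvd])
  have "wpart \<pi> * wpart \<pi> = n - epart \<pi> * (epart \<pi> - wpart \<pi>)" using \<pi>_norm by (simp add: enorm_def algebra_simps)
  then have "pp dvd wpart \<pi> * wpart \<pi>" using dvd_diff[OF pn dvd_mult2[OF a]] by (simp only:)
  then have b: "pp dvd wpart \<pi>" using prime_dvd_multD[OF pp(1)] by blast
  have "pp * pp dvd epart \<pi> * epart \<pi> - epart \<pi> * wpart \<pi> + wpart \<pi> * wpart \<pi>"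
    by (intro dvd_add dvd_diff mult_dvd_mono a b)
  then have "pp * pp dvd n" using \<pi>_norm by (simp only: enorm_def)
  then show False using n_primes[OF pp(1) pn] by blast
qed

lemma Q_dvd_iff: "of_int Q dvd u * \<pi> \<longleftrightarrow> Q dvd epart \<pi> * epart u - wpart \<pi> * wpart u"
proof -
  define a b x y where "a = epart \<pi>" and "b = wpart \<pi>" and "x = epart u" and "y = wpart u"
  have 1: "of_int Q dvd u * \<pi> \<longleftrightarrow> Q dvd a * x - b * y \<and> Q dvd x * b + y * a - y * b"
    unfolding of_int_dvd_eis by (simp add: a_def b_def x_def y_def ac_simps)
  have "Q dvd x * b + y * a - y * b" if h: "Q dvd a * x - b * y"
  proof -
    have "a * (x * b + y * a - y * b) = b * (a * x - b * y) + y * n"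
      unfolding \<pi>_norm[symmetric] enorm_def a_def b_def by (simp add: algebra_simps)
    moreover have "Q dvd b * (a * x - b * y) + y * n" using h q_dvd by (intro dvd_add dvd_mult)
    ultimately have "Q dvd a * (x * b + y * a - y * b)" by (simp only:)
    moreover have "coprime Q a" using coprime_n_part unfolding a_def by (rule coprime_commute[THEN iffD1])
    ultimately show ?thesis by (simp only: coprime_dvd_mult_right_iff)
  qed
  then show ?thesis unfolding 1 unfolding a_def b_def x_def y_def by blast
qed

text \<open>
  The candidate ideal. The three conditions describe its localisations at the primes dividing
  \<open>q q'\<close>, dividing \<open>q\<close>, and at \<open>3\<close>.
\<close>

definition I0 where "I0 = {E k u | k u. M dvd k \<and> of_int Q dvd u * \<pi> \<and> 3 dvd k - s * red u}"

lemma I0_iff: "E k u \<in> I0 \<longleftrightarrow> M dvd k \<and> of_int Q dvd u * \<pi> \<and> 3 dvd k - s * red u"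
  unfolding I0_def by (auto simp: E_inj)

text \<open>
  \<open>E k u \<mapsto> k - s u\<close> is the residue map at the ramified prime above
  \<open>3\<close>; this is its multiplicativity.
\<close>

lemma residue_mult:
  "[(k * l + n * etr (u * econj v)) - s * red (of_int k * v + of_int l * u + econj (\<pi> * u * v)) = (k - s * red u) * (l - s * red v)] (mod 3)"
proof -
  have "[etr (u * econj v) = 2 * (red u * red v)] (mod 3)"
    by (rule cong_trans[OF red_cong(3) cong_mult[OF cong_refl cong_trans[OF red_cong(1) cong_mult[OF cong_refl red_cong(2)]]]])
  then have 1: "[k * l + n * etr (u * econj v) = k * l + 1 * (2 * (red u * red v))] (mod 3)"
    by (intro cong_add cong_refl cong_mult n_cong)
  have "[red (econj (\<pi> * u * v)) = s * red u * red v] (mod 3)"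
    by (rule cong_trans[OF red_cong(2) cong_trans[OF red_cong(1) cong_mult[OF red_cong(1) cong_refl]]])
  then have 2: "[s * red (of_int k * v + of_int l * u + econj (\<pi> * u * v)) = s * (k * red v + l * red u + s * red u * red v)] (mod 3)"
    unfolding red_hom by (intro cong_add cong_refl cong_mult)
  have 3: "k * l + 1 * (2 * (red u * red v)) - s * (k * red v + l * red u + s * red u * red v) =
     (k - s * red u) * (l - s * red v) + (2 * (red u * red v) - 2 * ((s * s) * (red u * red v)))"
    by (simp add: algebra_simps)
  have 4: "[(k - s * red u) * (l - s * red v) + (2 * (red u * red v) - 2 * ((s * s) * (red u * red v))) =
     (k - s * red u) * (l - s * red v) + (2 * (red u * red v) - 2 * (1 * (red u * red v)))] (mod 3)"
    by (intro cong_add cong_diff cong_mult cong_refl s_3)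
  have 5: "[k * l + n * etr (u * econj v) - s * red (of_int k * v + of_int l * u + econj (\<pi> * u * v)) =
     (k - s * red u) * (l - s * red v) + (2 * (red u * red v) - 2 * ((s * s) * (red u * red v)))] (mod 3)"
    using cong_diff[OF 1 2] unfolding 3 .
  have "[k * l + n * etr (u * econj v) - s * red (of_int k * v + of_int l * u + econj (\<pi> * u * v)) =
     (k - s * red u) * (l - s * red v) + (2 * (red u * red v) - 2 * (1 * (red u * red v)))] (mod 3)"
    by (rule cong_trans[OF 5 4])
  then show ?thesis by (simp only: mult_1 diff_self add_0_right)
qed

lemma I0_ideal: "ideal I0 R"
  unfolding ideal_iff
proof (intro conjI ballI)
  show "I0 \<subseteq> Ok" unfolding I0_def by auto
  have "E 0 0 \<in> I0" unfolding I0_iff by (simp add: red_def)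
  then show "0 \<in> I0" by (simp add: E_of_int)
next
  fix x y assume "x \<in> I0" "y \<in> I0"
  then obtain k u l v where e: "x = E k u" "y = E l v" unfolding I0_def by blast
  have x: "M dvd k" "of_int Q dvd u * \<pi>" "3 dvd k - s * red u" and y: "M dvd l" "of_int Q dvd v * \<pi>" "3 dvd l - s * red v"
    using \<open>x \<in> I0\<close> \<open>y \<in> I0\<close> unfolding e I0_iff by (simp_all only: simp_thms)
  have "k + l - s * red (u + v) = (k - s * red u) + (l - s * red v)" by (simp add: red_hom algebra_simps)
  then show "x + y \<in> I0" unfolding e E_add I0_iff distrib_right using dvd_add[OF x(1) y(1)] dvd_add[OF x(2) y(2)] dvd_add[OF x(3) y(3)] by (simp only: simp_thms)
next
  fix x y assume "x \<in> I0" "y \<in> Ok"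
  obtain k u where e: "x = E k u" using \<open>x \<in> I0\<close> unfolding I0_def by blast
  obtain l v where f: "y = E l v" using \<open>y \<in> Ok\<close> by (rule O_cases)
  have x: "M dvd k" "of_int Q dvd u * \<pi>" "3 dvd k - s * red u" using \<open>x \<in> I0\<close> unfolding e I0_iff by (simp_all only: simp_thms)
  let ?K = "k * l + n * etr (u * econj v)" and ?U = "of_int k * v + of_int l * u + econj (\<pi> * u * v)"
  have "M dvd ?K" by (intro dvd_add dvd_mult2 x qq)
  moreover have "of_int Q dvd ?U * \<pi>"
  proof -
    have e': "?U * \<pi> = of_int k * (v * \<pi>) + of_int l * (u * \<pi>) + of_int n * econj (u * v)"
      unfolding \<pi>_norm[symmetric] enorm_eq by (simp add: econj_hom algebra_simps)
    have "(of_int Q :: eis) dvd of_int k" "(of_int Q :: eis) dvd of_int n"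
      unfolding of_int_dvd_of_int_eis using dvd_mult_left[OF x(1)] q_dvd by simp_all
    note d = this
    have "of_int Q dvd of_int k * (v * \<pi>) + of_int l * (u * \<pi>) + of_int n * econj (u * v)"
      by (rule dvd_add[OF dvd_add[OF dvd_mult2[OF d(1)] dvd_mult[OF x(2)]] dvd_mult2[OF d(2)]])
    then show ?thesis unfolding e' .
  qed
  moreover have "3 dvd ?K - s * red ?U"
    unfolding cong_dvd_iff[OF residue_mult] using x(3) by (rule dvd_mult2)
  ultimately have "x * y \<in> I0" unfolding e f E_mult I0_iff by (simp only: simp_thms)
  then show "y * x \<in> I0" by (simp only: mult.commute)
qed

text \<open>
  Each coset is determined by three residues, and by the Chinese remainder theorem every triple
  occurs.
\<close>

lemma I0_card: "card (coset I0 ` Ok) = 3 * q\<^sup>2 * q'"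
proof -
  define c where "c = (\<lambda>(k, u). coset I0 (E k u))"
  define h where "h = (\<lambda>(k, u). (k mod M, (epart \<pi> * epart u - wpart \<pi> * wpart u) mod Q, (k - s * red u) mod 3))"
  have "coset I0 ` Ok = range c" unfolding Ok_def c_def by auto
  moreover have "card (range c) = card (range h)"
  proof (rule card_image_eq_if_same_fibres)
    fix x y :: "int \<times> eis"
    obtain k u where x: "x = (k, u)" by (cases x)
    obtain l v where y: "y = (l, v)" by (cases y)
    have e: "epart \<pi> * epart u - wpart \<pi> * wpart u - (epart \<pi> * epart v - wpart \<pi> * wpart v) = epart \<pi> * epart (u - v) - wpart \<pi> * wpart (u - v)"
      "k - s * red u - (l - s * red v) = (k - l) - s * red (u - v)"
      by (simp_all add: red_hom algebra_simps)
    show "c x = c y \<longleftrightarrow> h x = h y"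
      unfolding x y c_def h_def prod.case coset_eq[OF I0_ideal] E_diff I0_iff prod.inject mod_eq_dvd_iff e Q_dvd_iff ..
  qed
  moreover have "range h = {0..<M} \<times> {0..<Q} \<times> {0..<3}"
  proof (intro equalityI subsetI)
    fix z assume "z \<in> range h"
    then obtain k u where z: "z = h (k, u)" by auto
    show "z \<in> {0..<M} \<times> {0..<Q} \<times> {0..<3}" unfolding z h_def prod.case
      by (intro SigmaI; simp only: atLeastLessThan_iff pos_mod_sign pos_mod_bound M_pos zero_less_numeral simp_thms)
  next
    fix z assume "z \<in> {0..<M} \<times> {0..<Q} \<times> {0..<(3::int)}"
    then obtain i j l where z: "z = (i, j, l)" "0 \<le> i" "i < M" "0 \<le> j" "j < Q" "0 \<le> l" "l < 3" by auto
    obtain a' where a': "[epart \<pi> * a' = 1] (mod Q)" using cong_solve_coprime_int[OF coprime_n_part] by blast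
    define x where "x = a' * j"
    define k where "k = i + M * (l + s * x - i)"
    have "[(epart \<pi> * a') * j = 1 * j] (mod Q)" by (rule cong_mult[OF a' cong_refl])
    then have 2: "(epart \<pi> * x) mod Q = j" unfolding x_def cong_def using z(4,5) by (simp add: mult.assoc)
    have 1: "k mod M = i" unfolding k_def using z(2,3) by simp
    have "[k - s * x = i + 1 * (l + s * x - i) - s * x] (mod 3)"
      unfolding k_def by (intro cong_diff cong_add cong_mult cong_refl M_3)
    then have 3: "(k - s * x) mod 3 = l" unfolding cong_def using z(6,7) by simp
    have "h (k, Eis x 0) = z" unfolding h_def prod.case z(1) using 1 2 3 by (simp add: red_def)
    then show "z \<in> range h" by (rule range_eqI[OF sym])
  qed
  ultimately have "card (coset I0 ` Ok) = nat M * (nat Q * 3)" by (simp add: card_cartesian_product del: of_nat_mult)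
  moreover have "nat M = q * q'" "nat Q = q" by (simp_all only: of_nat_mult[symmetric] nat_int)
  ultimately show ?thesis by (simp only: power2_eq_square mult_ac)
qed

text \<open>
  The norm of an element of the ideal lies in the ideal, so that it is divisible by the primes
  in the norm of the ideal. As these are totally ramified, this gives the conditions on
  \<open>k\<close>; the square of \<open>q\<close> gives the condition on \<open>u\<close>.
\<close>

lemma subset_I0:
  assumes I: "ideal I R" and N: "card (coset I ` Ok) = 3 * q\<^sup>2 * q'"
  shows "I \<subseteq> I0"
proof
  fix x assume xI: "x \<in> I"
  have "x \<in> Ok" using I_closed(1)[OF I] xI by blast
  then obtain k u where x: "x = E k u" by (rule O_cases)
  note xI' = xI[unfolded x]
  have N0: "3 * q\<^sup>2 * q' > 0" using M_pos by simp
  define nx where "nx = k ^ 3 - 3 * n * k * enorm u + n * etr (u ^ 3 * \<pi>)"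
  have nx: "of_int nx \<in> I" unfolding nx_def by (rule norm_in_ideal[OF I xI'])
  have pk: "int p dvd k" if p: "Factorial_Ring.prime p" "int p dvd M" for p
  proof -
    have "p dvd q * q'" using p(2) unfolding of_nat_mult[symmetric] of_nat_dvd_iff .
    then have "p dvd (q * q') * (3 * q)" by (rule dvd_mult2)
    then have "p dvd 3 * q\<^sup>2 * q'" by (simp add: power2_eq_square mult_ac)
    then have d: "int p dvd nx" using prime_dvd_norm[OF I N N0 p(1) _ nx] by blast
    have "int p dvd n * (etr (u ^ 3 * \<pi>) - 3 * k * enorm u)" by (rule dvd_mult2[OF dvd_trans[OF p(2) qq]])
    from dvd_diff[OF d this] have "int p dvd k ^ 3" unfolding nx_def by (simp add: algebra_simps)
    then show ?thesis using prime_dvd_power[of "int p" k 3] p(1) by simp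
  qed
  have "M dvd k" by (rule dvd_if_primes[OF qq pk])
  moreover have "of_int Q dvd u * \<pi>"
  proof -
    have sq: "of_int (int p) dvd u * \<pi>" if p: "Factorial_Ring.prime p" "int p dvd Q" for p
    proof (rule square_condition[OF I N N0 p(1) _ _ xI'])
      have "p dvd q" using p(2) unfolding of_nat_dvd_iff .
      then have "p * p dvd (q * q) * (3 * q')" by (intro dvd_mult2 mult_dvd_mono)
      then show "p * p dvd 3 * q\<^sup>2 * q'" by (simp add: power2_eq_square mult_ac)
      show "int p dvd n" by (rule dvd_trans[OF p(2) q_dvd])
      show "int p dvd k" by (rule pk[OF p(1) dvd_mult2[OF p(2)]])
    qed
    show ?thesis unfolding of_int_dvd_eis
      by (intro conjI dvd_if_primes[OF q_dvd]) (use sq in \<open>simp_all only: of_int_dvd_eis\<close>)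
  qed
  moreover have "3 dvd k - s * red u"
  proof -
    have "int 3 dvd nx" by (rule prime_dvd_norm[OF I N N0 _ _ nx]) (simp_all add: mult.assoc)
    then have d: "3 dvd nx" by simp
    have "[etr (u ^ 3 * \<pi>) = 2 * (red u * s)] (mod 3)"
    proof -
      have "[red (u ^ 3) = red u ^ 3] (mod 3)" unfolding power3_eq_cube
        by (rule cong_trans[OF red_cong(1) cong_mult[OF red_cong(1) cong_refl]])
      from cong_trans[OF this cube_cong_3] have "[red (u ^ 3 * \<pi>) = red u * s] (mod 3)"
        by (rule cong_trans[OF red_cong(1) cong_mult[OF _ cong_refl]])
      then show ?thesis by (rule cong_trans[OF red_cong(3) cong_mult[OF cong_refl]])
    qed
    then have "[nx = k - 3 * n * k * enorm u + 1 * (2 * (red u * s))] (mod 3)"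
      unfolding nx_def by (intro cong_add cong_diff cong_mult cong_refl n_cong cube_cong_3)
    from d[unfolded cong_dvd_iff[OF this]]
    have "3 dvd k - 3 * n * k * enorm u + 1 * (2 * (red u * s))" .
    moreover have "k - 3 * n * k * enorm u + 1 * (2 * (red u * s)) = (k - s * red u) + 3 * (red u * s - n * k * enorm u)"
      by (simp add: algebra_simps)
    ultimately show ?thesis by (simp only: dvd_add_left_iff dvd_triv_left)
  qed
  ultimately show "x \<in> I0" unfolding x I0_iff by blast
qed

text \<open>
  An inclusion of ideals with the same finite index is an equality.
\<close>

lemma unique_I0:
  assumes I: "ideal I R" and N: "card (coset I ` Ok) = 3 * q\<^sup>2 * q'"
  shows "I = I0"
proof
  show sub: "I \<subseteq> I0" by (rule subset_I0[OF I N])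
  let ?A = "coset I ` Ok" and ?f = "\<lambda>C. coset I0 (inv_into Ok (coset I) C)"
  have fx: "?f (coset I x) = coset I0 x" if "x \<in> Ok" for x
  proof -
    have "coset I (inv_into Ok (coset I) (coset I x)) = coset I x" by (rule f_inv_into_f[OF imageI[OF that]])
    then have "inv_into Ok (coset I) (coset I x) - x \<in> I" unfolding coset_eq[OF I] .
    then show ?thesis unfolding coset_eq[OF I0_ideal] using sub by blast
  qed
  have "?f ` ?A = coset I0 ` Ok" unfolding image_image using fx by (rule image_cong[OF refl])
  then have "card (?f ` ?A) = card ?A" unfolding N by (simp only: I0_card)
  moreover have "finite ?A" using N M_pos by (intro card_ge_0_finite) simp
  ultimately have inj: "inj_on ?f ?A" by (intro eq_card_imp_inj_on)
  show "I0 \<subseteq> I"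
  proof
    fix y assume y: "y \<in> I0"
    have yO: "y \<in> Ok" "0 \<in> Ok" using I_closed(1)[OF I0_ideal] y O_closed(4)[of 0] by auto
    have "coset I0 y = coset I0 0" unfolding coset_eq[OF I0_ideal] using y by simp
    then have "?f (coset I y) = ?f (coset I 0)" unfolding fx[OF yO(1)] fx[OF yO(2)] .
    then have "coset I y = coset I 0" by (rule inj_onD[OF inj _ imageI[OF yO(1)] imageI[OF yO(2)]])
    then show "y \<in> I" unfolding coset_eq[OF I] by simp
  qed
qed

text \<open>
  The Eisenstein integers \<open>u\<close> with \<open>q\<close> dividing \<open>u \<pi>\<close>
  form an ideal, generated by an element of least norm. It contains \<open>q\<close> and the
  conjugate of \<open>\<pi>\<close>, which forces that norm to be \<open>q\<close>.
\<close>

lemma kappa_exists: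
  obtains \<kappa> where "enorm \<kappa> = Q" "\<forall>u. of_int Q dvd u * \<pi> \<longleftrightarrow> \<kappa> dvd u"
proof -
  define U where "U = {u. of_int Q dvd u * \<pi>}"
  have QU: "of_int Q \<in> U" unfolding U_def by simp
  have Q0: "(of_int Q :: eis) \<noteq> 0" unfolding of_int_eq_0_eis using M_pos(2) by simp
  define \<kappa> where "\<kappa> = (ARG_MIN (\<lambda>u. nat (enorm u)) u. u \<in> U \<and> u \<noteq> 0)"
  have ex: "of_int Q \<in> U \<and> (of_int Q :: eis) \<noteq> 0" using QU Q0 by blast
  have k: "\<kappa> \<in> U \<and> \<kappa> \<noteq> 0" unfolding \<kappa>_def by (rule arg_min_natI[where P = "\<lambda>u. u \<in> U \<and> u \<noteq> 0" and k = "of_int Q", OF ex])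
  have kmin: "nat (enorm \<kappa>) \<le> nat (enorm u)" if "u \<in> U" "u \<noteq> 0" for u
    unfolding \<kappa>_def by (rule arg_min_nat_le[where P = "\<lambda>u. u \<in> U \<and> u \<noteq> 0" and m = "\<lambda>u. nat (enorm u)", OF conjI[OF that]])
  have dv: "\<kappa> dvd u" if u: "u \<in> U" for u
  proof -
    have k0: "\<kappa> \<noteq> 0" using k by blast
    obtain z where z: "enorm (u - z * \<kappa>) < enorm \<kappa>" by (rule eis_division[OF k0])
    have d: "of_int Q dvd u * \<pi>" "of_int Q dvd \<kappa> * \<pi>" using u k unfolding U_def by blast+
    have "u - z * \<kappa> \<in> U"
      unfolding U_def mem_Collect_eq left_diff_distrib mult.assoc by (rule dvd_diff[OF d(1) dvd_mult[OF d(2)]])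
    moreover have "nat (enorm (u - z * \<kappa>)) < nat (enorm \<kappa>)"
      using z unfolding nat_less_eq_zless[OF enorm_nonneg] .
    ultimately have "u - z * \<kappa> = 0" using kmin[of "u - z * \<kappa>"] by (meson leD)
    then have "u = \<kappa> * z" by (simp add: mult.commute)
    then show ?thesis by (rule dvdI)
  qed
  have iff: "of_int Q dvd u * \<pi> \<longleftrightarrow> \<kappa> dvd u" for u
  proof
    show "of_int Q dvd u * \<pi> \<Longrightarrow> \<kappa> dvd u" using dv unfolding U_def by blast
    assume "\<kappa> dvd u"
    then obtain z where z: "u = \<kappa> * z" by (rule dvdE)
    have uz: "u * \<pi> = z * (\<kappa> * \<pi>)" unfolding z by (simp only: mult_ac)
    have "of_int Q dvd \<kappa> * \<pi>" using k unfolding U_def by blast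
    then show "of_int Q dvd u * \<pi>" unfolding uz by (rule dvd_mult)
  qed
  have mono: "enorm x dvd enorm y" if xy: "x dvd y" for x y
  proof -
    obtain z where "y = x * z" using xy by (rule dvdE)
    then show ?thesis unfolding enorm_mult[symmetric] by (simp add: enorm_mult)
  qed
  obtain n1 where n1: "n = Q * n1" using q_dvd by (rule dvdE)
  have cop: "coprime Q n1"
  proof (rule ccontr)
    assume "\<not> coprime Q n1"
    then have "\<not> is_unit (gcd Q n1)" unfolding is_unit_gcd .
    moreover have "gcd Q n1 \<noteq> 0" using M_pos(2) by simp
    ultimately obtain pp where pp: "Factorial_Ring.prime pp" "pp dvd gcd Q n1" using prime_divisor_exists[of "gcd Q n1"] by blast
    then have "pp * pp dvd n" unfolding n1 by (intro mult_dvd_mono) simp_all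
    moreover from this have "pp dvd n" by (rule dvd_mult_left)
    ultimately show False using n_primes[OF pp(1)] by blast
  qed
  have k1: "enorm \<kappa> dvd Q * Q" using mono[OF dv[OF QU]] unfolding enorm_of_int .
  have k2: "enorm \<kappa> dvd Q * n1"
  proof -
    have "of_int Q dvd econj \<pi> * \<pi>"
      using q_dvd unfolding mult.commute[of "econj \<pi>"] enorm_eq[symmetric] \<pi>_norm of_int_dvd_of_int_eis .
    then have "\<kappa> dvd econj \<pi>" unfolding iff .
    from mono[OF this] show ?thesis unfolding enorm_econj \<pi>_norm n1 .
  qed
  have "of_int Q dvd \<kappa> * \<pi>" unfolding iff by (rule dvd_refl)
  from mono[OF this] have "Q * Q dvd enorm \<kappa> * n" unfolding enorm_of_int enorm_mult \<pi>_norm .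
  then have "Q * Q dvd Q * (enorm \<kappa> * n1)" unfolding n1 by (simp only: mult_ac)
  then have "Q = 0 \<or> Q dvd enorm \<kappa> * n1" unfolding dvd_mult_cancel_left .
  then have "Q dvd enorm \<kappa> * n1" using M_pos(2) by auto
  then have "Q dvd enorm \<kappa>" using cop by (simp only: coprime_dvd_mult_left_iff)
  then obtain e where e: "enorm \<kappa> = Q * e" by (rule dvdE)
  have "e dvd Q" "e dvd n1" using k1 k2 M_pos(2) unfolding e by simp_all
  with cop have "is_unit e" by (rule coprime_common_divisor)
  moreover have "e \<ge> 0" using enorm_nonneg[of \<kappa>] M_pos(2) unfolding e by (auto simp: zero_le_mult_iff)
  ultimately have "e = 1" by (auto simp: zdvd1_eq)
  then have kQ: "enorm \<kappa> = Q" unfolding e by simp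
  have "\<forall>u. of_int Q dvd u * \<pi> \<longleftrightarrow> \<kappa> dvd u" by (intro allI iff)
  with kQ show ?thesis by (rule that)
qed

text \<open>
  The sign of \<open>\<kappa>\<close> is chosen such that the condition at \<open>3\<close>
  takes its simplest form.
\<close>

lemma I0_lattice:
  obtains \<kappa> where "enorm \<kappa> = Q" "I0 = {E (M * j) (\<kappa> * z) | j z. 3 dvd j - (epart z + wpart z)}"
proof -
  obtain \<kappa>1 where k1': "enorm \<kappa>1 = Q" "\<forall>u. of_int Q dvd u * \<pi> \<longleftrightarrow> \<kappa>1 dvd u" by (rule kappa_exists)
  note k1 = k1'(1) k1'(2)[THEN spec]
  define t where "t = s * red \<kappa>1"
  have "[t * t = 1] (mod 3)"
  proof -
    have "[(s * s) * (red \<kappa>1 * red \<kappa>1) = 1 * Q] (mod 3)"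
      using cong_mult[OF s_3 red_cong(4)[of \<kappa>1]] unfolding k1(1) .
    then have "[t * t = Q] (mod 3)" unfolding t_def by (simp add: mult_ac)
    then show ?thesis using divisor_mod_3[OF q_dvd] by (rule cong_trans)
  qed
  then have "t * t mod 3 = 1" unfolding cong_def by simp
  then have tt: "(t mod 3) * (t mod 3) mod 3 = 1" by (simp only: mod_mult_eq)
  have "t mod 3 = 0 \<or> t mod 3 = 1 \<or> t mod 3 = 2" by presburger
  with tt have t: "t mod 3 = 1 \<or> t mod 3 = 2" by auto
  obtain \<kappa> where k': "enorm \<kappa> = Q" "\<forall>u. of_int Q dvd u * \<pi> \<longleftrightarrow> \<kappa> dvd u" "[s * red \<kappa> = 1] (mod 3)"
  proof (cases "t mod 3 = 1")
    case True
    then have c: "[s * red \<kappa>1 = 1] (mod 3)" unfolding t_def cong_def by simp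
    show ?thesis by (rule that[OF k1' c])
  next
    case False
    have "- t mod 3 = 1" using False t by presburger
    then have c: "[s * red (- \<kappa>1) = 1] (mod 3)" unfolding t_def cong_def red_hom by simp
    have e: "enorm (- \<kappa>1) = Q" using k1(1) by (simp add: enorm_def)
    have d: "\<forall>u. of_int Q dvd u * \<pi> \<longleftrightarrow> - \<kappa>1 dvd u" by (intro allI) (simp only: k1(2) minus_dvd_iff)
    show ?thesis by (rule that[OF e d c])
  qed
  note k = k'(1) k'(2)[THEN spec] k'(3)
  have c: "3 dvd M * j - s * red (\<kappa> * z) \<longleftrightarrow> 3 dvd j - (epart z + wpart z)" for j z
  proof (rule cong_dvd_iff)
    have 1: "[M * j - s * red (\<kappa> * z) = 1 * j - (s * red \<kappa>) * red z] (mod 3)"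
      unfolding mult.assoc[of s "red \<kappa>"] by (intro cong_diff cong_mult cong_refl M_3 red_cong(1))
    have 2: "[1 * j - (s * red \<kappa>) * red z = 1 * j - 1 * red z] (mod 3)"
      by (intro cong_diff cong_mult cong_refl k(3))
    show "[M * j - s * red (\<kappa> * z) = j - (epart z + wpart z)] (mod 3)"
      using cong_trans[OF 1 2] by (simp only: red_def mult_1)
  qed
  have "I0 = {E (M * j) (\<kappa> * z) | j z. 3 dvd j - (epart z + wpart z)}"
  proof (intro equalityI subsetI)
    fix x assume "x \<in> I0"
    then obtain k' u where x: "x = E k' u" unfolding I0_def by blast
    have h: "M dvd k'" "\<kappa> dvd u" "3 dvd k' - s * red u" using \<open>x \<in> I0\<close> unfolding x I0_iff k(2) by (simp_all only: simp_thms)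
    obtain j where j: "k' = M * j" using h(1) by (rule dvdE)
    obtain z where z: "u = \<kappa> * z" using h(2) by (rule dvdE)
    show "x \<in> {E (M * j) (\<kappa> * z) | j z. 3 dvd j - (epart z + wpart z)}"
      using h(3) x unfolding j z c by blast
  next
    fix x assume "x \<in> {E (M * j) (\<kappa> * z) | j z. 3 dvd j - (epart z + wpart z)}"
    then obtain j z where x: "x = E (M * j) (\<kappa> * z)" "3 dvd j - (epart z + wpart z)" by blast
    show "x \<in> I0" unfolding x(1) I0_iff k(2) c using x(2) by simp
  qed
  with k(1) show ?thesis by (rule that)
qed

theorem ideal_of_given_norm:
  "nonzero_ideal F I \<and> ideal_norm F I = 3 * q\<^sup>2 * q' \<longleftrightarrow> I = I0"
proof
  assume "nonzero_ideal F I \<and> ideal_norm F I = 3 * q\<^sup>2 * q'"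
  then show "I = I0" unfolding nonzero_ideal_def ideal_norm_card using unique_I0 by blast
next
  have "E (3 * M) 0 \<in> I0" unfolding I0_iff by (simp add: red_def)
  moreover have "E (3 * M) 0 \<noteq> 0"
  proof -
    have "3 * M \<noteq> 0" using M_pos(1) by linarith
    then show ?thesis unfolding E_eq_0 by (simp only: simp_thms)
  qed
  ultimately have "I0 \<noteq> {0}" by blast
  moreover assume "I = I0"
  ultimately show "nonzero_ideal F I \<and> ideal_norm F I = 3 * q\<^sup>2 * q'"
    unfolding nonzero_ideal_def ideal_norm_card using I0_ideal I0_card by blast
qed

theorem well_rounded_I0:
  "well_rounded (canonical_embedding \<sigma> ` I0) \<longleftrightarrow> int q * int q' * int q' \<le> 4 * n \<and> n \<le> 4 * (int q * int q' * int q')"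
proof -
  obtain \<kappa> where k: "enorm \<kappa> = Q" "I0 = {E (M * j) (\<kappa> * z) | j z. 3 dvd j - (epart z + wpart z)}" by (rule I0_lattice)
  have "well_rounded (canonical_embedding \<sigma> ` I0) \<longleftrightarrow> 3 * (M * M) \<le> 12 * (n * Q) \<and> 6 * (n * Q) \<le> 24 * (M * M)"
    unfolding k(2) by (rule well_rounded_iff[OF M_pos(1) k(1) M_pos(2)])
  also have "3 * (M * M) = (3 * Q) * (Q * int q' * int q')" by (simp only: mult_ac)
  also have "24 * (M * M) = (6 * Q) * (4 * (Q * int q' * int q'))" by simp
  also have "12 * (n * Q) = (3 * Q) * (4 * n)" by simp
  also have "6 * (n * Q) = (6 * Q) * n" by simp
  finally show ?thesis using M_pos(2) by (simp only: mult_le_cancel_left_pos zero_less_mult_iff zero_less_numeral simp_thms)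
qed

end

section \<open>From the Galois group to the explicit field\<close>

text \<open>
  What \<open>\<sigma>\<close> fixes is fixed by the group it generates, hence rational. The
  group structure of the set of automorphisms is needed to deal with inverses in the generated
  group.
\<close>

lemma cyclic_cubicI:
  assumes F: "cyclic_cubic_field F" and \<sigma>: "\<sigma> \<in> carrier (gal_group F)"
    and gen: "generate (gal_group F) {\<sigma>} = carrier (gal_group F)"
  shows "cyclic_cubic F \<sigma>"
proof -
  define B where "B = BijGroup F"
  define H where "H = {\<sigma> \<in> Bij F. \<sigma> \<in> Ring.ring_hom (CC\<lparr>carrier := F\<rparr>) (CC\<lparr>carrier := F\<rparr>) \<and> (\<forall>x\<in>\<rat>. \<sigma> x = x)}"
  have G: "gal_group F = B\<lparr>carrier := H\<rparr>" unfolding gal_group_def B_def H_def ..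
  have field: "subfield F CC" and dim: "ring.dimension CC 3 \<rat> F"
    and fixed': "{x \<in> F. \<forall>\<sigma> \<in> carrier (gal_group F). \<sigma> x = x} = \<rat>"
    using F unfolding cyclic_cubic_field_def by blast+
  have cG: "carrier (gal_group F) = H" unfolding G by simp
  have fixed: "{x \<in> F. \<forall>\<sigma> \<in> H. \<sigma> x = x} = \<rat>" using fixed' unfolding cG .
  have FR: "x \<in> F" if "x \<in> \<rat>" for x using fixed that by blast
  have Hd: "f \<in> Bij F" "bij_betw f F F" "\<And>x. x \<in> F \<Longrightarrow> f x \<in> F" "\<And>x y. x \<in> F \<Longrightarrow> y \<in> F \<Longrightarrow> f (x + y) = f x + f y"
      "\<And>x y. x \<in> F \<Longrightarrow> y \<in> F \<Longrightarrow> f (x * y) = f x * f y" "\<And>x. x \<in> \<rat> \<Longrightarrow> f x = x" "inj_on f F" "f ` F = F" if f: "f \<in> H" for f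
  proof -
    show "f \<in> Bij F" "\<And>x. x \<in> \<rat> \<Longrightarrow> f x = x" using f unfolding H_def by blast+
    then show b: "bij_betw f F F" unfolding Bij_def by simp
    then show "inj_on f F" "f ` F = F" unfolding bij_betw_def by blast+
    then show "\<And>x. x \<in> F \<Longrightarrow> f x \<in> F" by blast
    have h: "f \<in> Ring.ring_hom (CC\<lparr>carrier := F\<rparr>) (CC\<lparr>carrier := F\<rparr>)" using f unfolding H_def by blast
    show "\<And>x y. x \<in> F \<Longrightarrow> y \<in> F \<Longrightarrow> f (x + y) = f x + f y" using Ring.ring_hom_add[OF h] by simp
    show "\<And>x y. x \<in> F \<Longrightarrow> y \<in> F \<Longrightarrow> f (x * y) = f x * f y" using Ring.ring_hom_mult[OF h] by simp
  qed
  have Fa: "x + y \<in> F" "x * y \<in> F" "1 \<in> F" if "x \<in> F" "y \<in> F" for x y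
  proof -
    have r: "subring F CC" using field unfolding subfield_def subdomain_def subcring_def by blast
    show "x + y \<in> F" using subringE(7)[OF r that] by simp
    show "x * y \<in> F" using subringE(6)[OF r that] by simp
    show "1 \<in> F" using subringE(3)[OF r] by simp
  qed
  interpret B: group B unfolding B_def by (rule group_BijGroup)
  have mult: "f \<otimes>\<^bsub>B\<^esub> g = compose F f g" if "f \<in> Bij F" "g \<in> Bij F" for f g
    using that unfolding B_def BijGroup_def by simp
  have invB: "inv\<^bsub>B\<^esub> f = (\<lambda>x\<in>F. inv_into F f x)" if "f \<in> Bij F" for f
    unfolding B_def by (rule inv_BijGroup[OF that])
  have HI: "f \<in> H" if "f \<in> Bij F" "\<And>x. x \<in> F \<Longrightarrow> f x \<in> F" "\<And>x y. x \<in> F \<Longrightarrow> y \<in> F \<Longrightarrow> f (x + y) = f x + f y"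
      "\<And>x y. x \<in> F \<Longrightarrow> y \<in> F \<Longrightarrow> f (x * y) = f x * f y" "\<And>x. x \<in> \<rat> \<Longrightarrow> f x = x" for f
    unfolding H_def using that by (auto intro!: Ring.ring_hom_memI)
  have sub: "subgroup H B"
  proof (rule B.subgroupI)
    show "H \<subseteq> carrier B" unfolding H_def B_def BijGroup_def by auto
    show "H \<noteq> {}" using \<sigma> unfolding G by auto
    show "inv\<^bsub>B\<^esub> f \<in> H" if f: "f \<in> H" for f
    proof -
      define g where "g = inv\<^bsub>B\<^esub> f"
      have g: "g x = inv_into F f x" if "x \<in> F" for x unfolding g_def invB[OF Hd(1)[OF f]] using that by simp
      have gF: "g x \<in> F" and fg: "f (g x) = x" if "x \<in> F" for x
        unfolding g[OF that] using inv_into_into[of x f F] f_inv_into_f[of x f F] Hd(8)[OF f] that by simp_all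
      have eq: "u = v" if "u \<in> F" "v \<in> F" "f u = f v" for u v using inj_onD[OF Hd(7)[OF f] that(3,1,2)] .
      have "g \<in> H"
      proof (rule HI)
        have "g \<in> carrier B" unfolding g_def by (rule B.inv_closed) (simp add: B_def BijGroup_def Hd(1)[OF f])
        then show "g \<in> Bij F" by (simp add: B_def BijGroup_def)
        show "g x \<in> F" if "x \<in> F" for x using gF[OF that] .
        show "g (x + y) = g x + g y" if "x \<in> F" "y \<in> F" for x y
          by (rule eq) (simp_all add: gF Fa that fg Hd(4)[OF f])
        show "g (x * y) = g x * g y" if "x \<in> F" "y \<in> F" for x y
          by (rule eq) (simp_all add: gF Fa that fg Hd(5)[OF f])
        show "g x = x" if "x \<in> \<rat>" for x
          by (rule eq) (simp_all add: gF FR that fg Hd(6)[OF f])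
      qed
      then show ?thesis unfolding g_def .
    qed
    show "f \<otimes>\<^bsub>B\<^esub> g \<in> H" if f: "f \<in> H" and g: "g \<in> H" for f g
    proof -
      have "compose F f g \<in> H"
      proof (rule HI)
        have "f \<otimes>\<^bsub>B\<^esub> g \<in> carrier B" by (rule B.m_closed) (simp_all add: B_def BijGroup_def Hd(1)[OF f] Hd(1)[OF g])
        then show "compose F f g \<in> Bij F" unfolding mult[OF Hd(1)[OF f] Hd(1)[OF g]] by (simp add: B_def BijGroup_def)
      qed (simp_all add: compose_def Hd[OF f] Hd[OF g] Fa FR)
      then show ?thesis unfolding mult[OF Hd(1)[OF f] Hd(1)[OF g]] .
    qed
  qed
  have \<sigma>H: "\<sigma> \<in> H" using \<sigma> unfolding cG .
  have gen_fixed: "h x = x" if h: "h \<in> generate (gal_group F) {\<sigma>}" and x: "x \<in> F" "\<sigma> x = x" for h x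
    using h
  proof (induction h rule: generate.induct)
    case one
    have "\<one>\<^bsub>gal_group F\<^esub> = (\<lambda>x\<in>F. x)" unfolding gal_group_def BijGroup_def by simp
    then show ?case using x(1) by simp
  next
    case (incl h)
    then show ?case using x(2) by simp
  next
    case (inv h)
    have i: "inv\<^bsub>gal_group F\<^esub> \<sigma> = inv\<^bsub>B\<^esub> \<sigma>" unfolding G by (rule B.m_inv_consistent[OF sub \<sigma>H])
    have "(inv\<^bsub>gal_group F\<^esub> \<sigma>) x = inv_into F \<sigma> x"
      unfolding i invB[OF Hd(1)[OF \<sigma>H]] using x(1) by simp
    also have "\<dots> = inv_into F \<sigma> (\<sigma> x)" by (simp only: x(2))
    also have "\<dots> = x" by (rule inv_into_f_f[OF Hd(7)[OF \<sigma>H] x(1)])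
    finally show ?case using inv by simp
  next
    case (eng h k)
    have hk: "h \<in> H" "k \<in> H" using eng.hyps by (simp_all only: gen cG)
    have "h \<otimes>\<^bsub>gal_group F\<^esub> k = compose F h k" unfolding G using mult[OF Hd(1)[OF hk(1)] Hd(1)[OF hk(2)]] by simp
    then show ?case using eng.IH x(1) by (simp add: compose_def)
  qed
  show ?thesis
  proof (rule cyclic_cubic.intro)
    fix x assume x: "x \<in> F" "\<sigma> x = x"
    have "h x = x" if h: "h \<in> H" for h
      by (rule gen_fixed[OF _ x]) (use h in \<open>simp only: gen cG\<close>)
    then show "x \<in> \<rat>" using fixed x(1) by blast
  qed (rule field dim Hd(3-7)[OF \<sigma>H]; assumption)+
qed

lemma prod_primes_squarefree:
  fixes p :: "nat \<Rightarrow> nat" and pp :: int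
  assumes A: "finite A" "inj_on p A" and p: "\<And>i. i \<in> A \<Longrightarrow> Factorial_Ring.prime (p i) \<and> [p i = 1] (mod 3)"
    and pp: "Factorial_Ring.prime pp" "pp dvd int (\<Prod>i\<in>A. p i)"
  shows "pp mod 3 = 1 \<and> \<not> pp * pp dvd int (\<Prod>i\<in>A. p i)"
proof -
  define l where "l = nat pp"
  have ln: "0 \<le> pp \<and> Factorial_Ring.prime (nat pp)" using pp(1) by (rule prime_int_nat_transfer[THEN iffD1])
  then have l: "pp = int l" "Factorial_Ring.prime l" unfolding l_def by simp_all
  have div: "\<exists>i\<in>C. l = p i" if C: "C \<subseteq> A" "l dvd (\<Prod>i\<in>C. p i)" for C
  proof -
    have "finite C" using A(1) C(1) by (rule rev_finite_subset)
    then obtain i where i: "i \<in> C" "l dvd p i" using C(2) prime_dvd_prod_iff[OF _ l(2)] by blast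
    have "l = p i" by (rule primes_dvd_imp_eq[OF l(2) _ i(2)]) (use p i(1) C(1) in blast)
    then show ?thesis using i(1) by blast
  qed
  have "l dvd (\<Prod>i\<in>A. p i)" using pp(2) unfolding l(1) of_nat_dvd_iff .
  then obtain i where i: "i \<in> A" "l = p i" using div[OF subset_refl] by blast
  have "l mod 3 = 1" using p[OF i(1)] unfolding i(2) cong_def by simp
  then have "int (l mod 3) = int 1" by (simp only:)
  then have "pp mod 3 = 1" unfolding l(1) by (simp add: zmod_int)
  moreover have "\<not> pp * pp dvd int (\<Prod>i\<in>A. p i)"
  proof
    assume "pp * pp dvd int (\<Prod>i\<in>A. p i)"
    then have "l * l dvd (\<Prod>i\<in>A. p i)" unfolding l(1) of_nat_mult[symmetric] of_nat_dvd_iff .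
    then have "l * l dvd l * (\<Prod>i\<in>A - {i}. p i)" unfolding prod.remove[OF A(1) i(1)] i(2) .
    then have "l dvd (\<Prod>i\<in>A - {i}. p i)" using l(2) by auto
    then obtain j where "j \<in> A - {i}" "l = p j" using div[of "A - {i}"] by blast
    then show False using inj_onD[OF A(2), of i j] i by auto
  qed
  ultimately show ?thesis by blast
qed

theorem theorem1p3:
  fixes F :: "complex set" and \<sigma> :: "complex \<Rightarrow> complex"
    and p :: "nat \<Rightarrow> nat" and r m q q' :: nat
  assumes "cyclic_cubic_field F"
    and "\<sigma> \<in> carrier (gal_group F)"
    and "generate (gal_group F) {\<sigma>} = carrier (gal_group F)"
    and "r \<ge> 2"
    and "inj_on p {1..r}"
    and "\<forall>i\<in>{1..r}. Factorial_Ring.prime (p i) \<and> [p i = 1] (mod 3)"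
    and "m = 9 * (\<Prod>i=1..r. p i)"
    and "is_conductor F m"
    and "q dvd (\<Prod>i=1..r. p i)"
    and "q' dvd (\<Prod>i=1..r. p i)"
    and "coprime q q'"
  shows "(\<exists>!I. nonzero_ideal F I \<and> ideal_norm F I = 3 * q\<^sup>2 * q') \<and>
         (\<forall>I. nonzero_ideal F I \<and> ideal_norm F I = 3 * q\<^sup>2 * q' \<longrightarrow>
              (well_rounded (canonical_embedding \<sigma> ` I) \<longleftrightarrow>
                 real m / 36 \<le> real (q * q'\<^sup>2) \<and> real (q * q'\<^sup>2) \<le> 4 * real m / 9))"
proof -
  define n where "n = (\<Prod>i=1..r. p i)"
  have pr: "Factorial_Ring.prime (p i) \<and> [p i = 1] (mod 3)" if "i \<in> {1..r}" for i using assms(6) that by blast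
  interpret cyclic_cubic F \<sigma> by (rule cyclic_cubicI[OF assms(1-3)])
  have "[n = (\<Prod>i=1..r. 1)] (mod 3)" unfolding n_def by (rule cong_prod) (use pr in blast)
  then have n3: "n mod 3 = 1" unfolding cong_def by simp
  have mn: "m = 9 * n" unfolding n_def by (rule assms(7))
  interpret cubic_conductor F \<sigma> n m by unfold_locales (fact mn n3 assms(8))+
  obtain \<theta> and a b :: int where \<theta>: "\<theta> * cnj \<theta> = of_nat n" "\<theta> ^ 3 = of_nat n * (of_int a + of_int b * \<omega>)"
    "a\<^sup>2 - a * b + b\<^sup>2 = int n" "\<not> 3 dvd b"
    "\<theta> + cnj \<theta> \<in> F" "\<sigma> (\<theta> + cnj \<theta>) = \<omega>\<^sup>2 * \<theta> + cnj (\<omega>\<^sup>2 * \<theta>)"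
    "\<sigma> (\<sigma> (\<theta> + cnj \<theta>)) = \<omega> * \<theta> + cnj (\<omega> * \<theta>)" by (rule gauss_generator)
  have "q * q' dvd n" unfolding n_def by (rule divides_mult[OF assms(9-11)])
  then have qn: "int q * int q' dvd int n" unfolding of_nat_mult[symmetric] of_nat_dvd_iff .
  interpret cubic_ideal F \<sigma> \<theta> "Eis a b" "int n" q q'
  proof
    show "\<theta> * cnj \<theta> = of_int (int n)" "\<theta> ^ 3 = of_int (int n) * eC (Eis a b)" using \<theta>(1,2) by (simp_all add: eC_def)
    show "enorm (Eis a b) = int n" using \<theta>(3) by (simp add: enorm_def power2_eq_square)
    show "\<not> 3 dvd wpart (Eis a b)" using \<theta>(4) by simp
    show "0 < int n" using n3 by (cases n) simp_all
    show "int n mod 3 = 1" using arg_cong[OF n3, of int] by (simp add: zmod_int)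
    show "pp mod 3 = 1 \<and> \<not> pp * pp dvd int n" if "Factorial_Ring.prime pp" "pp dvd int n" for pp
      using prod_primes_squarefree[OF finite_atLeastAtMost assms(5) pr that[unfolded n_def]] unfolding n_def .
  qed (fact \<theta>(5-7) qn assms(11))+
  have real_n: "real m = 9 * real n" unfolding assms(7) n_def by simp
  have e1: "int q * int q' * int q' \<le> 4 * int n \<longleftrightarrow> real (q * q'\<^sup>2) \<le> 4 * real m / 9"
  proof -
    have "int q * int q' * int q' \<le> 4 * int n \<longleftrightarrow> int (q * q'\<^sup>2) \<le> int (4 * n)" by (simp add: power2_eq_square mult_ac)
    also have "\<dots> \<longleftrightarrow> real (q * q'\<^sup>2) \<le> real (4 * n)" by (simp only: of_nat_le_iff)
    finally show ?thesis unfolding real_n by simp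
  qed
  have e2: "int n \<le> 4 * (int q * int q' * int q') \<longleftrightarrow> real m / 36 \<le> real (q * q'\<^sup>2)"
  proof -
    have "int n \<le> 4 * (int q * int q' * int q') \<longleftrightarrow> int n \<le> int (4 * (q * q'\<^sup>2))" by (simp add: power2_eq_square mult_ac)
    also have "\<dots> \<longleftrightarrow> real n \<le> real (4 * (q * q'\<^sup>2))" by (simp only: of_nat_le_iff)
    also have "\<dots> \<longleftrightarrow> real n \<le> 4 * real (q * q'\<^sup>2)" by (simp only: of_nat_mult of_nat_numeral)
    finally show ?thesis unfolding real_n by (simp only:) linarith
  qed
  have wr: "well_rounded (canonical_embedding \<sigma> ` I0) \<longleftrightarrow>
      real m / 36 \<le> real (q * q'\<^sup>2) \<and> real (q * q'\<^sup>2) \<le> 4 * real m / 9"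
    unfolding well_rounded_I0 e1 e2 by (rule conj_commute)
  show ?thesis unfolding ideal_of_given_norm
    by (intro conjI allI impI ex1I[of _ I0] refl) (simp_all only: wr)
qed

end
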